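(* Let $1\le k\le n-1$ be integers and let $f$ be a non-negative, bounded, integrable function on $\mathbb{R}^n$. Set $$ \Phi(f)=\int_{G_{n,k}}\frac{\left(\int_E f(x)\,dx\right)^n}{\|f|_E\|_\infty^{\,n-k}}\,d\mu_{n,k}(E),\qquad \Psi(f)=\int_{M_{n,k}}\frac{\left(\int_F f(x)\,dx\right)^{n+1}}{\|f|_F\|_\infty^{\,n-k}}\,d\nu_{n,k}(F). $$ Then $\Phi(f\circ g^{-1})=\Phi(f)$ for every volume-preserving linear transformation $g$ of $\mathbb{R}^n$, and $\Psi(f\circ g^{-1})=\Psi(f)$ for every volume-preserving affine transformation $g$ of $\mathbb{R}^n$.
   Context: $G_{n,k}$ is the Grassmannian of $k$-dimensional linear subspaces of $\mathbb{R}^n$ with Haar probability measure $\mu_{n,k}$. $M_{n,k}$ is the affine Grassmannian of $k$-dimensional affine subspaces of $\mathbb{R}^n$ with the measure $\nu_{n,k}(A)=\int_{G_{n,k}}|\{x\in E^\perp: x+E\in A\}|\,d\mu_{n,k}(E)$. Integrals over $E$, $F$ and the $L^\infty$-norms of the restrictions $f|_E$, $f|_F$ are with respect to $k$-dimensional Lebesgue measure. The integrands are read as $0$ when the $L^\infty$-norm in the denominator is $0$. *)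

theory Defs
  imports "HOL-Probability.Probability"
begin

definition grassmannian :: "nat \<Rightarrow> 'a::euclidean_space set set" where
  "grassmannian k = {E. subspace E \<and> dim E = k}"

definition affine_grassmannian :: "nat \<Rightarrow> 'a::euclidean_space set set" where
  "affine_grassmannian k = {F. affine F \<and> aff_dim F = int k}"

text \<open>
  On a space of flats of one fixed dimension, the sets of all flats meeting a given open set form
  a subbasis of the usual (quotient) topology. That topology is second countable, so these sets
  generate its Borel sigma-algebra.
\<close>

definition flats_borel :: "'a::euclidean_space set set \<Rightarrow> 'a set measure" where
  "flats_borel \<F> = sigma \<F> {{F \<in> \<F>. F \<inter> U \<noteq> {}} | U. open U}"

text \<open>
  Since the orthogonal group acts transitively on the Grassmannian, there is exactly one invariant
  Borel probability measure, so the description below is proper for \<open>k \<le> DIM('a)\<close>.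
\<close>

definition grassmannian_haar :: "nat \<Rightarrow> 'a::euclidean_space set measure" where
  "grassmannian_haar k = (THE \<mu>.
     sets \<mu> = sets (flats_borel (grassmannian k)) \<and> prob_space \<mu> \<and>
     (\<forall>U::'a \<Rightarrow> 'a. orthogonal_transformation U \<longrightarrow> distr \<mu> \<mu> ((`) U) = \<mu>))"

definition orthonormal_basis_of :: "'a::euclidean_space set \<Rightarrow> 'a set \<Rightarrow> bool" where
  "orthonormal_basis_of B V \<longleftrightarrow> pairwise orthogonal B \<and> (\<forall>b\<in>B. norm b = 1) \<and> span B = V"

definition direction :: "'a::euclidean_space set \<Rightarrow> 'a set" where
  "direction F = {x - y | x y. x \<in> F \<and> y \<in> F}"

text \<open>
  Lebesgue measure of dimension \<open>dim (direction F)\<close> on a nonempty affine subspace \<open>F\<close>, as a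
  complete measure on the ambient space concentrated on \<open>F\<close>. It is transported by Cartesian
  coordinates, in the way \<^const>\<open>lborel\<close> is built from \<^const>\<open>Basis\<close>; the result
  does not depend on the chosen origin and orthonormal basis. The completion is needed because
  \<^const>\<open>esssup\<close> is \<^const>\<open>top\<close> for functions that are not measurable.
\<close>

definition flat_lebesgue :: "'a::euclidean_space set \<Rightarrow> 'a measure" where
  "flat_lebesgue F =
     (let a = (SOME a. a \<in> F); B = (SOME B. orthonormal_basis_of B (direction F))
      in completion
           (distr (\<Pi>\<^sub>M b\<in>B. (lborel :: real measure)) borel (\<lambda>c. a + (\<Sum>b\<in>B. c b *\<^sub>R b))))"

definition affine_grassmannian_measure :: "nat \<Rightarrow> 'a::euclidean_space set measure" where
  "affine_grassmannian_measure k =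
     measure_of (affine_grassmannian k) (sets (flats_borel (affine_grassmannian k)))
       (\<lambda>A. \<integral>\<^sup>+ E. emeasure (flat_lebesgue (E\<^sup>\<bottom>)) {x \<in> E\<^sup>\<bottom>. (\<lambda>y. x + y) ` E \<in> A}
              \<partial>grassmannian_haar k)"

definition flat_integral :: "'a::euclidean_space set \<Rightarrow> ('a \<Rightarrow> real) \<Rightarrow> ennreal" where
  "flat_integral F f = (\<integral>\<^sup>+ x. ennreal (f x) \<partial>flat_lebesgue F)"

definition flat_Linf_norm :: "'a::euclidean_space set \<Rightarrow> ('a \<Rightarrow> real) \<Rightarrow> ennreal" where
  "flat_Linf_norm F f = esssup (flat_lebesgue F) (\<lambda>x. ennreal \<bar>f x\<bar>)"

definition Phi :: "nat \<Rightarrow> (real ^ 'n \<Rightarrow> real) \<Rightarrow> ennreal" where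
  "Phi k f = (\<integral>\<^sup>+ E.
     (if flat_Linf_norm E f = 0 then 0
      else flat_integral E f ^ CARD('n) / flat_Linf_norm E f ^ (CARD('n) - k))
     \<partial>grassmannian_haar k)"

definition Psi :: "nat \<Rightarrow> (real ^ 'n \<Rightarrow> real) \<Rightarrow> ennreal" where
  "Psi k f = (\<integral>\<^sup>+ F.
     (if flat_Linf_norm F f = 0 then 0
      else flat_integral F f ^ (CARD('n) + 1) / flat_Linf_norm F f ^ (CARD('n) - k))
     \<partial>affine_grassmannian_measure k)"

definition volume_preserving :: "('a::euclidean_space \<Rightarrow> 'a) \<Rightarrow> bool" where
  "volume_preserving g \<longleftrightarrow>
     (\<forall>A\<in>sets lebesgue. g ` A \<in> sets lebesgue \<and> emeasure lebesgue (g ` A) = emeasure lebesgue A)"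

text \<open>
  A linear or affine map that preserves volume is automatically bijective, so bijectivity is not
  required separately.
\<close>

definition affine_map :: "('a::real_vector \<Rightarrow> 'b::real_vector) \<Rightarrow> bool" where
  "affine_map g \<longleftrightarrow> (\<exists>h c. linear h \<and> g = (\<lambda>x. h x + c))"

end

theory Submission
  imports Defs
begin

text \<open>
  A linear bijection \<open>g\<close> multiplies Lebesgue measure on a \<open>k\<close>-dimensional subspace \<open>E\<close> by a
  factor \<open>J(E)\<close>, while essential suprema do not change. So the integrand of \<open>\<Phi>\<close> for
  \<open>f \<circ> g\<inverse>\<close> at \<open>g E\<close> is \<open>J(E)\<^sup>n\<close> times the one for \<open>f\<close> at \<open>E\<close>, and it remains to see that,
  for \<open>\<bar>det g\<bar> = 1\<close>, the Haar measure has density \<open>J(E)\<^sup>-\<^sup>n\<close> under \<open>E \<mapsto> g E\<close>.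
  Realise the Haar measure as the law of the span of \<open>k\<close> independent vectors, uniform in the unit
  ball, written as the columns of a matrix \<open>y\<close>. Left multiplication \<open>y \<mapsto> g y\<close> preserves Lebesgue
  measure on matrices, and in the chart \<open>y = (1; x) a\<close>, where the span depends on \<open>x\<close> only,
  integrating out the \<open>k \<times> k\<close> matrix \<open>a\<close> gives a constant times the \<open>-n\<close>th power of the volume
  of the parallelepiped spanned by \<open>g (1; x)\<close>; the ratio of these volumes for \<open>g\<close> and for the
  identity is \<open>J\<close>. For affine subspaces, the measure on translates of \<open>E\<close> acquires one more factor
  \<open>J(E)\<close>, because the Jacobians on \<open>E\<close> and on the quotient by \<open>E\<close> multiply to \<open>1\<close>.
\<close>

subsection \<open>Product measures on vectors and matrices\<close>

text \<open>Two obstacles shape the proof. First, \<open>f\<close> is only Lebesgue measurable on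
  R^n, so its restriction to a single flat, and the integrands of \<open>Phi\<close> and
  \<open>Psi\<close> as functions of the flat, may fail to be measurable. All integrals are then
  lower integrals, so the density formulas, proved for measurable integrands, must be carried over
  along bimeasurable bijections. Second, the Haar measure is a definite description: existence and
  uniqueness are both owed, and invariance under isometries is the Jacobian 1 case of the density
  formula itself. The exponent n is a sum: under \<open>a -> s a\<close> Lebesgue measure on k x k
  matrices contributes k determinant factors and the chart contributes n - k. To avoid types
  depending on k, everything lives in R^n and in n x n matrices, padded by zeros outside an index
  set \<open>I\<close> with k elements. Jacobians are encoded by volumes of bodies rather than Gram
  determinants, so that their scaling laws and their measurability in \<open>E\<close> follow from
  linear substitution and Fubini.\<close>

definition vec_measure :: "('n::finite \<Rightarrow> 'a::euclidean_space measure) \<Rightarrow> ('a ^ 'n) measure" where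
  "vec_measure N = distr (\<Pi>\<^sub>M i\<in>UNIV. N i) borel vec_lambda"

definition borel_sf :: "'a::topological_space measure \<Rightarrow> bool" where
  "borel_sf N \<longleftrightarrow> sets N = sets borel \<and> sigma_finite_measure N"

lemma measurable_vec_lambda_PiM:
  fixes N :: "'n::finite \<Rightarrow> 'a::euclidean_space measure"
  assumes "\<And>i. sets (N i) = sets borel"
  shows "vec_lambda \<in> (\<Pi>\<^sub>M i\<in>UNIV. N i) \<rightarrow>\<^sub>M borel"
proof (subst borel_measurable_euclidean_space, rule ballI)
  fix b :: "'a ^ 'n" assume "b \<in> Basis"
  then obtain i u where b: "b = axis i u" by (auto simp: Basis_vec_def)
  have [measurable]: "(\<lambda>f. f i) \<in> (\<Pi>\<^sub>M i\<in>UNIV. N i) \<rightarrow>\<^sub>M borel"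
    using measurable_component_singleton[of i UNIV N] assms[of i]
    by (simp cong: measurable_cong_sets)
  show "(\<lambda>x. vec_lambda x \<bullet> b) \<in> borel_measurable (\<Pi>\<^sub>M i\<in>UNIV. N i)"
    unfolding b by (simp add: inner_axis)
qed

lemma vec_nth_borel [measurable]:
  "(\<lambda>x :: 'a::euclidean_space ^ 'n::finite. x $ i) \<in> borel \<rightarrow>\<^sub>M borel"
  by (intro borel_measurable_continuous_onI continuous_intros)

lemma borel_measurable_vec_lambda [measurable (raw)]:
  fixes f :: "'x \<Rightarrow> 'n::finite \<Rightarrow> 'a::euclidean_space"
  assumes "\<And>i. (\<lambda>x. f x i) \<in> M \<rightarrow>\<^sub>M borel"
  shows "(\<lambda>x. \<chi> i. f x i) \<in> M \<rightarrow>\<^sub>M borel"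
proof (subst borel_measurable_euclidean_space, rule ballI)
  fix b :: "'a ^ 'n" assume "b \<in> Basis"
  then obtain i u where b: "b = axis i u" by (auto simp: Basis_vec_def)
  note assms[measurable]
  show "(\<lambda>x. (\<chi> i. f x i) \<bullet> b) \<in> borel_measurable M"
    unfolding b by (simp add: inner_axis)
qed

lemma sets_vec_measure [simp, measurable_cong]: "sets (vec_measure N) = sets borel"
  and space_vec_measure [simp]: "space (vec_measure N) = UNIV"
  by (simp_all add: vec_measure_def)

lemma measurable_nth_PiM:
  fixes N :: "'n::finite \<Rightarrow> 'a::euclidean_space measure"
  assumes "\<And>i. sets (N i) = sets borel"
  shows "(\<lambda>x. \<lambda>i. x $ i) \<in> borel \<rightarrow>\<^sub>M (\<Pi>\<^sub>M i\<in>UNIV. N i)"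
proof (rule measurable_PiM_single')
  show "(\<lambda>x. x $ i) \<in> borel \<rightarrow>\<^sub>M N i" for i
    using vec_nth_borel[of i] by (simp add: assms cong: measurable_cong_sets)
  show "(\<lambda>x. ($) x) \<in> space borel \<rightarrow> (\<Pi>\<^sub>E i\<in>UNIV. space (N i))"
    using assms[THEN sets_eq_imp_space_eq] by auto
qed

lemma emeasure_vec_measure_box:
  fixes N :: "'n::finite \<Rightarrow> 'a::euclidean_space measure"
  assumes N: "\<And>i. borel_sf (N i)" and A: "\<And>i. A i \<in> sets borel"
  shows "emeasure (vec_measure N) {x. \<forall>i. x $ i \<in> A i} = (\<Prod>i\<in>UNIV. emeasure (N i) (A i))"
proof -
  interpret product_sigma_finite N
    using N by (simp add: product_sigma_finite_def borel_sf_def)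
  have [simp]: "sets (N i) = sets borel" for i using N by (simp add: borel_sf_def)
  have [simp]: "space (N i) = UNIV" for i using sets_eq_imp_space_eq[of "N i" borel] by simp
  have "{x :: 'a ^ 'n. \<forall>i. x $ i \<in> A i} = (\<Inter>i. (\<lambda>x. x $ i) -` A i \<inter> space borel)" by auto
  also have "\<dots> \<in> sets borel"
    by (intro sets.finite_INT) (auto intro: measurable_sets[OF vec_nth_borel A, simplified])
  finally have B: "{x. \<forall>i. x $ i \<in> A i} \<in> sets (borel :: ('a ^ 'n) measure)" .
  have "emeasure (vec_measure N) {x. \<forall>i. x $ i \<in> A i} = emeasure (\<Pi>\<^sub>M i\<in>UNIV. N i)
      (vec_lambda -` {x. \<forall>i. x $ i \<in> A i} \<inter> space (\<Pi>\<^sub>M i\<in>UNIV. N i))"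
    unfolding vec_measure_def by (rule emeasure_distr[OF measurable_vec_lambda_PiM B]) simp
  also have "vec_lambda -` {x. \<forall>i. x $ i \<in> A i} \<inter> space (\<Pi>\<^sub>M i\<in>UNIV. N i) = (\<Pi>\<^sub>E i\<in>UNIV. A i)"
    by (auto simp: space_PiM)
  finally show ?thesis using A by (simp add: emeasure_PiM)
qed

text \<open>Box values suffice: \<open>M\<close> is carried to the function space, where
  \<open>PiM_eqI\<close> identifies it, and \<open>vec_lambda\<close> carries it back.\<close>

lemma vec_measure_eqI:
  fixes N :: "'n::finite \<Rightarrow> 'a::euclidean_space measure"
  assumes N: "\<And>i. borel_sf (N i)" and M: "sets M = sets borel"
    and eq: "\<And>A. (\<And>i. A i \<in> sets borel) \<Longrightarrow>
      emeasure M {x. \<forall>i. x $ i \<in> A i} = (\<Prod>i\<in>UNIV. emeasure (N i) (A i))"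
  shows "M = vec_measure N"
proof -
  interpret product_sigma_finite N
    using N by (simp add: product_sigma_finite_def borel_sf_def)
  have [simp]: "sets (N i) = sets borel" for i using N by (simp add: borel_sf_def)
  have [simp]: "space (N i) = UNIV" for i using sets_eq_imp_space_eq[of "N i" borel] by simp
  have sM: "space M = UNIV" using sets_eq_imp_space_eq[OF M] by simp
  have mn: "(\<lambda>x i. x $ i) \<in> M \<rightarrow>\<^sub>M (\<Pi>\<^sub>M i\<in>UNIV. N i)"
    using measurable_nth_PiM[of N] M by (simp cong: measurable_cong_sets)
  have P: "distr M (\<Pi>\<^sub>M i\<in>UNIV. N i) (\<lambda>x i. x $ i) = (\<Pi>\<^sub>M i\<in>UNIV. N i)"
  proof (rule PiM_eqI)
    fix A assume A: "\<And>i. i \<in> UNIV \<Longrightarrow> A i \<in> sets (N i)"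
    have "emeasure (distr M (\<Pi>\<^sub>M i\<in>UNIV. N i) (\<lambda>x i. x $ i)) (\<Pi>\<^sub>E i\<in>UNIV. A i)
      = emeasure M ((\<lambda>x i. x $ i) -` (\<Pi>\<^sub>E i\<in>UNIV. A i) \<inter> space M)"
      using A by (intro emeasure_distr[OF mn] sets_PiM_I_finite) auto
    also have "(\<lambda>x i. x $ i) -` (\<Pi>\<^sub>E i\<in>UNIV. A i) \<inter> space M = {x. \<forall>i. x $ i \<in> A i}"
      by (auto simp: sM)
    finally show "emeasure (distr M (\<Pi>\<^sub>M i\<in>UNIV. N i) (\<lambda>x i. x $ i)) (\<Pi>\<^sub>E i\<in>UNIV. A i)
      = (\<Prod>i\<in>UNIV. emeasure (N i) (A i))"
      using A by (simp add: eq)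
  qed auto
  have "vec_measure N = distr (distr M (\<Pi>\<^sub>M i\<in>UNIV. N i) (\<lambda>x i. x $ i)) borel vec_lambda"
    by (simp add: P vec_measure_def)
  also have "\<dots> = distr M borel (\<lambda>x. x)"
    by (subst distr_distr[OF measurable_vec_lambda_PiM mn]) (auto simp: comp_def)
  also have "\<dots> = M"
    by (rule measure_eqI) (auto simp: M emeasure_distr measurable_def sM)
  finally show ?thesis by simp
qed

text \<open>Boxes whose sides come from countable covers of the factors by sets of finite measure
  form such a cover of the product.\<close>

lemma borel_sf_vec_measure [simp, intro]:
  fixes N :: "'n::finite \<Rightarrow> 'a::euclidean_space measure"
  assumes N: "\<And>i. borel_sf (N i)"
  shows "borel_sf (vec_measure N)"
  unfolding borel_sf_def
proof (safe; (simp; fail)?)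
  have [simp]: "sets (N i) = sets borel" "space (N i) = UNIV" for i
    using N sets_eq_imp_space_eq[of "N i" borel] by (auto simp add: borel_sf_def)
  have "\<exists>F :: 'n \<Rightarrow> 'a set set. \<forall>i. countable (F i) \<and> F i \<subseteq> sets borel \<and> \<Union>(F i) = UNIV \<and>
      (\<forall>a\<in>F i. emeasure (N i) a \<noteq> \<infinity>)"
    using N by (intro choice allI) (auto simp: borel_sf_def sigma_finite_measure_def)
  then obtain F :: "'n \<Rightarrow> 'a set set" where F: "\<And>i. countable (F i)" "\<And>i. F i \<subseteq> sets borel"
    "\<And>i. \<Union>(F i) = UNIV" "\<And>i a. a \<in> F i \<Longrightarrow> emeasure (N i) a \<noteq> \<infinity>" by metis
  define G where "G = (\<lambda>A. {x :: 'a ^ 'n. \<forall>i. x $ i \<in> A i}) ` (\<Pi>\<^sub>E i\<in>UNIV. F i)"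
  have m: "{x :: 'a ^ 'n. \<forall>i. x $ i \<in> A i} \<in> sets borel" if "A \<in> (\<Pi>\<^sub>E i\<in>UNIV. F i)" for A
  proof -
    have [measurable]: "A i \<in> sets borel" for i using that F(2)[of i] by (auto simp: PiE_iff)
    show ?thesis by measurable
  qed
  have "\<Union>G = UNIV"
  proof safe
    fix x :: "'a ^ 'n"
    have "\<exists>A. \<forall>i. A i \<in> F i \<and> x $ i \<in> A i" using F(3) by (intro choice) blast
    then show "x \<in> \<Union>G" by (auto simp: G_def)
  qed auto
  moreover have "emeasure (vec_measure N) a \<noteq> \<infinity>" if "a \<in> G" for a
  proof -
    from that obtain A where A: "a = {x :: 'a ^ 'n. \<forall>i. x $ i \<in> A i}" and "A \<in> (\<Pi>\<^sub>E i\<in>UNIV. F i)"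
      unfolding G_def by (elim imageE)
    then have A2: "\<And>i. A i \<in> F i" by auto
    have "emeasure (vec_measure N) a = (\<Prod>i\<in>UNIV. emeasure (N i) (A i))"
      unfolding A using A2 F(2) by (intro emeasure_vec_measure_box N) blast
    then show ?thesis using F(4) A2 by (simp add: ennreal_prod_eq_top)
  qed
  moreover have "countable G" unfolding G_def using F(1) by (intro countable_image countable_PiE) auto
  moreover have "G \<subseteq> sets (vec_measure N)" using m by (auto simp: G_def)
  ultimately show "sigma_finite_measure (vec_measure N)"
    unfolding sigma_finite_measure_def space_vec_measure by blast
qed

lemma ennreal_cancel_left: "1 / a * (a * x) = x" if "a \<noteq> 0" "a \<noteq> top" for a x :: ennreal
proof -
  have "1 / a * (a * x) = x * a / a" by (simp add: ennreal_times_divide mult.commute)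
  with that show ?thesis by (simp add: mult_divide_eq_ennreal)
qed

lemma ennreal_cancel_right: "a * (1 / a * x) = x" if "a \<noteq> 0" "a \<noteq> top" for a x :: ennreal
proof -
  have "a * (1 / a * x) = 1 / a * (a * x)" by (rule mult.left_commute)
  also have "\<dots> = x" using that by (rule ennreal_cancel_left)
  finally show ?thesis .
qed

text \<open>Common source of the rules below for translations, scalings, coordinate projections and
  row-wise linear maps. The image measure divided by the product of the \<open>c i\<close> has the
  box values of the original measure.\<close>

lemma nn_integral_vec_measure_map:
  fixes N :: "'n::finite \<Rightarrow> 'a::euclidean_space measure"
  assumes N: "\<And>i. borel_sf (N i)" and T[measurable]: "\<And>i. T i \<in> borel \<rightarrow>\<^sub>M borel"
    and c: "\<And>i A. A \<in> sets borel \<Longrightarrow> emeasure (N i) (T i -` A) = c i * emeasure (N i) A"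
    and c0: "\<And>i. c i \<noteq> 0" "\<And>i. c i \<noteq> top"
    and F[measurable]: "F \<in> borel_measurable borel"
  shows "(\<integral>\<^sup>+x. F (\<chi> i. T i (x $ i)) \<partial>vec_measure N) = (\<Prod>i\<in>UNIV. c i) * (\<integral>\<^sup>+x. F x \<partial>vec_measure N)"
proof -
  let ?g = "\<lambda>x. \<chi> i. T i (x $ i)"
  let ?c = "\<Prod>i\<in>UNIV. c i"
  have [measurable]: "?g \<in> borel \<rightarrow>\<^sub>M borel" by measurable
  have c1: "?c \<noteq> 0" "?c \<noteq> top" using c0 by (auto simp: ennreal_prod_eq_top)
  have "scale_measure (1 / ?c) (distr (vec_measure N) borel ?g) = vec_measure N"
  proof (rule vec_measure_eqI[OF N])
    fix A :: "'n \<Rightarrow> 'a set" assume A[measurable]: "\<And>i. A i \<in> sets borel"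
    have [measurable]: "{x. \<forall>i. x $ i \<in> A i} \<in> sets borel" by measurable
    have "emeasure (distr (vec_measure N) borel ?g) {x. \<forall>i. x $ i \<in> A i}
      = emeasure (vec_measure N) {x. \<forall>i. x $ i \<in> T i -` A i}"
      by (subst emeasure_distr) (auto simp: vimage_def)
    also have "\<dots> = (\<Prod>i\<in>UNIV. emeasure (N i) (T i -` A i))"
      using measurable_sets_borel[OF T A] by (intro emeasure_vec_measure_box N) auto
    also have "\<dots> = ?c * (\<Prod>i\<in>UNIV. emeasure (N i) (A i))"
      by (simp add: c A prod.distrib)
    finally show "emeasure (scale_measure (1 / ?c) (distr (vec_measure N) borel ?g)) {x. \<forall>i. x $ i \<in> A i}
        = (\<Prod>i\<in>UNIV. emeasure (N i) (A i))"
      using c1 by (simp add: ennreal_cancel_left)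
  qed simp
  then have "(\<integral>\<^sup>+x. F x \<partial>vec_measure N) = (\<integral>\<^sup>+x. F x \<partial>scale_measure (1 / ?c) (distr (vec_measure N) borel ?g))"
    by simp
  also have "\<dots> = 1 / ?c * (\<integral>\<^sup>+x. F (?g x) \<partial>vec_measure N)"
    by (subst nn_integral_scale_measure) (auto simp: nn_integral_distr)
  finally show ?thesis using c1 by (simp add: ennreal_cancel_right)
qed

abbreviation dirac0 :: "'a::euclidean_space measure" where "dirac0 \<equiv> return borel 0"

lemma borel_sf_dirac [simp]: "borel_sf (dirac0 :: 'a::euclidean_space measure)"
  by (simp add: borel_sf_def prob_space_return prob_space_imp_sigma_finite)

lemma borel_sf_lborel [simp]: "borel_sf (lborel :: 'a::euclidean_space measure)"
  by (simp add: borel_sf_def lborel.sigma_finite_measure_axioms)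

text \<open>Coordinates outside \<open>I\<close> carry the point mass at 0, so measures on R^I live
  on the fixed type R^n and \<open>I\<close> can vary without a change of type.\<close>

definition on_coords :: "'n set \<Rightarrow> 'a::euclidean_space measure \<Rightarrow> 'n \<Rightarrow> 'a measure" where
  "on_coords I N i = (if i \<in> I then N else dirac0)"

lemma borel_sf_on_coords [simp]: "borel_sf N \<Longrightarrow> borel_sf (on_coords I N i)"
  by (simp add: on_coords_def)

lemma nn_integral_vec_measure_split:
  fixes N :: "'a::euclidean_space measure"
  assumes N: "borel_sf N" and RS: "R \<union> S = UNIV" "R \<inter> S = {}"
    and F[measurable]: "F \<in> borel_measurable borel"
  shows "(\<integral>\<^sup>+x. F x \<partial>vec_measure (\<lambda>_::'n::finite. N)) =
    (\<integral>\<^sup>+x. \<integral>\<^sup>+y. F (\<chi> i. if i \<in> R then x $ i else y $ i) \<partial>vec_measure (on_coords S N) \<partial>vec_measure (on_coords R N))"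
proof -
  let ?X = "vec_measure (on_coords R N)" and ?Y = "vec_measure (on_coords S N)"
  let ?g = "\<lambda>(x, y). (\<chi> i. if i \<in> R then x $ i else y $ i) :: 'a ^ 'n"
  have bs: "borel_sf ?X" "borel_sf ?Y" using N by auto
  interpret X: sigma_finite_measure ?X using bs by (simp add: borel_sf_def)
  interpret Y: sigma_finite_measure ?Y using bs by (simp add: borel_sf_def)
  have sN: "sets N = sets borel" using N by (simp add: borel_sf_def)
  have [measurable]: "?g \<in> ?X \<Otimes>\<^sub>M ?Y \<rightarrow>\<^sub>M borel" by measurable
  have S: "i \<in> S \<longleftrightarrow> i \<notin> R" for i using RS by auto
  have "distr (?X \<Otimes>\<^sub>M ?Y) borel ?g = vec_measure (\<lambda>_. N)"
  proof (rule vec_measure_eqI[OF N])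
    fix A :: "'n \<Rightarrow> 'a set" assume A[measurable]: "\<And>i. A i \<in> sets borel"
    \<comment> \<open>Off its own index set each factor imposes no condition; the point mass gives
      \<open>UNIV\<close> mass 1.\<close>
    let ?BX = "{x :: 'a ^ 'n. \<forall>i. x $ i \<in> (if i \<in> R then A i else UNIV)}"
    let ?BY = "{x :: 'a ^ 'n. \<forall>i. x $ i \<in> (if i \<in> S then A i else UNIV)}"
    have [measurable]: "{x. \<forall>i. x $ i \<in> A i} \<in> sets borel" by measurable
    have m: "?BX \<in> sets ?X" "?BY \<in> sets ?Y"
      by (simp, measurable)+
    have "emeasure (distr (?X \<Otimes>\<^sub>M ?Y) borel ?g) {x. \<forall>i. x $ i \<in> A i} = emeasure (?X \<Otimes>\<^sub>M ?Y) (?BX \<times> ?BY)"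
      by (subst emeasure_distr)
         (auto simp: space_pair_measure S split: if_splits intro!: arg_cong[where f="emeasure (?X \<Otimes>\<^sub>M ?Y)"])
    also have "\<dots> = emeasure ?X ?BX * emeasure ?Y ?BY"
      by (rule Y.emeasure_pair_measure_Times[OF m])
    also have "emeasure ?X ?BX = (\<Prod>i\<in>UNIV. emeasure (on_coords R N i) (if i \<in> R then A i else UNIV))"
      using N by (intro emeasure_vec_measure_box) auto
    also have "emeasure ?Y ?BY = (\<Prod>i\<in>UNIV. emeasure (on_coords S N i) (if i \<in> S then A i else UNIV))"
      using N by (intro emeasure_vec_measure_box) auto
    also have "(\<Prod>i\<in>UNIV. emeasure (on_coords R N i) (if i \<in> R then A i else UNIV)) *
       (\<Prod>i\<in>UNIV. emeasure (on_coords S N i) (if i \<in> S then A i else UNIV)) = (\<Prod>i\<in>UNIV. emeasure N (A i))"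
      unfolding prod.distrib[symmetric] by (intro prod.cong) (auto simp: on_coords_def S)
    finally show "emeasure (distr (?X \<Otimes>\<^sub>M ?Y) borel ?g) {x. \<forall>i. x $ i \<in> A i} = (\<Prod>i\<in>UNIV. emeasure N (A i))" .
  qed simp
  then have "(\<integral>\<^sup>+x. F x \<partial>vec_measure (\<lambda>_::'n. N)) = (\<integral>\<^sup>+x. F x \<partial>distr (?X \<Otimes>\<^sub>M ?Y) borel ?g)"
    by simp
  also have "\<dots> = (\<integral>\<^sup>+p. F (?g p) \<partial>(?X \<Otimes>\<^sub>M ?Y))" by (rule nn_integral_distr) auto
  also have "\<dots> = (\<integral>\<^sup>+x. \<integral>\<^sup>+y. F (?g (x, y)) \<partial>?Y \<partial>?X)"
    by (rule Y.nn_integral_fst[symmetric]) measurable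
  finally show ?thesis by simp
qed

text \<open>An iterated product is characterised by boxes with arbitrary Borel sets of rows, while
  only boxes of entries are given here. Both measures are therefore identified as the image of a
  single product over index pairs.\<close>

lemma matrix_measure_eqI:
  fixes N :: "'n::finite \<Rightarrow> 'm::finite \<Rightarrow> real measure"
  assumes N: "\<And>i j. borel_sf (N i j)" and M: "sets M = sets borel"
    and eq: "\<And>A. (\<And>i j. A i j \<in> sets borel) \<Longrightarrow>
      emeasure M {x. \<forall>i j. x $ i $ j \<in> A i j} = (\<Prod>i\<in>UNIV. \<Prod>j\<in>UNIV. emeasure (N i j) (A i j))"
  shows "M = vec_measure (\<lambda>i. vec_measure (N i))"
proof -
  let ?N = "\<lambda>(i, j). N i j"
  let ?P = "PiM UNIV ?N"
  let ?g = "\<lambda>x :: real ^ 'm ^ 'n. \<lambda>(i, j). x $ i $ j"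
  let ?h = "\<lambda>f. (\<chi> i j. f (i, j)) :: real ^ 'm ^ 'n"
  interpret product_sigma_finite ?N
    using N by (auto simp add: product_sigma_finite_def borel_sf_def)
  have [simp]: "sets (N i j) = sets borel" for i j using N by (simp add: borel_sf_def)
  have [simp]: "space (N i j) = UNIV" for i j using sets_eq_imp_space_eq[of "N i j" borel] by simp
  have g: "?g \<in> borel \<rightarrow>\<^sub>M ?P"
  proof (rule measurable_PiM_single')
    show "(\<lambda>x. ?g x p) \<in> borel \<rightarrow>\<^sub>M ?N p" for p
      by (cases p) (simp cong: measurable_cong_sets)
  qed (auto simp: case_prod_beta)
  have h: "?h \<in> ?P \<rightarrow>\<^sub>M borel"
  proof -
    have [measurable]: "(\<lambda>f. f (i, j)) \<in> ?P \<rightarrow>\<^sub>M borel" for i j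
      using measurable_component_singleton[of "(i, j)" UNIV ?N] by (simp cong: measurable_cong_sets)
    show ?thesis by measurable
  qed
  \<comment> \<open>Proved for an arbitrary candidate, because it is applied both to
    \<open>M\<close> and to the iterated product.\<close>
  have *: "M' = distr ?P borel ?h" if M': "sets M' = sets borel"
    and eq': "\<And>A. (\<And>i j. A i j \<in> sets borel) \<Longrightarrow>
      emeasure M' {x. \<forall>i j. x $ i $ j \<in> A i j} = (\<Prod>i\<in>UNIV. \<Prod>j\<in>UNIV. emeasure (N i j) (A i j))" for M'
  proof -
    have g': "?g \<in> M' \<rightarrow>\<^sub>M ?P" using g M' by (simp cong: measurable_cong_sets)
    have sM: "space M' = UNIV" using sets_eq_imp_space_eq[OF M'] by simp
    have "distr M' ?P ?g = ?P"
    proof (rule PiM_eqI)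
      fix A assume "\<And>p. p \<in> UNIV \<Longrightarrow> A p \<in> sets (?N p)"
      then have A: "A (i, j) \<in> sets borel" for i j by force
      have A': "A p \<in> sets (?N p)" for p using A by (cases p) auto
      have "emeasure (distr M' ?P ?g) (Pi\<^sub>E UNIV A) = emeasure M' (?g -` Pi\<^sub>E UNIV A \<inter> space M')"
        using A' by (intro emeasure_distr[OF g'] sets_PiM_I_finite) auto
      also have "?g -` Pi\<^sub>E UNIV A \<inter> space M' = {x. \<forall>i j. x $ i $ j \<in> A (i, j)}"
        by (auto simp: sM PiE_iff)
      also have "emeasure M' \<dots> = (\<Prod>p\<in>UNIV \<times> UNIV. emeasure (?N p) (A p))"
        using A by (subst eq') (auto simp: prod.cartesian_product intro!: prod.cong)
      finally show "emeasure (distr M' ?P ?g) (Pi\<^sub>E UNIV A) = (\<Prod>p\<in>UNIV. emeasure (?N p) (A p))"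
        by simp
    qed auto
    then have "distr ?P borel ?h = distr (distr M' ?P ?g) borel ?h" by simp
    also have "\<dots> = distr M' borel (\<lambda>x. x)"
      by (subst distr_distr[OF h g']) (auto simp: comp_def)
    also have "\<dots> = M'"
      by (rule measure_eqI) (auto simp: M' emeasure_distr measurable_def sM)
    finally show ?thesis by simp
  qed
  have "vec_measure (\<lambda>i. vec_measure (N i)) = distr ?P borel ?h"
  proof (rule *)
    fix A :: "'n \<Rightarrow> 'm \<Rightarrow> real set" assume A[measurable]: "\<And>i j. A i j \<in> sets borel"
    have "{x :: real ^ 'm ^ 'n. \<forall>i j. x $ i $ j \<in> A i j} = {x. \<forall>i. x $ i \<in> {r. \<forall>j. r $ j \<in> A i j}}" by simp
    also have "emeasure (vec_measure (\<lambda>i. vec_measure (N i))) \<dots> = (\<Prod>i\<in>UNIV. emeasure (vec_measure (N i)) {r. \<forall>j. r $ j \<in> A i j})"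
      using N by (intro emeasure_vec_measure_box) auto
    also have "\<dots> = (\<Prod>i\<in>UNIV. \<Prod>j\<in>UNIV. emeasure (N i j) (A i j))"
      using N by (intro prod.cong emeasure_vec_measure_box) auto
    finally show "emeasure (vec_measure (\<lambda>i. vec_measure (N i))) {x. \<forall>i j. x $ i $ j \<in> A i j} = (\<Prod>i\<in>UNIV. \<Prod>j\<in>UNIV. emeasure (N i j) (A i j))" .
  qed simp
  with *[OF M eq] show ?thesis by simp
qed

lemma nn_integral_transpose:
  fixes N :: "'n::finite \<Rightarrow> 'm::finite \<Rightarrow> real measure"
  assumes N: "\<And>i j. borel_sf (N i j)" and F[measurable]: "F \<in> borel_measurable borel"
  shows "(\<integral>\<^sup>+x. F (transpose x) \<partial>vec_measure (\<lambda>i. vec_measure (N i))) =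
    (\<integral>\<^sup>+x. F x \<partial>vec_measure (\<lambda>j. vec_measure (\<lambda>i. N i j)))"
proof -
  let ?M = "vec_measure (\<lambda>i. vec_measure (N i))"
  have [measurable]: "(transpose :: real ^ 'm ^ 'n \<Rightarrow> _) \<in> borel \<rightarrow>\<^sub>M borel"
    unfolding transpose_def by measurable
  have "distr ?M borel transpose = vec_measure (\<lambda>j. vec_measure (\<lambda>i. N i j))"
  proof (rule matrix_measure_eqI)
    fix A :: "'m \<Rightarrow> 'n \<Rightarrow> real set" assume A[measurable]: "\<And>i j. A i j \<in> sets borel"
    have [measurable]: "{x :: real ^ 'n ^ 'm. \<forall>i j. x $ i $ j \<in> A i j} \<in> sets borel" by measurable
    have "emeasure (distr ?M borel transpose) {x. \<forall>i j. x $ i $ j \<in> A i j} =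
        emeasure ?M {x. \<forall>i. x $ i \<in> {r. \<forall>j. r $ j \<in> A j i}}"
      by (subst emeasure_distr) (auto simp: transpose_def intro!: arg_cong[where f="emeasure ?M"])
    also have "\<dots> = (\<Prod>i\<in>UNIV. emeasure (vec_measure (N i)) {r. \<forall>j. r $ j \<in> A j i})"
      using N by (intro emeasure_vec_measure_box) auto
    also have "\<dots> = (\<Prod>i\<in>UNIV. \<Prod>j\<in>UNIV. emeasure (N i j) (A j i))"
      using N by (intro prod.cong emeasure_vec_measure_box) auto
    also have "\<dots> = (\<Prod>j\<in>UNIV. \<Prod>i\<in>UNIV. emeasure (N i j) (A j i))" by (rule prod.swap)
    finally show "emeasure (distr ?M borel transpose) {x. \<forall>i j. x $ i $ j \<in> A i j} = \<dots>" .
  qed (use N in auto)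
  then show ?thesis by (subst nn_integral_distr[of _ ?M borel, symmetric]) auto
qed

subsection \<open>Linear substitutions\<close>

lemma lborel_vec_measure: "(lborel :: (real ^ 'n::finite) measure) = vec_measure (\<lambda>_. lborel)"
proof (rule lborel_eqI)
  fix l u :: "real ^ 'n" assume lu: "\<And>b. b \<in> Basis \<Longrightarrow> l \<bullet> b \<le> u \<bullet> b"
  have le: "l $ i \<le> u $ i" for i using lu[of "axis i 1"] by (simp add: inner_axis)
  have B: "(Basis :: (real ^ 'n) set) = (\<lambda>i. axis i 1) ` UNIV" by (auto simp: Basis_vec_def)
  have "box l u = {x. \<forall>i. x $ i \<in> {l $ i <..< u $ i}}" by (auto simp: mem_box_cart)
  then have "emeasure (vec_measure (\<lambda>_. lborel)) (box l u) = (\<Prod>i\<in>UNIV. ennreal (u $ i - l $ i))"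
    using emeasure_vec_measure_box[of "\<lambda>_::'n. lborel" "\<lambda>i. {l $ i <..< u $ i}"] le by simp
  also have "\<dots> = ennreal (\<Prod>i\<in>UNIV. u $ i - l $ i)"
    using le by (intro prod_ennreal) simp
  also have "(\<Prod>i\<in>UNIV. u $ i - l $ i) = (\<Prod>b\<in>Basis. (u - l) \<bullet> b)"
    unfolding B by (subst prod.reindex) (auto simp: inj_on_def axis_eq_axis inner_axis)
  finally show "emeasure (vec_measure (\<lambda>_. lborel)) (box l u) = ennreal (\<Prod>b\<in>Basis. (u - l) \<bullet> b)" .
qed simp

lemma emeasure_vimage_eq:
  assumes "sets M = sets borel" "T \<in> borel \<rightarrow>\<^sub>M borel" "A \<in> sets borel"
  shows "emeasure M (T -` A) = (\<integral>\<^sup>+x. indicator A (T x) \<partial>M)"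
proof -
  have "emeasure M (T -` A) = (\<integral>\<^sup>+x. indicator (T -` A) x \<partial>M)"
    using assms measurable_sets_borel[of T borel A] by simp
  then show ?thesis by (simp add: indicator_vimage)
qed

lemma matrix_vector_mult_borel [measurable (raw)]:
  fixes f :: "'x \<Rightarrow> real ^ 'n::finite ^ 'm::finite" and g :: "'x \<Rightarrow> real ^ 'n"
  assumes "f \<in> M \<rightarrow>\<^sub>M borel" "g \<in> M \<rightarrow>\<^sub>M borel"
  shows "(\<lambda>x. f x *v g x) \<in> M \<rightarrow>\<^sub>M borel"
  using assms unfolding matrix_vector_mult_def by measurable

lemma matrix_matrix_mult_borel [measurable (raw)]:
  fixes f :: "'x \<Rightarrow> real ^ 'n::finite ^ 'm::finite" and g :: "'x \<Rightarrow> real ^ 'k::finite ^ 'n"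
  assumes "f \<in> M \<rightarrow>\<^sub>M borel" "g \<in> M \<rightarrow>\<^sub>M borel"
  shows "(\<lambda>x. f x ** g x) \<in> M \<rightarrow>\<^sub>M borel"
  using assms unfolding matrix_matrix_mult_def by measurable

lemma transpose_borel [measurable (raw)]:
  fixes f :: "'x \<Rightarrow> real ^ 'n::finite ^ 'm::finite"
  assumes "f \<in> M \<rightarrow>\<^sub>M borel"
  shows "(\<lambda>x. transpose (f x)) \<in> M \<rightarrow>\<^sub>M borel"
  using assms unfolding transpose_def by measurable

lemma det_borel [measurable (raw)]:
  fixes f :: "'x \<Rightarrow> real ^ 'n::finite ^ 'n"
  assumes "f \<in> M \<rightarrow>\<^sub>M borel"
  shows "(\<lambda>x. det (f x)) \<in> M \<rightarrow>\<^sub>M borel"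
  using assms unfolding det_def by measurable

section \<open>Coordinate projections, square blocks and their determinants\<close>

definition cproj :: "'n::finite set \<Rightarrow> real ^ 'n ^ 'n" where
  "cproj I = (\<chi> i j. if i = j \<and> i \<in> I then 1 else 0)"

lemma cproj_mult_vec: "cproj I *v x = (\<chi> i. if i \<in> I then x $ i else 0)"
  by (auto simp: cproj_def matrix_vector_mult_def vec_eq_iff if_distrib[of "\<lambda>c. c * _"] sum.delta' cong: if_cong)

lemma cproj_mult_nth: "(cproj I ** X) $ i = (if i \<in> I then X $ i else 0)"
  by (auto simp: cproj_def matrix_matrix_mult_def vec_eq_iff if_distrib[of "\<lambda>c. c * _"] sum.delta' cong: if_cong)

lemma transpose_cproj [simp]: "transpose (cproj I) = cproj I"
  by (auto simp: cproj_def transpose_def vec_eq_iff)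

lemma mult_cproj_nth: "(X ** cproj I) $ i = (\<chi> j. if j \<in> I then X $ i $ j else 0)"
proof -
  have "X ** cproj I = transpose (cproj I ** transpose X)" by (simp add: matrix_transpose_mul)
  then show ?thesis by (simp add: transpose_def cproj_mult_nth vec_eq_iff)
qed

lemma cproj_UNIV [simp]: "cproj UNIV = mat 1" and cproj_empty [simp]: "cproj {} = 0"
  by (auto simp: cproj_def mat_def vec_eq_iff)

lemma cproj_mult_cproj: "cproj I ** cproj J = cproj (I \<inter> J)"
  by (auto simp: vec_eq_iff cproj_mult_nth) (auto simp: cproj_def)

lemma cproj_idem [simp]: "cproj I ** cproj I = cproj I"
  by (simp add: cproj_mult_cproj)

lemma cproj_compl [simp]: "cproj I ** cproj (- I) = 0" "cproj (- I) ** cproj I = 0"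
  by (simp_all add: cproj_mult_cproj)

lemma cproj_add_compl: "cproj I + cproj (- I) = mat 1"
  by (auto simp: cproj_def mat_def vec_eq_iff)

lemma cproj_idem_vec [simp]: "cproj I *v (cproj I *v x) = cproj I *v x"
  by (simp add: matrix_vector_mul_assoc)

lemma matrix_zero_mult [simp]: "(0 :: real ^ 'n::finite ^ 'm::finite) ** X = 0" "X ** (0 :: real ^ 'n ^ 'm) = 0"
  by (auto simp: matrix_matrix_mult_def vec_eq_iff)

text \<open>Square matrices indexed by \<open>I\<close> live in the full matrix space, padded by zeros;
  \<open>bdet I\<close> is the absolute value of their determinant.\<close>

definition block :: "'n::finite set \<Rightarrow> real ^ 'n ^ 'n \<Rightarrow> bool" where
  "block I a \<longleftrightarrow> cproj I ** a = a \<and> a ** cproj I = a"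

definition bdet :: "'n::finite set \<Rightarrow> real ^ 'n ^ 'n \<Rightarrow> real" where
  "bdet I a = \<bar>det (a + cproj (- I))\<bar>"

lemma blockD: "block I a \<Longrightarrow> cproj I ** a = a" "block I a \<Longrightarrow> a ** cproj I = a"
  by (auto simp: block_def)

lemma matrix_matrix_add_rdistrib: "(A + B) ** C = A ** C + B ** (C :: real ^ 'n::finite ^ 'm::finite)"
  by (simp add: matrix_matrix_mult_def vec_eq_iff distrib_right sum.distrib)

lemma block_compl: assumes "block I a" shows "cproj (- I) ** a = 0" "a ** cproj (- I) = 0"
proof -
  have "cproj (- I) ** (cproj I ** a) = 0" by (simp add: matrix_mul_assoc)
  then show "cproj (- I) ** a = 0" using assms by (simp add: block_def)
  have "(a ** cproj I) ** cproj (- I) = 0" by (simp add: matrix_mul_assoc[symmetric])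
  then show "a ** cproj (- I) = 0" using assms by (simp add: block_def)
qed

lemma block_cproj [simp]: "block I (cproj I)" by (simp add: block_def)

lemma block_conj_cproj [simp]: "block I (cproj I ** a ** cproj I)"
  unfolding block_def by (metis cproj_idem matrix_mul_assoc)

lemma block_UNIV [simp]: "block UNIV a" by (simp add: block_def)

lemma block_transpose [simp]: "block I (transpose a) = block I a"
  unfolding block_def by (metis matrix_transpose_mul transpose_cproj transpose_transpose)

lemma bdet_UNIV [simp]: "bdet UNIV a = \<bar>det a\<bar>" by (simp add: bdet_def)

lemma bdet_nonneg [simp]: "0 \<le> bdet I a" by (simp add: bdet_def)

lemma bdet_transpose [simp]: "bdet I (transpose a) = bdet I a"
proof -
  have "transpose (a + cproj (- I)) = transpose a + cproj (- I)"
    by (auto simp: transpose_def vec_eq_iff cproj_def)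
  then show ?thesis by (metis bdet_def det_transpose)
qed

text \<open>\<open>a + cproj (- I)\<close> extends \<open>a\<close> by the identity on the
  complement. The cross terms vanish for blocks, so the extension is multiplicative.\<close>

lemma bdet_mult: assumes "block I a" "block I b" shows "bdet I (a ** b) = bdet I a * bdet I b"
proof -
  have "(a + cproj (- I)) ** (b + cproj (- I)) = a ** b + cproj (- I)"
    using block_compl[OF assms(1)] block_compl[OF assms(2)]
    by (simp add: matrix_add_ldistrib matrix_matrix_add_rdistrib)
  then show ?thesis by (simp add: bdet_def det_mul[symmetric] abs_mult[symmetric])
qed

lemma bdet_cproj [simp]: "bdet I (cproj I) = 1"
  by (simp add: bdet_def cproj_add_compl)

lemma bdet_borel [measurable (raw)]:
  assumes "f \<in> M \<rightarrow>\<^sub>M borel" shows "(\<lambda>x. bdet I (f x)) \<in> M \<rightarrow>\<^sub>M borel"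
  using assms unfolding bdet_def by measurable

section \<open>Lebesgue measure on coordinate subspaces\<close>

definition clebesgue :: "'n::finite set \<Rightarrow> (real ^ 'n) measure" where
  "clebesgue I = vec_measure (on_coords I lborel)"

lemma sets_clebesgue [simp, measurable_cong]: "sets (clebesgue I) = sets borel"
  and space_clebesgue [simp]: "space (clebesgue I) = UNIV"
  by (simp_all add: clebesgue_def)

lemma borel_sf_clebesgue [simp]: "borel_sf (clebesgue I)"
  unfolding clebesgue_def by (intro borel_sf_vec_measure) simp

lemma sigma_finite_clebesgue: "sigma_finite_measure (clebesgue I)"
  using borel_sf_clebesgue[of I] by (simp add: borel_sf_def)

lemma clebesgue_UNIV: "clebesgue UNIV = lborel"
  by (simp add: clebesgue_def lborel_vec_measure on_coords_def[abs_def])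

text \<open>The measure is concentrated on vectors vanishing off \<open>I\<close>, so projecting the
  argument changes nothing.\<close>

lemma nn_integral_clebesgue_cproj:
  assumes F[measurable]: "F \<in> borel_measurable borel"
  shows "(\<integral>\<^sup>+c. F (cproj I *v c) \<partial>clebesgue I) = (\<integral>\<^sup>+c. F c \<partial>clebesgue I)"
proof -
  let ?T = "\<lambda>i x. if i \<in> I then x else (0::real)"
  have "(\<integral>\<^sup>+c. F (\<chi> i. ?T i (c $ i)) \<partial>clebesgue I) = (\<Prod>i\<in>(UNIV::'a set). 1) * (\<integral>\<^sup>+c. F c \<partial>clebesgue I)"
    unfolding clebesgue_def
    by (intro nn_integral_vec_measure_map) (auto simp: on_coords_def indicator_def)
  then show ?thesis by (simp add: cproj_mult_vec)
qed

lemma nn_integral_lborel_split: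
  fixes F :: "real ^ 'n::finite \<Rightarrow> ennreal"
  assumes F[measurable]: "F \<in> borel_measurable borel"
  shows "(\<integral>\<^sup>+x. F x \<partial>lborel) = (\<integral>\<^sup>+c. \<integral>\<^sup>+w. F (cproj I *v c + cproj (- I) *v w) \<partial>clebesgue (- I) \<partial>clebesgue I)"
proof -
  have "(\<chi> i. if i \<in> I then c $ i else w $ i) = cproj I *v c + cproj (- I) *v w" for c w :: "real ^ 'n"
    by (auto simp: cproj_mult_vec vec_eq_iff)
  then show ?thesis
    unfolding clebesgue_def lborel_vec_measure
    by (subst nn_integral_vec_measure_split[of lborel I "- I"]) auto
qed

lemma nn_integral_clebesgue_add:
  assumes F[measurable]: "F \<in> borel_measurable borel"
  shows "(\<integral>\<^sup>+c. F (c + cproj I *v d) \<partial>clebesgue I) = (\<integral>\<^sup>+c. F c \<partial>clebesgue I)"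
proof -
  let ?T = "\<lambda>i x. x + (if i \<in> I then d $ i else (0::real))"
  have l: "emeasure lborel ((\<lambda>x. x + t) -` A) = emeasure lborel A" if "A \<in> sets borel" for t :: real and A
  proof -
    have "emeasure lborel ((\<lambda>x. x + t) -` A) = emeasure (distr lborel borel ((+) t)) A"
      using that by (subst emeasure_distr) (auto simp: add.commute vimage_def)
    then show ?thesis by (simp add: lborel_distr_plus)
  qed
  have "(\<integral>\<^sup>+c. F (\<chi> i. ?T i (c $ i)) \<partial>clebesgue I) = (\<Prod>i\<in>(UNIV::'a set). 1) * (\<integral>\<^sup>+c. F c \<partial>clebesgue I)"
    unfolding clebesgue_def
    by (intro nn_integral_vec_measure_map) (auto simp: on_coords_def indicator_def l)
  moreover have "(\<chi> i. ?T i (c $ i)) = c + cproj I *v d" for c :: "real ^ 'a"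
    by (auto simp: cproj_mult_vec vec_eq_iff)
  ultimately show ?thesis by simp
qed

section \<open>Linear change of variables for Lebesgue measure\<close>

lemma lborel_swap:
  fixes F :: "real ^ 'n::finite \<Rightarrow> ennreal"
  assumes p: "p permutes UNIV" and F[measurable]: "F \<in> borel_measurable borel"
  shows "(\<integral>\<^sup>+x. F (\<chi> i. x $ p i) \<partial>lborel) = (\<integral>\<^sup>+x. F x \<partial>lborel)"
proof -
  have "distr lborel borel (\<lambda>x :: real ^ 'n. \<chi> i. x $ p i) = vec_measure (\<lambda>_. lborel)"
  proof (rule vec_measure_eqI)
    fix A :: "'n \<Rightarrow> real set" assume A[measurable]: "\<And>i. A i \<in> sets borel"
    have [measurable]: "{x :: real ^ 'n. \<forall>i. x $ i \<in> A i} \<in> sets borel" by measurable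
    have "emeasure (distr lborel borel (\<lambda>x :: real ^ 'n. \<chi> i. x $ p i)) {x. \<forall>i. x $ i \<in> A i}
      = emeasure lborel {x :: real ^ 'n. \<forall>i. x $ p i \<in> A i}"
      by (subst emeasure_distr) (auto simp: vimage_def)
    also have "{x :: real ^ 'n. \<forall>i. x $ p i \<in> A i} = {x. \<forall>i. x $ i \<in> A (inv p i)}"
      using p by (metis permutes_inverses)
    also have "emeasure lborel \<dots> = (\<Prod>i\<in>UNIV. emeasure lborel (A (inv p i)))"
      unfolding lborel_vec_measure by (intro emeasure_vec_measure_box) auto
    also have "\<dots> = (\<Prod>i\<in>UNIV. emeasure lborel (A i))"
      using prod.permute[OF permutes_inv[OF p], of "\<lambda>i. emeasure lborel (A i)"] by (simp add: comp_def)
    finally show "emeasure (distr lborel borel (\<lambda>x :: real ^ 'n. \<chi> i. x $ p i)) {x. \<forall>i. x $ i \<in> A i}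
      = (\<Prod>i\<in>UNIV. emeasure lborel (A i))" .
  qed auto
  then have "(\<integral>\<^sup>+x. F x \<partial>lborel) = (\<integral>\<^sup>+x. F x \<partial>distr lborel borel (\<lambda>x :: real ^ 'n. \<chi> i. x $ p i))"
    by (simp add: lborel_vec_measure)
  then show ?thesis by (simp add: nn_integral_distr)
qed

text \<open>By Fubini with coordinate \<open>m\<close> innermost, the shear is a translation,
  because \<open>x $ n\<close> stays fixed during that integration.\<close>

lemma lborel_shear:
  fixes F :: "real ^ 'n::finite \<Rightarrow> ennreal"
  assumes mn: "m \<noteq> n" and F[measurable]: "F \<in> borel_measurable borel"
  shows "(\<integral>\<^sup>+x. F (\<chi> i. if i = m then x $ m + c * x $ n else x $ i) \<partial>lborel) = (\<integral>\<^sup>+x. F x \<partial>lborel)"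
proof -
  let ?s = "\<lambda>x :: real ^ 'n. \<chi> i. if i = m then x $ m + c * x $ n else x $ i"
  have eq: "?s (cproj (- {m}) *v x + cproj {m} *v w) =
      cproj (- {m}) *v x + cproj {m} *v (w + cproj {m} *v axis m (c * x $ n))" for x w
    using mn by (auto simp: vec_eq_iff cproj_mult_vec axis_def)
  have "(\<integral>\<^sup>+x. F (?s x) \<partial>lborel) =
    (\<integral>\<^sup>+x. \<integral>\<^sup>+w. F (?s (cproj (- {m}) *v x + cproj {m} *v w)) \<partial>clebesgue {m} \<partial>clebesgue (- {m}))"
    using nn_integral_lborel_split[of "\<lambda>x. F (?s x)" "- {m}"] by (simp only: double_complement) simp
  also have "\<dots> = (\<integral>\<^sup>+x. \<integral>\<^sup>+w. F (cproj (- {m}) *v x + cproj {m} *v (w + cproj {m} *v axis m (c * x $ n)))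
      \<partial>clebesgue {m} \<partial>clebesgue (- {m}))"
    unfolding eq ..
  also have "\<dots> = (\<integral>\<^sup>+x. \<integral>\<^sup>+w. F (cproj (- {m}) *v x + cproj {m} *v w) \<partial>clebesgue {m} \<partial>clebesgue (- {m}))"
    by (intro nn_integral_cong nn_integral_clebesgue_add) measurable
  also have "\<dots> = (\<integral>\<^sup>+x. F x \<partial>lborel)"
    using nn_integral_lborel_split[of F "- {m}"] by simp
  finally show ?thesis .
qed

text \<open>Induction on elementary operations. The integrand is quantified inside the induction
  predicate, because the row-operation case applies the hypothesis to \<open>F\<close> composed with
  a shear.\<close>

lemma nn_integral_lborel_linear:
  fixes A :: "real ^ 'n::finite ^ 'n"
  assumes "det A \<noteq> 0" and "F \<in> borel_measurable borel"
  shows "ennreal \<bar>det A\<bar> * (\<integral>\<^sup>+x. F (A *v x) \<partial>lborel) = (\<integral>\<^sup>+x. F x \<partial>lborel)"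
proof -
  have "det A \<noteq> 0 \<longrightarrow> (\<forall>F\<in>borel_measurable borel.
    ennreal \<bar>det A\<bar> * (\<integral>\<^sup>+x. F (A *v x) \<partial>lborel) = (\<integral>\<^sup>+x. F x \<partial>lborel))"
  proof (rule induct_matrix_row_operations[where P="\<lambda>A. det A \<noteq> 0 \<longrightarrow> (\<forall>F\<in>borel_measurable borel.
    ennreal \<bar>det A\<bar> * (\<integral>\<^sup>+x. F (A *v x) \<partial>lborel) = (\<integral>\<^sup>+x. F x \<partial>lborel))"], goal_cases)
    case (1 A i)
    then show ?case using det_zero_row(2)[of i A] by simp
  next
    case (2 A)
    show ?case
    proof safe
      fix F :: "real ^ 'n \<Rightarrow> ennreal" assume nz: "det A \<noteq> 0" and [measurable]: "F \<in> borel_measurable borel"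
      have d: "det A = (\<Prod>i\<in>UNIV. A $ i $ i)" using 2 by (rule det_diagonal)
      then have nz': "A $ i $ i \<noteq> 0" for i using nz by auto
      have Av: "A *v x = (\<chi> i. A $ i $ i * x $ i)" for x
      proof -
        have "(\<Sum>j\<in>UNIV. A $ i $ j * x $ j) = (\<Sum>j\<in>UNIV. if j = i then A $ i $ i * x $ i else 0)" for i
          using 2[of i] by (intro sum.cong) auto
        then show ?thesis by (simp add: matrix_vector_mult_def vec_eq_iff)
      qed
      have e: "emeasure lborel ((*) t -` S) = ennreal (inverse \<bar>t\<bar>) * emeasure lborel S"
        if "t \<noteq> 0" "S \<in> sets borel" for t :: real and S
      proof -
        have "emeasure lborel ((*) t -` S) = emeasure (distr lborel borel ((*) t)) S"
          using that by (subst emeasure_distr) auto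
        also have "\<dots> = emeasure (density lborel (\<lambda>_. ennreal (inverse \<bar>t\<bar>))) S"
          using that by (subst lborel_distr_mult) auto
        also have "\<dots> = ennreal (inverse \<bar>t\<bar>) * emeasure lborel S"
          using that by (subst emeasure_density_const) auto
        finally show ?thesis .
      qed
      have "(\<integral>\<^sup>+x. F (A *v x) \<partial>lborel) =
        (\<Prod>i\<in>UNIV. ennreal (inverse \<bar>A $ i $ i\<bar>)) * (\<integral>\<^sup>+x. F x \<partial>lborel)"
        unfolding lborel_vec_measure Av
        by (intro nn_integral_vec_measure_map) (auto simp: e nz')
      also have "(\<Prod>i\<in>UNIV. ennreal (inverse \<bar>A $ i $ i\<bar>)) = ennreal (inverse \<bar>det A\<bar>)"
        unfolding d by (subst prod_ennreal) (auto simp: abs_prod prod_inversef[symmetric] comp_def)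
      finally show "ennreal \<bar>det A\<bar> * (\<integral>\<^sup>+x. F (A *v x) \<partial>lborel) = (\<integral>\<^sup>+x. F x \<partial>lborel)"
        using nz by (simp add: mult.assoc[symmetric] ennreal_mult[symmetric])
    qed
  next
    case (3 A m n)
    let ?p = "Transposition.transpose m n"
    let ?A = "\<chi> i j. A $ i $ ?p j"
    have p: "?p permutes UNIV" by (rule permutes_swap_id) auto
    have d: "det ?A = of_int (sign ?p) * det A" using p by (rule det_permute_columns)
    have Av: "?A *v x = A *v (\<chi> i. x $ ?p i)" for x
      unfolding matrix_vector_mult_def vec_eq_iff
      using sum.permute[OF p, of "\<lambda>j. A $ i $ j * x $ ?p j" for i] by (simp add: comp_def)
    show ?case
    proof safe
      fix F :: "real ^ 'n \<Rightarrow> ennreal" assume nz: "det ?A \<noteq> 0" and F[measurable]: "F \<in> borel_measurable borel"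
      have "(\<integral>\<^sup>+x. F (?A *v x) \<partial>lborel) = (\<integral>\<^sup>+x. F (A *v x) \<partial>lborel)"
        unfolding Av by (rule lborel_swap[OF p, of "\<lambda>x. F (A *v x)"]) measurable
      moreover have "\<bar>det ?A\<bar> = \<bar>det A\<bar>" "det A \<noteq> 0" using nz by (auto simp: d abs_mult sign_def)
      ultimately show "ennreal \<bar>det ?A\<bar> * (\<integral>\<^sup>+x. F (?A *v x) \<partial>lborel) = (\<integral>\<^sup>+x. F x \<partial>lborel)"
        using 3(1) F by simp
    qed
  next
    case (4 A m n c)
    let ?A = "\<chi> i. if i = m then row m A + c *\<^sub>R row n A else row i A"
    have d: "det ?A = det A" using det_row_operation[OF 4(2), of A c] by (simp add: scalar_mult_eq_scaleR cong: if_cong)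
    have Av: "?A *v x = (\<chi> i. if i = m then (A *v x) $ m + c * (A *v x) $ n else (A *v x) $ i)" for x
      by (auto simp: matrix_vector_mult_def vec_eq_iff row_def distrib_right sum.distrib sum_distrib_left mult.assoc)
    show ?case
    proof safe
      fix F :: "real ^ 'n \<Rightarrow> ennreal" assume nz: "det ?A \<noteq> 0" and F[measurable]: "F \<in> borel_measurable borel"
      let ?s = "\<lambda>x :: real ^ 'n. \<chi> i. if i = m then x $ m + c * x $ n else x $ i"
      have [measurable]: "(\<lambda>x. F (?s x)) \<in> borel_measurable borel" by measurable
      have "ennreal \<bar>det A\<bar> * (\<integral>\<^sup>+x. F (?s (A *v x)) \<partial>lborel) = (\<integral>\<^sup>+x. F (?s x) \<partial>lborel)"
        using 4(1)[rule_format, of "\<lambda>x. F (?s x)"] nz by (simp add: d)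
      also have "\<dots> = (\<integral>\<^sup>+x. F x \<partial>lborel)" using 4(2) by (rule lborel_shear) fact
      finally show "ennreal \<bar>det ?A\<bar> * (\<integral>\<^sup>+x. F (?A *v x) \<partial>lborel) = (\<integral>\<^sup>+x. F x \<partial>lborel)"
        unfolding Av d .
    qed
  qed
  with assms show ?thesis by simp
qed

definition unit_cube :: "(real ^ 'n::finite) set" where
  "unit_cube = {x. \<forall>i. x $ i \<in> {0..1}}"

lemma unit_cube_borel [measurable]: "unit_cube \<in> sets borel"
  unfolding unit_cube_def by measurable

lemma emeasure_clebesgue_unit_cube [simp]: "emeasure (clebesgue I) unit_cube = 1"
proof -
  have "emeasure (clebesgue I) unit_cube = (\<Prod>i\<in>UNIV. emeasure (on_coords I lborel i) {0..1::real})"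
    unfolding clebesgue_def unit_cube_def
    by (rule emeasure_vec_measure_box[of "on_coords I (lborel :: real measure)" "\<lambda>_. {0..1}"]) (simp_all del: atLeastAtMost_iff)
  also have "\<dots> = 1" by (intro prod.neutral) (auto simp: on_coords_def)
  finally show ?thesis .
qed

text \<open>The remaining coordinates are filled in with a cube of mass 1, so that substitutions on
  R^I can be deduced from those on R^n.\<close>

lemma nn_integral_clebesgue_conv_lborel:
  fixes F :: "real ^ 'n::finite \<Rightarrow> ennreal"
  assumes F[measurable]: "F \<in> borel_measurable borel"
  shows "(\<integral>\<^sup>+c. F c \<partial>clebesgue I) =
    (\<integral>\<^sup>+x. F (cproj I *v x) * indicator unit_cube (cproj (- I) *v x) \<partial>lborel)"
proof -
  interpret sigma_finite_measure "clebesgue (- I)" by (rule sigma_finite_clebesgue)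
  have "(\<integral>\<^sup>+x. F (cproj I *v x) * indicator unit_cube (cproj (- I) *v x) \<partial>lborel) =
    (\<integral>\<^sup>+c. \<integral>\<^sup>+w. F (cproj I *v c) * indicator unit_cube (cproj (- I) *v w) \<partial>clebesgue (- I) \<partial>clebesgue I)"
    by (subst nn_integral_lborel_split[where I=I]) (auto simp: matrix_vector_right_distrib matrix_vector_mul_assoc)
  also have "\<dots> = (\<integral>\<^sup>+c. F (cproj I *v c) * (\<integral>\<^sup>+w. indicator unit_cube (cproj (- I) *v w) \<partial>clebesgue (- I)) \<partial>clebesgue I)"
    by (subst nn_integral_cmult) auto
  also have "(\<integral>\<^sup>+w. indicator unit_cube (cproj (- I) *v w) \<partial>clebesgue (- I)) = 1"
    by (subst nn_integral_clebesgue_cproj) auto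
  finally show ?thesis using nn_integral_clebesgue_cproj[of F I] by simp
qed

text \<open>The substitution on R^n is applied to \<open>a\<close> extended by the identity, which
  does not move the coordinates on which the auxiliary cube depends.\<close>

lemma nn_integral_clebesgue_linear:
  fixes F :: "real ^ 'n::finite \<Rightarrow> ennreal"
  assumes a: "block I a" "bdet I a \<noteq> 0" and F[measurable]: "F \<in> borel_measurable borel"
  shows "ennreal (bdet I a) * (\<integral>\<^sup>+c. F (a *v c) \<partial>clebesgue I) = (\<integral>\<^sup>+c. F c \<partial>clebesgue I)"
proof -
  let ?A = "a + cproj (- I)"
  have A: "cproj I ** ?A = a ** cproj I" "cproj (- I) ** ?A = cproj (- I)"
    using blockD[OF a(1)] block_compl[OF a(1)] by (simp_all add: matrix_add_ldistrib)
  have "(\<integral>\<^sup>+c. F c \<partial>clebesgue I) = (\<integral>\<^sup>+x. F (cproj I *v x) * indicator unit_cube (cproj (- I) *v x) \<partial>lborel)"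
    by (rule nn_integral_clebesgue_conv_lborel) fact
  also have "\<dots> = ennreal (bdet I a) *
      (\<integral>\<^sup>+x. F (cproj I *v (?A *v x)) * indicator unit_cube (cproj (- I) *v (?A *v x)) \<partial>lborel)"
    unfolding bdet_def using a(2) by (intro nn_integral_lborel_linear[symmetric]) (auto simp: bdet_def)
  also have "(\<integral>\<^sup>+x. F (cproj I *v (?A *v x)) * indicator unit_cube (cproj (- I) *v (?A *v x)) \<partial>lborel)
      = (\<integral>\<^sup>+x. F (a *v (cproj I *v x)) * indicator unit_cube (cproj (- I) *v x) \<partial>lborel)"
    by (simp only: matrix_vector_mul_assoc A)
  also have "\<dots> = (\<integral>\<^sup>+c. F (a *v c) \<partial>clebesgue I)"
    by (rule nn_integral_clebesgue_conv_lborel[symmetric]) measurable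
  finally show ?thesis by simp
qed

section \<open>Lebesgue measure on zero-padded matrices\<close>

definition mlebesgue :: "'n::finite set \<Rightarrow> 'n set \<Rightarrow> (real ^ 'n ^ 'n) measure" where
  "mlebesgue R I = vec_measure (on_coords R (clebesgue I))"

lemma sets_mlebesgue [simp, measurable_cong]: "sets (mlebesgue R I) = sets borel"
  and space_mlebesgue [simp]: "space (mlebesgue R I) = UNIV"
  by (simp_all add: mlebesgue_def)

lemma borel_sf_mlebesgue [simp]: "borel_sf (mlebesgue R I)"
  unfolding mlebesgue_def by (intro borel_sf_vec_measure) simp

lemma sigma_finite_mlebesgue: "sigma_finite_measure (mlebesgue R I)"
  using borel_sf_mlebesgue[of R I] by (simp add: borel_sf_def)

lemma vec_measure_dirac: "vec_measure (\<lambda>_::'n::finite. dirac0 :: real measure) = dirac0"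
proof (rule vec_measure_eqI[symmetric])
  fix A :: "'n \<Rightarrow> real set" assume A[measurable]: "\<And>i. A i \<in> sets borel"
  have "{x :: real ^ 'n. \<forall>i. x $ i \<in> A i} \<in> sets borel" by measurable
  then show "emeasure dirac0 {x :: real ^ 'n. \<forall>i. x $ i \<in> A i} = (\<Prod>i\<in>UNIV. emeasure dirac0 (A i))"
    by (auto simp: indicator_def)
qed auto

text \<open>This form is symmetric in rows and columns, which is what transposition needs. The cases
  that matter are frames (\<open>R = UNIV\<close>), square blocks (\<open>R = I\<close>) and chart
  coordinates (\<open>R = - I\<close>).\<close>

lemma mlebesgue_entries:
  "mlebesgue R I = vec_measure (\<lambda>i. vec_measure (\<lambda>j. if i \<in> R \<and> j \<in> I then lborel else dirac0))"
  unfolding mlebesgue_def clebesgue_def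
  by (intro arg_cong[where f=vec_measure] ext)
     (auto simp: on_coords_def[abs_def] vec_measure_dirac[symmetric])

lemma nn_integral_mlebesgue_transpose:
  assumes F[measurable]: "F \<in> borel_measurable borel"
  shows "(\<integral>\<^sup>+x. F (transpose x) \<partial>mlebesgue R I) = (\<integral>\<^sup>+x. F x \<partial>mlebesgue I R)"
  unfolding mlebesgue_entries
  by (subst nn_integral_transpose) (auto simp: conj_commute)

lemma matrix_mult_nth: fixes X :: "real ^ 'n::finite ^ 'm::finite"
  shows "(X ** a) $ i = transpose a *v (X $ i)"
  by (auto simp: matrix_matrix_mult_def matrix_vector_mult_def transpose_def vec_eq_iff mult.commute)

text \<open>Right multiplication acts on each row by \<open>transpose a\<close>, so every one of the
  \<open>card R\<close> varying rows contributes a factor \<open>bdet I a\<close>.\<close>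

lemma nn_integral_mlebesgue_right:
  fixes F :: "real ^ 'n::finite ^ 'n \<Rightarrow> ennreal"
  assumes a: "block I a" "bdet I a \<noteq> 0" and F[measurable]: "F \<in> borel_measurable borel"
  shows "ennreal (bdet I a) ^ card R * (\<integral>\<^sup>+x. F (x ** a) \<partial>mlebesgue R I) = (\<integral>\<^sup>+x. F x \<partial>mlebesgue R I)"
proof -
  define b where "b = transpose a"
  let ?c = "\<lambda>i. if i \<in> R then 1 / ennreal (bdet I a) else 1"
  have pos: "0 < bdet I a" using a(2) bdet_nonneg[of I a] by linarith
  have l: "emeasure (clebesgue I) ((*v) b -` A) = 1 / ennreal (bdet I a) * emeasure (clebesgue I) A"
    if A[measurable]: "A \<in> sets borel" for A
  proof -
    have "ennreal (bdet I a) * emeasure (clebesgue I) ((*v) b -` A) =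
       ennreal (bdet I a) * (\<integral>\<^sup>+c. indicator A (b *v c) \<partial>clebesgue I)"
      by (subst emeasure_vimage_eq) auto
    also have "\<dots> = emeasure (clebesgue I) A"
      using nn_integral_clebesgue_linear[of I b "indicator A"] a by (auto simp: b_def)
    finally show ?thesis using pos
      by (metis divide_eq_0_iff ennreal_divide_times ennreal_less_top less_numeral_extra(3) linorder_not_less
          mult.left_neutral mult_divide_eq_ennreal mult.commute ennreal_eq_0_iff top.extremum_strict)
  qed
  have "(\<integral>\<^sup>+x. F (\<chi> i. b *v (x $ i)) \<partial>mlebesgue R I) = (\<Prod>i\<in>(UNIV::'n set). ?c i) * (\<integral>\<^sup>+x. F x \<partial>mlebesgue R I)"
    unfolding mlebesgue_def using pos
    by (intro nn_integral_vec_measure_map)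
       (auto simp: on_coords_def indicator_def l ennreal_divide_eq_top_iff ennreal_divide_eq_0_iff measurable_sets_borel[of "(*v) b" borel])
  moreover have "(\<chi> i. b *v (x $ i)) = x ** a" for x :: "real ^ 'n ^ 'n" by (subst vec_eq_iff) (simp add: b_def matrix_mult_nth)
  moreover have "(\<Prod>i\<in>(UNIV::'n set). ?c i) = (1 / ennreal (bdet I a)) ^ card R"
    by (simp add: prod.If_cases)
  moreover have "ennreal (bdet I a) ^ card R * (1 / ennreal (bdet I a)) ^ card R = 1"
    unfolding power_mult_distrib[symmetric] using pos by (simp add: ennreal_times_divide)
  ultimately show ?thesis by (simp only: mult.assoc[symmetric] mult_1)
qed

lemma nn_integral_mlebesgue_left:
  fixes F :: "real ^ 'n::finite ^ 'n \<Rightarrow> ennreal"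
  assumes a: "block R a" "bdet R a \<noteq> 0" and F[measurable]: "F \<in> borel_measurable borel"
  shows "ennreal (bdet R a) ^ card I * (\<integral>\<^sup>+x. F (a ** x) \<partial>mlebesgue R I) = (\<integral>\<^sup>+x. F x \<partial>mlebesgue R I)"
proof -
  have "(\<integral>\<^sup>+x. F (a ** x) \<partial>mlebesgue R I) = (\<integral>\<^sup>+x. F (transpose (x ** transpose a)) \<partial>mlebesgue I R)"
    using nn_integral_mlebesgue_transpose[of "\<lambda>x. F (a ** x)" I R, symmetric]
    by (simp add: matrix_transpose_mul)
  moreover have "(\<integral>\<^sup>+x. F x \<partial>mlebesgue R I) = (\<integral>\<^sup>+x. F (transpose x) \<partial>mlebesgue I R)"
    by (subst nn_integral_mlebesgue_transpose) auto
  moreover have "ennreal (bdet R a) ^ card I * (\<integral>\<^sup>+x. F (transpose (x ** transpose a)) \<partial>mlebesgue I R) = (\<integral>\<^sup>+x. F (transpose x) \<partial>mlebesgue I R)"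
    using nn_integral_mlebesgue_right[of R "transpose a" "\<lambda>x. F (transpose x)" I] a by simp
  ultimately show ?thesis by simp
qed

lemma nn_integral_mlebesgue_split:
  fixes F :: "real ^ 'n::finite ^ 'n \<Rightarrow> ennreal"
  assumes F[measurable]: "F \<in> borel_measurable borel"
  shows "(\<integral>\<^sup>+y. F y \<partial>mlebesgue UNIV I) =
    (\<integral>\<^sup>+a. \<integral>\<^sup>+x. F (cproj I ** a + cproj (- I) ** x) \<partial>mlebesgue (- I) I \<partial>mlebesgue I I)"
proof -
  have "(\<chi> i. if i \<in> I then c $ i else w $ i) = cproj I ** c + cproj (- I) ** w" for c w :: "real ^ 'n ^ 'n"
    by (subst vec_eq_iff) (auto simp: cproj_mult_nth)
  moreover have "mlebesgue UNIV I = vec_measure (\<lambda>_. clebesgue I)"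
    by (simp add: mlebesgue_def on_coords_def[abs_def])
  ultimately show ?thesis
    using nn_integral_vec_measure_split[of "clebesgue I" I "- I" F] by (simp add: mlebesgue_def)
qed

lemma nn_integral_mlebesgue_cproj_right:
  assumes F[measurable]: "F \<in> borel_measurable borel"
  shows "(\<integral>\<^sup>+x. F (x ** cproj I) \<partial>mlebesgue R I) = (\<integral>\<^sup>+x. F x \<partial>mlebesgue R I)"
proof -
  have p: "emeasure (clebesgue I) ((*v) (cproj I) -` A) = emeasure (clebesgue I) A" if A[measurable]: "A \<in> sets borel" for A
    using nn_integral_clebesgue_cproj[of "indicator A" I] by (subst emeasure_vimage_eq) auto
  have "(\<integral>\<^sup>+x. F (\<chi> i. cproj I *v (x $ i)) \<partial>mlebesgue R I) = (\<Prod>i\<in>(UNIV::'a set). 1) * (\<integral>\<^sup>+x. F x \<partial>mlebesgue R I)"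
    unfolding mlebesgue_def
    by (intro nn_integral_vec_measure_map)
       (auto simp: on_coords_def indicator_def p measurable_sets_borel[of "(*v) (cproj I)" borel])
  moreover have "(\<chi> i. cproj I *v (x $ i)) = x ** cproj I" for x :: "real ^ 'a ^ 'a"
    by (simp add: vec_eq_iff matrix_mult_nth)
  ultimately show ?thesis by simp
qed

lemma nn_integral_mlebesgue_cproj_left:
  assumes F[measurable]: "F \<in> borel_measurable borel"
  shows "(\<integral>\<^sup>+x. F (cproj R ** x) \<partial>mlebesgue R I) = (\<integral>\<^sup>+x. F x \<partial>mlebesgue R I)"
  using nn_integral_mlebesgue_transpose[of "\<lambda>x. F (cproj R ** x)" I R]
    nn_integral_mlebesgue_transpose[of F I R]
    nn_integral_mlebesgue_cproj_right[of "\<lambda>x. F (transpose x)" I R]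
  by (simp add: matrix_transpose_mul)

lemma nn_integral_mlebesgue_add:
  assumes F[measurable]: "F \<in> borel_measurable borel"
  shows "(\<integral>\<^sup>+x. F (x + cproj R ** d ** cproj I) \<partial>mlebesgue R I) = (\<integral>\<^sup>+x. F x \<partial>mlebesgue R I)"
proof -
  let ?D = "cproj R ** d ** cproj I"
  have D: "?D $ i = (if i \<in> R then cproj I *v (d $ i) else 0)" for i
    by (subst matrix_mult_nth) (auto simp: cproj_mult_nth)
  have p: "emeasure (clebesgue I) ((\<lambda>x. x + cproj I *v v) -` A) = emeasure (clebesgue I) A"
    if A[measurable]: "A \<in> sets borel" for A v
    using nn_integral_clebesgue_add[of "indicator A" I v] by (subst emeasure_vimage_eq) auto
  have "(\<integral>\<^sup>+x. F (\<chi> i. x $ i + ?D $ i) \<partial>mlebesgue R I) = (\<Prod>i\<in>(UNIV::'a set). 1) * (\<integral>\<^sup>+x. F x \<partial>mlebesgue R I)"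
    unfolding mlebesgue_def D
    by (intro nn_integral_vec_measure_map)
       (auto simp: on_coords_def indicator_def p)
  moreover have "(\<chi> i. x $ i + ?D $ i) = x + ?D" for x :: "real ^ 'a ^ 'a"
    by (simp add: vec_eq_iff)
  ultimately show ?thesis by simp
qed

subsection \<open>Singular matrices form a null set\<close>

lemma det_pencil_poly:
  fixes B C :: "real ^ 'n::finite ^ 'n"
  shows "\<exists>p. \<forall>t. poly p t = det (B + t *\<^sub>R C)"
proof -
  have "poly (\<Sum>\<sigma> | \<sigma> permutes UNIV. smult (of_int (sign \<sigma>)) (\<Prod>i\<in>UNIV. [:B $ i $ \<sigma> i, C $ i $ \<sigma> i:])) t
    = det (B + t *\<^sub>R C)" for t
    by (simp add: det_def poly_sum poly_prod)
  then show ?thesis by blast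
qed

lemma bdet_nz_iff:
  assumes s: "block I s"
  shows "bdet I s \<noteq> 0 \<longleftrightarrow> (\<forall>x. s *v x = 0 \<longrightarrow> cproj I *v x = 0)"
proof -
  let ?A = "s + cproj (- I)"
  have inj: "det ?A \<noteq> 0 \<longleftrightarrow> (\<forall>x. ?A *v x = 0 \<longrightarrow> x = 0)"
    by (metis invertible_det_nz invertible_left_inverse matrix_left_invertible_ker)
  have A: "?A *v x = 0 \<longleftrightarrow> s *v x = 0 \<and> cproj (- I) *v x = 0" for x
  proof safe
    assume "?A *v x = 0"
    then have "cproj (- I) *v (?A *v x) = 0" by simp
    moreover have "cproj (- I) ** ?A = cproj (- I)" using block_compl[OF s] by (simp add: matrix_add_ldistrib)
    ultimately show q: "cproj (- I) *v x = 0" by (simp add: matrix_vector_mul_assoc)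
    show "s *v x = 0" using \<open>?A *v x = 0\<close> q by (simp add: matrix_vector_mult_add_rdistrib)
  qed (simp add: matrix_vector_mult_add_rdistrib)
  have x: "x = cproj I *v x + cproj (- I) *v x" for x
    using matrix_vector_mult_add_rdistrib[of "cproj I" "cproj (- I)" x] by (simp add: cproj_add_compl)
  have sx: "s *v (cproj I *v x) = s *v x" for x
    using s by (simp add: matrix_vector_mul_assoc block_def)
  have cx: "cproj (- I) *v (cproj I *v x) = 0" for x by (simp add: matrix_vector_mul_assoc)
  show ?thesis
    unfolding bdet_def abs_eq_0 inj A using x sx cx by (metis add.right_neutral add_0)
qed

text \<open>On each line in the direction \<open>cproj I\<close> the determinant is a polynomial in
  the parameter that is not identically zero. Translation invariance and Fubini turn the finiteness
  of its roots into a null set.\<close>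

lemma AE_bdet_nz:
  "AE a in mlebesgue I I. bdet I (cproj I ** a ** cproj I) \<noteq> 0"
proof -
  let ?P = "cproj I"
  let ?Z = "indicator {a. bdet I (?P ** a ** ?P) = 0} :: real ^ 'a ^ 'a \<Rightarrow> ennreal"
  interpret M: sigma_finite_measure "mlebesgue I I" by (rule sigma_finite_mlebesgue)
  interpret pair_sigma_finite "mlebesgue I I" "lborel :: real measure" ..
  have m[measurable]: "{a. bdet I (?P ** a ** ?P) = 0} \<in> sets borel" by measurable
  have fin: "finite {t. ?Z (a + t *\<^sub>R ?P) \<noteq> 0}" for a
  proof -
    let ?B = "?P ** a ** ?P"
    have blk: "block I (?B + t *\<^sub>R ?P)" for t
      using block_conj_cproj[of I a]
      by (auto simp: block_def matrix_add_ldistrib matrix_matrix_add_rdistrib matrix_scalar_ac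
          scalar_matrix_assoc[symmetric] matrix_mul_assoc matrix_mul_assoc[symmetric, of _ ?P ?P])
    obtain p where p: "\<And>t. poly p t = det ((?B + cproj (- I)) + t *\<^sub>R ?P)"
      using det_pencil_poly by blast
    have bd: "bdet I (?B + t *\<^sub>R ?P) = \<bar>poly p t\<bar>" for t
      by (simp add: bdet_def p algebra_simps)
    \<comment> \<open>At the parameter \<open>K + 1\<close> the multiple of the identity dominates
      \<open>?B\<close> on R^I, so the sum is injective there and the polynomial is not
      zero.\<close>
    define K where "K = onorm ((*v) ?B)"
    have K0: "0 \<le> K" unfolding K_def by (intro onorm_pos_le) simp
    have "bdet I (?B + (K + 1) *\<^sub>R ?P) \<noteq> 0"
      unfolding bdet_nz_iff[OF blk]
    proof safe
      fix x assume "(?B + (K + 1) *\<^sub>R ?P) *v x = 0"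
      then have "?B *v x = - ((K + 1) *\<^sub>R (?P *v x))"
        by (simp add: matrix_vector_mult_add_rdistrib scaleR_matrix_vector_assoc eq_neg_iff_add_eq_0)
      moreover have "?B *v (?P *v x) = ?B *v x"
        by (simp add: matrix_vector_mul_assoc matrix_mul_assoc[symmetric])
      ultimately have "norm (?B *v (?P *v x)) = (K + 1) * norm (?P *v x)" using K0 by simp
      moreover have "norm (?B *v (?P *v x)) \<le> K * norm (?P *v x)"
        unfolding K_def by (rule onorm) simp
      ultimately have "norm (?P *v x) \<le> 0" by (simp add: algebra_simps)
      then show "?P *v x = 0" by simp
    qed
    then have "p \<noteq> 0" using bd[of "K + 1"] by auto
    then have "finite {t. poly p t = 0}" by (rule poly_roots_finite)
    moreover have "?P ** (a + t *\<^sub>R ?P) ** ?P = ?B + t *\<^sub>R ?P" for t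
      by (simp add: matrix_add_ldistrib matrix_matrix_add_rdistrib matrix_scalar_ac
          scalar_matrix_assoc[symmetric])
    ultimately show ?thesis by (simp add: indicator_def bd)
  qed
  \<comment> \<open>Every translate has the same integral, so the integral may be averaged over
    \<open>t\<close> in the unit interval.\<close>
  have shift: "(\<integral>\<^sup>+a. ?Z (a + t *\<^sub>R ?P) \<partial>mlebesgue I I) = (\<integral>\<^sup>+a. ?Z a \<partial>mlebesgue I I)" for t
    using nn_integral_mlebesgue_add[where F="?Z" and R=I and I=I and d="t *\<^sub>R mat 1"]
    by (simp add: matrix_scalar_ac scalar_matrix_assoc[symmetric])
  have "(\<integral>\<^sup>+a. ?Z a \<partial>mlebesgue I I) = (\<integral>\<^sup>+t. (\<integral>\<^sup>+a. ?Z (a + t *\<^sub>R ?P) \<partial>mlebesgue I I) * indicator {0..1::real} t \<partial>lborel)"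
    unfolding shift by (simp add: nn_integral_cmult_indicator)
  also have "\<dots> = (\<integral>\<^sup>+t. \<integral>\<^sup>+a. ?Z (a + t *\<^sub>R ?P) * indicator {0..1} t \<partial>mlebesgue I I \<partial>lborel)"
    by (intro nn_integral_cong nn_integral_multc[symmetric]) measurable
  also have "\<dots> = (\<integral>\<^sup>+a. \<integral>\<^sup>+t. ?Z (a + t *\<^sub>R ?P) * indicator {0..1} t \<partial>lborel \<partial>mlebesgue I I)"
    by (rule Fubini') measurable
  also have "\<dots> = (\<integral>\<^sup>+a. 0 \<partial>mlebesgue I I)"
  proof (intro nn_integral_cong)
    fix a
    have "AE t in lborel. t \<notin> {t. ?Z (a + t *\<^sub>R ?P) \<noteq> 0}"
      using fin[of a] by (intro AE_not_in finite_imp_null_set_lborel)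
    then show "(\<integral>\<^sup>+t. ?Z (a + t *\<^sub>R ?P) * indicator {0..1} t \<partial>lborel) = 0"
      by (subst nn_integral_0_iff_AE) auto
  qed
  finally have "(\<integral>\<^sup>+a. ?Z a \<partial>mlebesgue I I) = 0" by simp
  then show ?thesis by (subst (asm) nn_integral_0_iff_AE) (auto simp: indicator_def)
qed

lemma AE_top_block_nz: "AE y in mlebesgue UNIV I. bdet I (cproj I ** y ** cproj I) \<noteq> 0"
proof -
  let ?P = "cproj I"
  let ?Z = "indicator {a. bdet I (?P ** a ** ?P) = 0} :: real ^ 'a ^ 'a \<Rightarrow> ennreal"
  have m[measurable]: "{a. bdet I (?P ** a ** ?P) = 0} \<in> sets borel" by measurable
  have e: "?P ** (?P ** a + cproj (- I) ** x) ** ?P = ?P ** a ** ?P" for a x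
    by (simp add: matrix_add_ldistrib matrix_mul_assoc)
  have "(\<integral>\<^sup>+y. ?Z y \<partial>mlebesgue UNIV I) = (\<integral>\<^sup>+a. \<integral>\<^sup>+x. ?Z (?P ** a + cproj (- I) ** x) \<partial>mlebesgue (- I) I \<partial>mlebesgue I I)"
    by (rule nn_integral_mlebesgue_split) measurable
  also have "\<dots> = (\<integral>\<^sup>+a. 0 \<partial>mlebesgue I I)"
    by (intro nn_integral_cong_AE, rule AE_mp[OF AE_bdet_nz], rule AE_I2) (simp add: indicator_def e)
  finally have "(\<integral>\<^sup>+a. ?Z a \<partial>mlebesgue UNIV I) = 0" by simp
  then show ?thesis by (subst (asm) nn_integral_0_iff_AE) (auto simp: indicator_def)
qed

subsection \<open>The affine chart of the Grassmannian\<close>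

text \<open>A generic frame \<open>y\<close> with invertible top block \<open>a\<close> is \<open>(1; x) a\<close>; the substitution
  of the lower rows produces the factor \<open>bdet I a ^ card (- I)\<close>.\<close>

lemma nn_integral_chart:
  fixes \<phi> h :: "real ^ 'n::finite ^ 'n \<Rightarrow> ennreal"
  assumes \<phi>[measurable]: "\<phi> \<in> borel_measurable borel" and h[measurable]: "h \<in> borel_measurable borel"
    and inv: "\<And>y a. block I a \<Longrightarrow> bdet I a \<noteq> 0 \<Longrightarrow> \<phi> (y ** a) = \<phi> y"
  shows "(\<integral>\<^sup>+y. \<phi> y * h y \<partial>mlebesgue UNIV I) =
    (\<integral>\<^sup>+x. \<phi> (cproj I + cproj (- I) ** x ** cproj I) *
       (\<integral>\<^sup>+a. ennreal (bdet I (cproj I ** a ** cproj I)) ^ card (- I) *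
            h ((cproj I + cproj (- I) ** x ** cproj I) ** (cproj I ** a ** cproj I)) \<partial>mlebesgue I I)
     \<partial>mlebesgue (- I) I)"
proof -
  let ?P = "cproj I" and ?Q = "cproj (- I)"
  let ?A = "mlebesgue I I" and ?X = "mlebesgue (- I) I"
  let ?F = "\<lambda>y. \<phi> y * h y"
  interpret A: sigma_finite_measure ?A by (rule sigma_finite_mlebesgue)
  interpret X: sigma_finite_measure ?X by (rule sigma_finite_mlebesgue)
  interpret pair_sigma_finite ?X ?A ..
  let ?G = "\<lambda>a. \<integral>\<^sup>+x. ?F (?P ** a + ?Q ** x) \<partial>?X"
  have [measurable]: "?G \<in> borel_measurable borel" by measurable
  have "(\<integral>\<^sup>+y. ?F y \<partial>mlebesgue UNIV I) = (\<integral>\<^sup>+a. ?G a \<partial>?A)"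
    by (rule nn_integral_mlebesgue_split) measurable
  \<comment> \<open>The variable is projected on both sides so that it is literally a block, as the
    right substitution rule requires.\<close>
  also have "\<dots> = (\<integral>\<^sup>+a. ?G (?P ** a) \<partial>?A)"
    by (rule nn_integral_mlebesgue_cproj_left[symmetric]) measurable
  also have "\<dots> = (\<integral>\<^sup>+a. ?G (?P ** (a ** ?P)) \<partial>?A)"
    by (rule nn_integral_mlebesgue_cproj_right[symmetric]) measurable
  also have "\<dots> = (\<integral>\<^sup>+a. \<integral>\<^sup>+x. ennreal (bdet I (?P ** a ** ?P)) ^ card (- I) *
      (\<phi> (?P + ?Q ** x ** ?P) * h ((?P + ?Q ** x ** ?P) ** (?P ** a ** ?P))) \<partial>?X \<partial>?A)"
  proof (intro nn_integral_cong_AE, rule AE_mp[OF AE_bdet_nz], rule AE_I2, rule impI)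
    fix a assume nz: "bdet I (?P ** a ** ?P) \<noteq> 0"
    let ?a = "?P ** a ** ?P"
    have e: "?P ** (?P ** (a ** ?P)) + ?Q ** (x ** ?a) = (?P + ?Q ** x ** ?P) ** ?a" for x
    proof -
      have "(?P + ?Q ** x ** ?P) ** ?a = ?P ** ?a + ?Q ** x ** (?P ** ?a)"
        by (simp only: matrix_matrix_add_rdistrib matrix_mul_assoc)
      also have "?P ** ?a = ?a" by (simp add: matrix_mul_assoc)
      finally show ?thesis by (simp add: matrix_mul_assoc)
    qed
    have "?G (?P ** (a ** ?P)) = ennreal (bdet I ?a) ^ card (- I) *
        (\<integral>\<^sup>+x. ?F (?P ** (?P ** (a ** ?P)) + ?Q ** (x ** ?a)) \<partial>?X)"
      using nz by (intro nn_integral_mlebesgue_right[symmetric]) auto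
    also have "\<dots> = (\<integral>\<^sup>+x. ennreal (bdet I ?a) ^ card (- I) * ?F ((?P + ?Q ** x ** ?P) ** ?a) \<partial>?X)"
      unfolding e by (rule nn_integral_cmult[symmetric]) measurable
    finally show "?G (?P ** (a ** ?P)) = (\<integral>\<^sup>+x. ennreal (bdet I ?a) ^ card (- I) *
        (\<phi> (?P + ?Q ** x ** ?P) * h ((?P + ?Q ** x ** ?P) ** ?a)) \<partial>?X)"
      using inv[OF block_conj_cproj nz] by simp
  qed
  also have "\<dots> = (\<integral>\<^sup>+x. \<integral>\<^sup>+a. ennreal (bdet I (?P ** a ** ?P)) ^ card (- I) *
      (\<phi> (?P + ?Q ** x ** ?P) * h ((?P + ?Q ** x ** ?P) ** (?P ** a ** ?P))) \<partial>?A \<partial>?X)"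
    by (rule Fubini') measurable
  also have "\<dots> = (\<integral>\<^sup>+x. \<integral>\<^sup>+a. \<phi> (?P + ?Q ** x ** ?P) * (ennreal (bdet I (?P ** a ** ?P)) ^ card (- I) *
      h ((?P + ?Q ** x ** ?P) ** (?P ** a ** ?P))) \<partial>?A \<partial>?X)"
    by (simp add: mult_ac)
  also have "\<dots> = (\<integral>\<^sup>+x. \<phi> (?P + ?Q ** x ** ?P) * (\<integral>\<^sup>+a. ennreal (bdet I (?P ** a ** ?P)) ^ card (- I) *
      h ((?P + ?Q ** x ** ?P) ** (?P ** a ** ?P)) \<partial>?A) \<partial>?X)"
    by (intro nn_integral_cong nn_integral_cmult) measurable
  finally show ?thesis .
qed

text \<open>All columns are constrained, but under \<open>mlebesgue UNIV I\<close> those outside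
  \<open>I\<close> vanish almost everywhere. A condition on columns, unlike one on rows, is
  invariant under isometries applied from the left.\<close>

definition colball :: "(real ^ 'n::finite ^ 'n) set" where
  "colball = {y. \<forall>j. norm (y *v axis j 1) \<le> 1}"

lemma colball_borel [measurable]: "colball \<in> sets borel"
  unfolding colball_def by measurable

text \<open>The volume of an ellipsoid. On frames it is inversely proportional to the volume of the
  parallelepiped spanned by the columns in \<open>I\<close>, so it replaces a Gram
  determinant.\<close>

definition ballvol :: "'n::finite set \<Rightarrow> real ^ 'n ^ 'n \<Rightarrow> ennreal" where
  "ballvol I y = emeasure (clebesgue I) {c. norm (y *v c) \<le> 1}"

lemma ballvol_mult:
  assumes s: "block I s" "bdet I s \<noteq> 0"
  shows "ennreal (bdet I s) * ballvol I (y ** s) = ballvol I y"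
proof -
  have m: "{c. norm (y *v c) \<le> 1} \<in> sets borel" for y :: "real ^ 'a ^ 'a" by measurable
  have "ballvol I y = (\<integral>\<^sup>+c. indicator {c. norm (y *v c) \<le> 1} c \<partial>clebesgue I)" for y
    unfolding ballvol_def using m by simp
  then show ?thesis
    using nn_integral_clebesgue_linear[OF s, of "indicator {c. norm (y *v c) \<le> 1}"] m
    by (simp add: indicator_def matrix_vector_mul_assoc)
qed

text \<open>Origin of the exponent: under \<open>a -> s a\<close> the \<open>card I\<close> columns
  contribute \<open>bdet I s ^ card I\<close> and the integrand contributes
  \<open>bdet I s ^ card (- I)\<close>, in total the power \<open>CARD('n)\<close>. Finally
  \<open>bdet I s\<close> is the ratio of the values of \<open>ballvol\<close> at
  \<open>cproj I\<close> and at \<open>y\<close>; the statement is multiplied out to avoid division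
  in \<open>ennreal\<close>.\<close>

lemma nn_integral_bdet_colball:
  fixes y :: "real ^ 'n::finite ^ 'n"
  assumes s: "block I s" "bdet I s \<noteq> 0" and y: "\<And>c. norm (y *v (cproj I *v c)) = norm (s *v c)" "y ** cproj I = y"
  shows "(\<integral>\<^sup>+a. ennreal (bdet I (cproj I ** a ** cproj I)) ^ card (- I) *
            indicator colball (y ** (cproj I ** a ** cproj I)) \<partial>mlebesgue I I) * ballvol I (cproj I) ^ CARD('n) =
    (\<integral>\<^sup>+a. ennreal (bdet I (cproj I ** a ** cproj I)) ^ card (- I) *
            indicator colball (cproj I ** a ** cproj I) \<partial>mlebesgue I I) * ballvol I y ^ CARD('n)"
proof -
  let ?P = "cproj I" and ?m = "card (- I)"
  let ?K = "\<lambda>b. ennreal (bdet I (?P ** b ** ?P)) ^ ?m * indicator colball (?P ** b ** ?P)"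
  let ?T = "\<integral>\<^sup>+a. ennreal (bdet I (?P ** a ** ?P)) ^ ?m * indicator colball (y ** (?P ** a ** ?P)) \<partial>mlebesgue I I"
  have n: "CARD('n) = card I + ?m"
    using card_Un_disjoint[of I "- I"] by (simp add: Compl_partition)
  have pos: "0 < bdet I s" using s(2) bdet_nonneg[of I s] by linarith
  have K: "?K (s ** a) = ennreal (bdet I s) ^ ?m *
      (ennreal (bdet I (?P ** a ** ?P)) ^ ?m * indicator colball (y ** (?P ** a ** ?P)))" for a
  proof -
    have e: "?P ** (s ** a) ** ?P = s ** (?P ** a ** ?P)"
      using blockD[OF s(1)] by (simp add: matrix_mul_assoc)
    have "norm ((s ** (?P ** a ** ?P)) *v v) = norm ((y ** (?P ** a ** ?P)) *v v)" for v
      using y(1)[of "(?P ** a ** ?P) *v v"]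
      by (simp add: matrix_vector_mul_assoc matrix_mul_assoc)
    then have "indicator colball (s ** (?P ** a ** ?P)) = (indicator colball (y ** (?P ** a ** ?P)) :: ennreal)"
      by (simp add: colball_def indicator_def)
    then show ?thesis
      unfolding e using s(1) by (simp add: bdet_mult ennreal_mult power_mult_distrib mult.assoc)
  qed
  have "(\<integral>\<^sup>+a. ?K a \<partial>mlebesgue I I) = ennreal (bdet I s) ^ card I * (\<integral>\<^sup>+a. ?K (s ** a) \<partial>mlebesgue I I)"
    by (rule nn_integral_mlebesgue_left[OF s, symmetric]) measurable
  also have "\<dots> = ennreal (bdet I s) ^ card I * (ennreal (bdet I s) ^ ?m * ?T)"
    unfolding K by (subst nn_integral_cmult) auto
  finally have 1: "(\<integral>\<^sup>+a. ?K a \<partial>mlebesgue I I) = ennreal (bdet I s) ^ CARD('n) * ?T"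
    by (simp add: n power_add mult.assoc)
  have "ballvol I y = ballvol I s"
  proof -
    have "norm (y *v c) = norm (s *v c)" for c
      using y(1)[of c] by (simp add: matrix_vector_mul_assoc y(2))
    then show ?thesis by (simp add: ballvol_def)
  qed
  then have "ballvol I ?P = ennreal (bdet I s) * ballvol I y"
    using ballvol_mult[OF s, of ?P] blockD[OF s(1)] by simp
  then show ?thesis unfolding 1 by (simp add: power_mult_distrib mult_ac)
qed

text \<open>The unit ball of R^I lies between two boxes of positive finite volume.\<close>

lemma ballvol_cproj_finite: "ballvol I (cproj I) \<noteq> top"
  and ballvol_cproj_pos: "ballvol I (cproj I) \<noteq> 0"
proof -
  let ?P = "cproj I :: real ^ 'a ^ 'a" and ?S = "{c. norm (cproj I *v c) \<le> 1}"
  have S[measurable]: "?S \<in> sets borel" by measurable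
  \<comment> \<open>With this half-side the absolute values of the coordinates sum to at most
    1.\<close>
  define r where "r = 1 / real CARD('a)"
  have r: "0 < r" by (simp add: r_def)
  let ?B = "\<lambda>r::real. {x :: real ^ 'a. \<forall>i. x $ i \<in> (if i \<in> I then {-r..r} else UNIV)}"
  have [measurable]: "(if i \<in> I then {-r..r} else UNIV) \<in> sets borel" for i and r :: real by simp
  have [measurable]: "?B r \<in> sets borel" for r by measurable
  have B: "emeasure (clebesgue I) (?B r) = (\<Prod>i\<in>UNIV. if i \<in> I then ennreal (2 * r) else 1)" if "0 < r" for r
  proof -
    have "emeasure (clebesgue I) (?B r) = (\<Prod>i\<in>UNIV. emeasure (on_coords I lborel i) (if i \<in> I then {-r..r} else UNIV))"
      unfolding clebesgue_def by (intro emeasure_vec_measure_box) auto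
    also have "\<dots> = (\<Prod>i\<in>UNIV. if i \<in> I then ennreal (2 * r) else 1)"
      using that by (intro prod.cong) (auto simp: on_coords_def)
    finally show ?thesis .
  qed
  have "?S \<subseteq> ?B 1"
  proof safe
    fix x i assume "norm (?P *v x) \<le> 1"
    then have "\<bar>(?P *v x) $ i\<bar> \<le> 1" using component_le_norm_cart[of "?P *v x" i] by linarith
    then show "x $ i \<in> (if i \<in> I then {-1..1} else UNIV)" by (auto simp: cproj_mult_vec)
  qed
  then have "ballvol I ?P \<le> emeasure (clebesgue I) (?B 1)" unfolding ballvol_def by (intro emeasure_mono) auto
  also have "\<dots> < top" by (subst B) (auto simp: less_top[symmetric] ennreal_prod_eq_top)
  finally show "ballvol I ?P \<noteq> top" by simp
  have "?B r \<subseteq> ?S"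
  proof safe
    fix x assume x: "\<forall>i. x $ i \<in> (if i \<in> I then {-r..r} else UNIV)"
    have "norm (?P *v x) \<le> (\<Sum>i\<in>UNIV. \<bar>(?P *v x) $ i\<bar>)" by (rule norm_le_l1_cart)
    also have "\<dots> \<le> (\<Sum>i\<in>(UNIV::'a set). r)"
    proof (rule sum_mono)
      fix i show "\<bar>(?P *v x) $ i\<bar> \<le> r" using x[rule_format, of i] r by (auto simp: cproj_mult_vec)
    qed
    finally show "norm (?P *v x) \<le> 1" by (simp add: r_def)
  qed
  then have "emeasure (clebesgue I) (?B r) \<le> ballvol I ?P" unfolding ballvol_def by (intro emeasure_mono) auto
  moreover have "emeasure (clebesgue I) (?B r) \<noteq> 0" using r by (subst B) auto
  ultimately show "ballvol I ?P \<noteq> 0" by auto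
qed

text \<open>Transposition turns the condition on columns into one on rows, for which the measure is
  a product of ball volumes and point masses.\<close>

lemma emeasure_colball: "emeasure (mlebesgue UNIV I) colball \<noteq> 0" "emeasure (mlebesgue UNIV I) colball \<noteq> top"
proof -
  let ?B = "{x :: real ^ 'a ^ 'a. \<forall>i. x $ i \<in> cball 0 1}"
  have [measurable]: "cball (0 :: real ^ 'a) 1 \<in> sets borel" by simp
  have [measurable]: "?B \<in> sets borel" by measurable
  have e: "transpose y \<in> ?B \<longleftrightarrow> y \<in> colball" for y :: "real ^ 'a ^ 'a"
    by (auto simp: colball_def matrix_vector_mult_basis column_def transpose_def)
  have "emeasure (mlebesgue UNIV I) colball = (\<integral>\<^sup>+y. indicator colball y \<partial>mlebesgue UNIV I)"
    by simp
  also have "\<dots> = (\<integral>\<^sup>+y. indicator ?B (transpose y) \<partial>mlebesgue UNIV I)"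
    by (simp only: indicator_def e)
  also have "\<dots> = (\<integral>\<^sup>+y. indicator ?B y \<partial>mlebesgue I UNIV)"
    by (rule nn_integral_mlebesgue_transpose) measurable
  also have "\<dots> = emeasure (mlebesgue I UNIV) ?B" by simp
  also have "\<dots> = (\<Prod>i\<in>UNIV. emeasure (on_coords I (clebesgue UNIV) i) (cball (0 :: real ^ 'a) 1))"
    unfolding mlebesgue_def by (intro emeasure_vec_measure_box) auto
  finally have *: "emeasure (mlebesgue UNIV I) colball = \<dots>" .
  have b: "emeasure lborel (cball (0 :: real ^ 'a) 1) = ballvol UNIV (cproj UNIV :: real ^ 'a ^ 'a)"
    by (auto simp: ballvol_def clebesgue_UNIV cball_def dist_norm intro!: arg_cong[where f="emeasure lborel"])
  show "emeasure (mlebesgue UNIV I) colball \<noteq> 0" "emeasure (mlebesgue UNIV I) colball \<noteq> top"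
    unfolding * using ballvol_cproj_pos[where ?'a='a, of UNIV] ballvol_cproj_finite[where ?'a='a, of UNIV]
    by (auto simp: ennreal_prod_eq_top on_coords_def clebesgue_UNIV b simp del: cproj_UNIV)
qed

subsection \<open>Orthonormal frames and orthogonal projections\<close>

definition coord_space :: "'n::finite set \<Rightarrow> (real ^ 'n) set" where
  "coord_space I = range ((*v) (cproj I))"

lemma coord_space_iff: "x \<in> coord_space I \<longleftrightarrow> cproj I *v x = x"
  by (auto simp: coord_space_def image_iff) metis

lemma subspace_coord_space [simp]: "subspace (coord_space I)"
  unfolding coord_space_def by (intro linear_subspace_image) auto

lemma dim_coord_space [simp]: "dim (coord_space I) = card I"
proof -
  have "coord_space I = {x :: real ^ 'a. \<forall>i. i \<notin> I \<longrightarrow> x $ i = 0}"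
    by (auto simp: set_eq_iff coord_space_iff cproj_mult_vec vec_eq_iff)
  then show ?thesis using dim_substandard_cart[where d=I and ?'a=real]
    by (simp add: dim_vec_eq)
qed

lemma orthogonal_matrix_norm:
  assumes "orthogonal_matrix U" shows "norm (U *v x) = norm (x :: real ^ 'n::finite)"
proof -
  have "orthogonal_transformation ((*v) U)"
    using assms by (simp add: orthogonal_transformation_matrix)
  then show ?thesis by (simp add: orthogonal_transformation)
qed

lemma orthogonal_matrix_cancel:
  assumes "orthogonal_matrix (U :: real ^ 'n::finite ^ 'n)"
  shows "transpose U ** U = mat 1" "U ** transpose U = mat 1"
    "transpose U ** (U ** A) = A" "U ** (transpose U ** A) = A"
    "transpose U *v (U *v x) = x" "U *v (transpose U *v x) = x"
  using assms by (auto simp: orthogonal_matrix_def matrix_mul_assoc matrix_vector_mul_assoc simp del: transpose_matrix_vector)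

lemma dim_orthogonal_image:
  fixes U :: "real ^ 'n::finite ^ 'n"
  assumes "orthogonal_matrix U"
  shows "dim ((*v) U ` coord_space I) = card I"
proof -
  have "inj ((*v) U)" by (metis injI orthogonal_matrix_cancel(5)[OF assms])
  then show ?thesis using dim_image_eq[of "(*v) U" "coord_space I"] by (simp add: inj_on_subset)
qed

lemma orthogonal_matrix_det: "orthogonal_matrix (U :: real ^ 'n::finite ^ 'n) \<Longrightarrow> \<bar>det U\<bar> = 1"
  using det_orthogonal_matrix[of U] by auto

lemma norm_cproj_split: "(norm (x :: real ^ 'n::finite))\<^sup>2 = (norm (cproj I *v x))\<^sup>2 + (norm (cproj (- I) *v x))\<^sup>2"
  unfolding norm_vec_def L2_set_def
  by (simp add: sum_nonneg sum.distrib[symmetric] cproj_mult_vec if_distrib cong: if_cong)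
     (intro sum.cong, auto)

text \<open>Isometries of the two complementary coordinate subspaces onto \<open>E\<close> and onto
  its orthogonal complement add up to an isometry of R^n. Such a frame reduces questions about
  \<open>E\<close> to coordinates.\<close>

lemma exists_orthogonal_frame:
  fixes E :: "(real ^ 'n::finite) set" and I :: "'n set"
  assumes E: "subspace E" "dim E = card I"
  shows "\<exists>U. orthogonal_matrix U \<and> (*v) U ` coord_space I = E"
proof -
  obtain f where f: "linear f" "f ` coord_space I = E" "\<And>x. x \<in> coord_space I \<Longrightarrow> norm (f x) = norm x"
    using isometry_subspaces[of "coord_space I" E] E by auto
  let ?E' = "{y \<in> UNIV. \<forall>x\<in>E. orthogonal x y}"
  have "dim ?E' + dim E = DIM(real ^ 'n)"
    using dim_subspace_orthogonal_to_vectors[OF E(1) subspace_UNIV] by simp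
  moreover have "card I + card (- I) = CARD('n)"
    using card_Un_disjoint[of I "- I"] by (simp add: Compl_partition)
  ultimately have d: "dim ?E' = card (- I)" using E(2) by simp
  have s: "subspace ?E'" by (auto simp: subspace_def orthogonal_def inner_add_right)
  obtain f' where f': "linear f'" "f' ` coord_space (- I) = ?E'" "\<And>x. x \<in> coord_space (- I) \<Longrightarrow> norm (f' x) = norm x"
    using isometry_subspaces[of "coord_space (- I)" ?E'] s d by auto
  define T where "T x = f (cproj I *v x) + f' (cproj (- I) *v x)" for x
  have c: "cproj J *v x \<in> coord_space J" for J and x :: "real ^ 'n" by (simp add: coord_space_def)
  have "linear T" unfolding T_def
    by (intro linear_compose_add linear_compose[OF _ f(1), unfolded comp_def] linear_compose[OF _ f'(1), unfolded comp_def]) auto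
  moreover have "norm (T x) = norm x" for x
  proof -
    have "f (cproj I *v x) \<in> E" "f' (cproj (- I) *v x) \<in> ?E'" using f(2) f'(2) c by blast+
    then have "orthogonal (f (cproj I *v x)) (f' (cproj (- I) *v x))" by auto
    then have "(norm (T x))\<^sup>2 = (norm (f (cproj I *v x)))\<^sup>2 + (norm (f' (cproj (- I) *v x)))\<^sup>2"
      unfolding T_def by (rule norm_add_Pythagorean)
    also have "\<dots> = (norm x)\<^sup>2" using f(3)[OF c] f'(3)[OF c] norm_cproj_split[of x I] by simp
    finally show ?thesis by simp
  qed
  ultimately have ot: "orthogonal_transformation T" by (simp add: orthogonal_transformation)
  then have om: "orthogonal_matrix (matrix T)" by (simp add: orthogonal_transformation_matrix)
  have Tm: "matrix T *v x = T x" for x using matrix_vector_mul(2)[OF \<open>linear T\<close>] by metis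
  have T: "T x = f x" if "x \<in> coord_space I" for x
  proof -
    have "cproj I *v x = x" using that by (simp add: coord_space_iff)
    moreover from this have "cproj (- I) *v x = 0"
      by (metis cproj_compl(2) matrix_vector_mul_assoc matrix_vector_mult_0)
    ultimately show ?thesis using f'(1) by (simp add: T_def linear_0)
  qed
  have "(*v) (matrix T) ` coord_space I = f ` coord_space I"
    by (intro image_cong) (auto simp: Tm T)
  then show ?thesis using om f(2) by blast
qed

text \<open>The orthogonal projection embeds the Grassmannian into a matrix space, where
  measurability and an invariant metric are at hand.\<close>

definition prj :: "(real ^ 'n::finite) set \<Rightarrow> real ^ 'n ^ 'n" where
  "prj E = (SOME p. transpose p = p \<and> p ** p = p \<and> range ((*v) p) = E)"

text \<open>Equal ranges give \<open>p ** q = q\<close> and \<open>q ** p = p\<close>; transposing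
  the second and using symmetry yields equality.\<close>

lemma projection_unique:
  fixes p q :: "real ^ 'n::finite ^ 'n"
  assumes p: "transpose p = p" "p ** p = p" and q: "transpose q = q" "q ** q = q"
    and r: "range ((*v) p) = range ((*v) q)"
  shows "p = q"
proof -
  have *: "p ** q = q" if p: "p ** p = p" and r: "range ((*v) q) \<subseteq> range ((*v) p)" for p q :: "real ^ 'n ^ 'n"
  proof (subst matrix_eq, rule allI)
    fix x
    have "q *v x \<in> range ((*v) p)" using r by blast
    then obtain y where "q *v x = p *v y" by auto
    then show "(p ** q) *v x = q *v x" using p by (metis matrix_vector_mul_assoc)
  qed
  have "p ** q = q" "q ** p = p" using *[of p q] *[of q p] p q r by auto
  moreover have "transpose (q ** p) = p ** q" using p q by (simp add: matrix_transpose_mul)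
  ultimately show ?thesis using p by simp
qed

lemma prj_frame:
  assumes U: "orthogonal_matrix U"
  shows "prj ((*v) U ` coord_space I) = U ** cproj I ** transpose U"
proof -
  let ?p = "U ** cproj I ** transpose U" and ?E = "(*v) U ` coord_space I"
  have t: "transpose ?p = ?p" by (simp add: matrix_transpose_mul matrix_mul_assoc)
  have "?p ** ?p = U ** (cproj I ** ((transpose U ** U) ** cproj I)) ** transpose U"
    by (simp only: matrix_mul_assoc)
  then have i: "?p ** ?p = ?p" using orthogonal_matrix_cancel[OF U] by simp
  have r: "range ((*v) ?p) = ?E"
  proof safe
    fix x show "?p *v x \<in> ?E"
      by (auto simp: coord_space_def matrix_vector_mul_assoc[symmetric] simp del: transpose_matrix_vector)
  next
    fix x assume "x \<in> coord_space I"
    then have "?p *v (U *v x) = U *v x" using orthogonal_matrix_cancel[OF U]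
      by (simp add: coord_space_iff matrix_vector_mul_assoc[symmetric] del: transpose_matrix_vector)
    then show "U *v x \<in> range ((*v) ?p)" by (metis rangeI)
  qed
  have "transpose (prj ?E) = prj ?E \<and> prj ?E ** prj ?E = prj ?E \<and> range ((*v) (prj ?E)) = ?E"
    unfolding prj_def using someI[of "\<lambda>p. transpose p = p \<and> p ** p = p \<and> range ((*v) p) = ?E" ?p] t i r by blast
  then show ?thesis using projection_unique[of "prj ?E" ?p] t i r by simp
qed

lemma
  fixes E :: "(real ^ 'n::finite) set"
  assumes E: "subspace E"
  shows transpose_prj: "transpose (prj E) = prj E" and prj_idem: "prj E ** prj E = prj E"
    and range_prj: "range ((*v) (prj E)) = E"
proof -
  have "dim E \<le> card (UNIV :: 'n set)" using dim_subset_UNIV[of E] by simp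
  then obtain I :: "'n set" where I: "card I = dim E" by (metis obtain_subset_with_card_n)
  obtain U where U: "orthogonal_matrix U" and UE: "(*v) U ` coord_space I = E"
    using exists_orthogonal_frame[OF E I[symmetric]] by auto
  have p: "prj E = U ** cproj I ** transpose U" using prj_frame[OF U, of I] UE by simp
  show "transpose (prj E) = prj E" unfolding p by (simp add: matrix_transpose_mul matrix_mul_assoc)
  have "prj E ** prj E = U ** (cproj I ** ((transpose U ** U) ** cproj I)) ** transpose U"
    unfolding p by (simp only: matrix_mul_assoc)
  then show "prj E ** prj E = prj E" unfolding p using orthogonal_matrix_cancel[OF U] by simp
  have "range ((*v) (prj E)) = (*v) (U ** cproj I) ` range ((*v) (transpose U))"
    unfolding p by (auto simp: image_image matrix_vector_mul_assoc simp del: transpose_matrix_vector)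
  also have "range ((*v) (transpose U)) = UNIV"
    by (metis orthogonal_matrix_cancel(5)[OF U] surj_def)
  also have "(*v) (U ** cproj I) ` UNIV = E"
    unfolding UE[symmetric] coord_space_def by (auto simp: image_image matrix_vector_mul_assoc)
  finally show "range ((*v) (prj E)) = E" .
qed

lemma prj_fix: "subspace E \<Longrightarrow> x \<in> E \<Longrightarrow> prj E *v x = x"
  by (metis imageE matrix_vector_mul_assoc prj_idem range_prj)

lemma prj_in: "subspace E \<Longrightarrow> prj E *v x \<in> E"
  using range_prj by blast

lemma prj_orthogonal:
  assumes "subspace E" "y \<in> E"
  shows "y \<bullet> (x - prj E *v x) = 0"
proof -
  have "y \<bullet> (prj E *v x) = (transpose (prj E) *v y) \<bullet> x" by (simp add: dot_lmul_matrix)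
  then show ?thesis using assms by (simp add: transpose_prj prj_fix inner_diff_right)
qed

lemma nn_integral_lborel_orthogonal:
  fixes U :: "real ^ 'n::finite ^ 'n"
  assumes "orthogonal_matrix U" "F \<in> borel_measurable borel"
  shows "(\<integral>\<^sup>+x. F (U *v x) \<partial>lborel) = (\<integral>\<^sup>+x. F x \<partial>lborel)"
  using nn_integral_lborel_linear[of U F] orthogonal_matrix_det[OF assms(1)] assms(2)
  by (cases "det U = 0") auto

subsection \<open>The Jacobian of a linear map on a subspace\<close>

text \<open>Up to a constant, \<open>jacvol g E\<close> is the reciprocal of the Jacobian of \<open>g\<close> on \<open>E\<close>.\<close>

definition jacvol :: "real ^ 'n::finite ^ 'n \<Rightarrow> (real ^ 'n) set \<Rightarrow> ennreal" where
  "jacvol g E = emeasure lborel {z. norm (g *v (prj E *v z)) \<le> 1 \<and> norm (z - prj E *v z) \<le> 1}"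

text \<open>In orthonormal coordinates the body is the product of an ellipsoid along
  \<open>E\<close> and the unit ball of the complement. The second factor does not depend on
  \<open>g\<close> and cancels in quotients.\<close>

lemma jacvol_frame:
  fixes U :: "real ^ 'n::finite ^ 'n"
  assumes U: "orthogonal_matrix U"
  shows "jacvol g ((*v) U ` coord_space I) = ballvol I (g ** U ** cproj I) * ballvol (- I) (cproj (- I))"
proof -
  let ?E = "(*v) U ` coord_space I" and ?P = "cproj I :: real ^ 'n ^ 'n" and ?Q = "cproj (- I) :: real ^ 'n ^ 'n"
  let ?S = "{z. norm (g *v (prj ?E *v z)) \<le> 1 \<and> norm (z - prj ?E *v z) \<le> 1}"
  let ?A = "{c. norm ((g ** U ** ?P) *v c) \<le> 1}" and ?B = "{c. norm (?Q *v c) \<le> 1}"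
  interpret sigma_finite_measure "clebesgue (- I)" by (rule sigma_finite_clebesgue)
  have [measurable]: "?S \<in> sets borel" "?A \<in> sets borel" "?B \<in> sets borel" by measurable
  have pU: "prj ?E *v (U *v x) = U *v (?P *v x)" for x
    unfolding prj_frame[OF U] using orthogonal_matrix_cancel[OF U]
    by (simp add: matrix_vector_mul_assoc[symmetric] del: transpose_matrix_vector)
  have Ux: "U *v x - U *v (?P *v x) = U *v (?Q *v x)" for x
  proof -
    have "x = ?P *v x + ?Q *v x"
      using matrix_vector_mult_add_rdistrib[of ?P ?Q x] by (simp add: cproj_add_compl)
    then have "x - ?P *v x = ?Q *v x" by (metis add_diff_cancel_left')
    then show ?thesis by (simp add: matrix_vector_mult_diff_distrib[symmetric])
  qed
  have S: "U *v x \<in> ?S \<longleftrightarrow> x \<in> ?A \<and> x \<in> ?B" for x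
    by (simp add: pU Ux orthogonal_matrix_norm[OF U] matrix_vector_mul_assoc[symmetric])
  have A: "?P *v c + ?Q *v w \<in> ?A \<longleftrightarrow> c \<in> ?A" for c w
    by (simp add: matrix_vector_right_distrib matrix_vector_mul_assoc matrix_mul_assoc[symmetric])
  have B: "?P *v c + ?Q *v w \<in> ?B \<longleftrightarrow> w \<in> ?B" for c w
    by (simp add: matrix_vector_right_distrib matrix_vector_mul_assoc matrix_mul_assoc[symmetric])
  have "jacvol g ?E = (\<integral>\<^sup>+x. indicator ?S x \<partial>lborel)" by (simp add: jacvol_def)
  also have "\<dots> = (\<integral>\<^sup>+x. indicator ?S (U *v x) \<partial>lborel)"
    by (rule nn_integral_lborel_orthogonal[OF U, symmetric]) measurable
  also have "\<dots> = (\<integral>\<^sup>+x. indicator ?A x * indicator ?B x \<partial>lborel)"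
    by (intro nn_integral_cong) (simp only: indicator_def S, simp)
  also have "\<dots> = (\<integral>\<^sup>+c. \<integral>\<^sup>+w. indicator ?A c * indicator ?B w \<partial>clebesgue (- I) \<partial>clebesgue I)"
    by (subst nn_integral_lborel_split[where I=I], measurable) (simp only: indicator_def A B)
  also have "\<dots> = (\<integral>\<^sup>+c. indicator ?A c * emeasure (clebesgue (- I)) ?B \<partial>clebesgue I)"
    by (intro nn_integral_cong) (subst nn_integral_cmult, auto)
  also have "\<dots> = ballvol I (g ** U ** ?P) * ballvol (- I) ?Q"
    by (subst nn_integral_multc) (auto simp: ballvol_def)
  finally show ?thesis .
qed

lemma jacvol_id:
  fixes E :: "(real ^ 'n::finite) set" and I :: "'n set"
  assumes "subspace E" "dim E = card I"
  shows "jacvol (mat 1) E = ballvol I (cproj I) * ballvol (- I) (cproj (- I))"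
proof -
  obtain U where U: "orthogonal_matrix U" "(*v) U ` coord_space I = E"
    using exists_orthogonal_frame[OF assms] by auto
  have "ballvol I (U ** cproj I) = ballvol I (cproj I)"
    by (simp add: ballvol_def matrix_vector_mul_assoc[symmetric] orthogonal_matrix_norm[OF U(1)])
  then show ?thesis using jacvol_frame[OF U(1), of "mat 1" I] U(2) by simp
qed

text \<open>The matrix of \<open>y\<close> with respect to an orthonormal basis of its range: a
  frame is an isometry times an invertible block.\<close>

lemma frame_coordinates:
  fixes U :: "real ^ 'n::finite ^ 'n"
  assumes U: "orthogonal_matrix U" and y: "y ** cproj I = y" and E: "range ((*v) y) = (*v) U ` coord_space I"
    and inj: "\<And>c. y *v c = 0 \<Longrightarrow> cproj I *v c = 0"
  shows "block I (transpose U ** y)" "bdet I (transpose U ** y) \<noteq> 0" "U ** (transpose U ** y) = y"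
proof -
  let ?s = "transpose U ** y"
  show Us: "U ** ?s = y" using orthogonal_matrix_cancel[OF U] by simp
  have "cproj I ** ?s = ?s"
  proof (subst matrix_eq, rule allI)
    fix x
    have "y *v x \<in> (*v) U ` coord_space I" using E by blast
    then obtain v where v: "y *v x = U *v v" "v \<in> coord_space I" by auto
    have "?s *v x = v" using v(1) orthogonal_matrix_cancel[OF U]
      by (simp add: matrix_vector_mul_assoc[symmetric] del: transpose_matrix_vector)
    then show "(cproj I ** ?s) *v x = ?s *v x" using v(2) by (simp add: coord_space_iff matrix_vector_mul_assoc[symmetric] del: transpose_matrix_vector)
  qed
  then show b: "block I ?s" using y by (simp add: block_def matrix_mul_assoc[symmetric])
  show "bdet I ?s \<noteq> 0"
    unfolding bdet_nz_iff[OF b] using inj Us by (metis matrix_vector_mul_assoc matrix_vector_mult_0_right)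
qed

text \<open>With \<open>y = U ** s\<close> both sides reduce to the same product, containing the
  factor \<open>bdet I s\<close> once. Hence the ratio of the ellipsoid volumes for
  \<open>g ** y\<close> and \<open>y\<close> depends on the span alone.\<close>

lemma ballvol_jacvol:
  fixes y :: "real ^ 'n::finite ^ 'n"
  assumes y: "y ** cproj I = y" and inj: "\<And>c. y *v c = 0 \<Longrightarrow> cproj I *v c = 0"
    and E: "range ((*v) y) = E" "dim E = card I"
  shows "ballvol I (g ** y) * jacvol (mat 1) E = ballvol I y * jacvol g E"
proof -
  have sE: "subspace E" unfolding E(1)[symmetric] by (intro linear_subspace_image) auto
  obtain U where U: "orthogonal_matrix U" "(*v) U ` coord_space I = E"
    using exists_orthogonal_frame[OF sE E(2)] by auto
  define s where "s = transpose U ** y"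
  have s: "block I s" "bdet I s \<noteq> 0" "U ** s = y"
    unfolding s_def using frame_coordinates[OF U(1) y _ inj] E(1) U(2) by auto
  have Ps: "U ** cproj I ** s = y" using blockD[OF s(1)] s(3) by (simp add: matrix_mul_assoc[symmetric])
  have 1: "ennreal (bdet I s) * ballvol I (g ** y) = ballvol I (g ** U ** cproj I)"
    using ballvol_mult[OF s(1,2), of "g ** U ** cproj I"] Ps by (simp add: matrix_mul_assoc[symmetric])
  have "ballvol I (U ** cproj I) = ballvol I (cproj I)"
    by (simp add: ballvol_def matrix_vector_mul_assoc[symmetric] orthogonal_matrix_norm[OF U(1)])
  then have 2: "ennreal (bdet I s) * ballvol I y = ballvol I (cproj I)"
    using ballvol_mult[OF s(1,2), of "U ** cproj I"] Ps by simp
  have J: "jacvol g E = ballvol I (g ** U ** cproj I) * ballvol (- I) (cproj (- I))"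
    using jacvol_frame[OF U(1), of g I] U(2) by simp
  show ?thesis
    unfolding J jacvol_id[OF sE E(2)] 1[symmetric] 2[symmetric] by (simp add: mult_ac)
qed

subsection \<open>Bimeasurable changes of variables for arbitrary integrands\<close>

text \<open>The integral is a supremum over simple functions below the integrand, so bounding
  measurable minorants suffices for an arbitrary \<open>f\<close>.\<close>

lemma nn_integral_leI_measurable:
  assumes "\<And>u. u \<in> borel_measurable M \<Longrightarrow> u \<le> f \<Longrightarrow> (\<integral>\<^sup>+x. u x \<partial>M) \<le> X"
  shows "(\<integral>\<^sup>+x. f x \<partial>M) \<le> X"
  unfolding nn_integral_def
proof (rule SUP_least, clarify)
  fix s assume s: "simple_function M s" "s \<le> f"
  then have "(\<integral>\<^sup>+x. s x \<partial>M) \<le> X" by (intro assms borel_measurable_simple_function)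
  then show "integral\<^sup>S M s \<le> X" using s(1) by (simp add: nn_integral_eq_simple_integral)
qed

text \<open>The integral of a nonmeasurable function is a lower integral, so it is transported by
  bimeasurable bijections as well.\<close>

lemma nn_integral_transport:
  assumes T[measurable]: "T \<in> M \<rightarrow>\<^sub>M N" and T'[measurable]: "T' \<in> N \<rightarrow>\<^sub>M M"
    and TT': "\<And>x. x \<in> space M \<Longrightarrow> T' (T x) = x" "\<And>y. y \<in> space N \<Longrightarrow> T (T' y) = y"
    and w[measurable]: "w \<in> borel_measurable M" and w0: "\<And>x. x \<in> space M \<Longrightarrow> w x \<noteq> 0 \<and> w x \<noteq> top"
    and eq: "\<And>\<psi>. \<psi> \<in> borel_measurable N \<Longrightarrow> (\<integral>\<^sup>+x. \<psi> (T x) * w x \<partial>M) = (\<integral>\<^sup>+y. \<psi> y \<partial>N)"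
  shows "(\<integral>\<^sup>+x. \<phi> (T x) * w x \<partial>M) = (\<integral>\<^sup>+y. \<phi> y \<partial>N)"
proof (rule antisym)
  show "(\<integral>\<^sup>+y. \<phi> y \<partial>N) \<le> (\<integral>\<^sup>+x. \<phi> (T x) * w x \<partial>M)"
  proof (rule nn_integral_leI_measurable)
    fix u assume u: "u \<in> borel_measurable N" "u \<le> \<phi>"
    have "(\<integral>\<^sup>+x. u x \<partial>N) = (\<integral>\<^sup>+x. u (T x) * w x \<partial>M)" using eq[OF u(1)] by simp
    also have "\<dots> \<le> (\<integral>\<^sup>+x. \<phi> (T x) * w x \<partial>M)"
      using u(2) by (intro nn_integral_mono mult_right_mono) (auto simp: le_fun_def)
    finally show "(\<integral>\<^sup>+x. u x \<partial>N) \<le> \<dots>" .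
  qed
  show "(\<integral>\<^sup>+x. \<phi> (T x) * w x \<partial>M) \<le> (\<integral>\<^sup>+y. \<phi> y \<partial>N)"
  proof (rule nn_integral_leI_measurable)
    fix u assume u[measurable]: "u \<in> borel_measurable M" and le: "u \<le> (\<lambda>x. \<phi> (T x) * w x)"
    \<comment> \<open>Dividing by the weight carries a measurable minorant on \<open>M\<close> to
      one on \<open>N\<close>.\<close>
    let ?\<psi> = "\<lambda>y. u (T' y) / w (T' y)"
    have m: "?\<psi> \<in> borel_measurable N" by measurable
    have "(\<integral>\<^sup>+x. u x \<partial>M) = (\<integral>\<^sup>+x. ?\<psi> (T x) * w x \<partial>M)"
    proof (rule nn_integral_cong)
      fix x assume x: "x \<in> space M"
      have "u x / w x * w x = u x * w x / w x" by (simp add: ennreal_times_divide mult.commute)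
      then show "u x = ?\<psi> (T x) * w x" using x w0[OF x] by (simp add: TT' mult_divide_eq_ennreal)
    qed
    also have "\<dots> = (\<integral>\<^sup>+y. ?\<psi> y \<partial>N)" by (rule eq[OF m])
    also have "\<dots> \<le> (\<integral>\<^sup>+y. \<phi> y \<partial>N)"
    proof (rule nn_integral_mono)
      fix y assume y: "y \<in> space N"
      then have x: "T' y \<in> space M" using measurable_space[OF T'] by blast
      have "u (T' y) \<le> \<phi> y * w (T' y)" using le[unfolded le_fun_def, rule_format, of "T' y"] y by (simp add: TT')
      then have "?\<psi> y \<le> \<phi> y * w (T' y) / w (T' y)" by (rule divide_right_mono_ennreal)
      then show "?\<psi> y \<le> \<phi> y" using w0[OF x] by (simp add: mult_divide_eq_ennreal)
    qed
    finally show "(\<integral>\<^sup>+x. u x \<partial>M) \<le> \<dots>" .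
  qed
qed

lemma AE_transport:
  assumes T[measurable]: "T \<in> M \<rightarrow>\<^sub>M N" and N: "\<And>A. A \<in> sets N \<Longrightarrow> emeasure N A = 0 \<longleftrightarrow> emeasure M (T -` A \<inter> space M) = 0"
    and "AE y in N. P y"
  shows "AE x in M. P (T x)"
proof -
  from assms(3) obtain Z where Z: "{y \<in> space N. \<not> P y} \<subseteq> Z" "Z \<in> sets N" "emeasure N Z = 0"
    by (auto elim: AE_E)
  have "T -` Z \<inter> space M \<in> null_sets M" using Z N by (auto simp: null_sets_def)
  then show ?thesis using Z(1) measurable_space[OF T] by (rule_tac AE_I') auto
qed

text \<open>Completion adds subsets of null sets, so \<open>T\<close> has to pull null sets back to
  null sets.\<close>

lemma measurable_completion_transport:
  assumes T: "T \<in> M \<rightarrow>\<^sub>M N" and N: "\<And>A. A \<in> sets N \<Longrightarrow> emeasure N A = 0 \<longleftrightarrow> emeasure M (T -` A \<inter> space M) = 0"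
  shows "T \<in> completion M \<rightarrow>\<^sub>M completion N"
proof -
  show ?thesis
  proof (rule completion.measurable_completion2[OF measurable_completion[OF T]])
    show "null_sets N \<subseteq> null_sets (distr (completion M) N T)"
      using N T by (auto simp: distr_completion[OF T] null_sets_def emeasure_distr)
  qed
qed

text \<open>\<open>esssup\<close> is \<open>top\<close> for nonmeasurable functions, so besides the
  almost everywhere bounds measurability itself must pass in both directions. This uses both maps
  and the correspondence of null sets.\<close>

lemma esssup_transport:
  fixes f :: "'b \<Rightarrow> ennreal"
  assumes T: "T \<in> M \<rightarrow>\<^sub>M N" and T': "T' \<in> N \<rightarrow>\<^sub>M M"
    and TT': "\<And>x. x \<in> space M \<Longrightarrow> T' (T x) = x" "\<And>y. y \<in> space N \<Longrightarrow> T (T' y) = y"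
    and N: "\<And>A. A \<in> sets N \<Longrightarrow> emeasure N A = 0 \<longleftrightarrow> emeasure M (T -` A \<inter> space M) = 0"
  shows "esssup (completion M) (\<lambda>x. f (T x)) = esssup (completion N) f"
proof -
  have M: "emeasure M A = 0 \<longleftrightarrow> emeasure N (T' -` A \<inter> space N) = 0" if A: "A \<in> sets M" for A
  proof -
    have "T -` (T' -` A \<inter> space N) \<inter> space M = A"
      using measurable_space[OF T] sets.sets_into_space[OF A] TT'(1) by auto
    then show ?thesis using N[OF measurable_sets[OF T' A]] by simp
  qed
  have cT: "T \<in> completion M \<rightarrow>\<^sub>M completion N" using T N by (rule measurable_completion_transport)
  have cT': "T' \<in> completion N \<rightarrow>\<^sub>M completion M" using T' M by (rule measurable_completion_transport)
  have meas: "(\<lambda>x. f (T x)) \<in> borel_measurable (completion M) \<longleftrightarrow> f \<in> borel_measurable (completion N)"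
  proof
    assume "(\<lambda>x. f (T x)) \<in> borel_measurable (completion M)"
    then have "(\<lambda>x. f (T x)) \<circ> T' \<in> borel_measurable (completion N)" by (rule measurable_comp[OF cT'])
    then show "f \<in> borel_measurable (completion N)"
      by (rule measurable_cong[THEN iffD1, rotated]) (simp add: TT')
  next
    assume "f \<in> borel_measurable (completion N)"
    then show "(\<lambda>x. f (T x)) \<in> borel_measurable (completion M)"
      using measurable_comp[OF cT] by (auto simp: comp_def)
  qed
  have AE: "(AE x in completion M. f (T x) \<le> z) \<longleftrightarrow> (AE x in completion N. f x \<le> z)" for z
    unfolding AE_completion_iff
  proof
    assume "AE x in M. f (T x) \<le> z"
    then have "AE y in N. f (T (T' y)) \<le> z" using AE_transport[OF T' M, of "\<lambda>x. f (T x) \<le> z"] by blast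
    then show "AE x in N. f x \<le> z" by (rule AE_mp) (auto simp: TT')
  next
    assume "AE x in N. f x \<le> z"
    then show "AE x in M. f (T x) \<le> z" using AE_transport[OF T N, of "\<lambda>x. f x \<le> z"] by blast
  qed
  show ?thesis
  proof (cases "f \<in> borel_measurable (completion N)")
    case True
    then show ?thesis using meas by (simp add: esssup_eq_AE AE)
  next
    case False
    then show ?thesis using meas by (simp add: esssup_non_measurable)
  qed
qed

subsection \<open>Lebesgue measure on flats\<close>

text \<open>For orthogonal \<open>A\<close> this is Lebesgue measure on the flat through
  \<open>a\<close>; for other invertible \<open>A\<close> it differs from that by a Jacobian, which
  is how images under linear maps are tracked.\<close>

definition flatm :: "'n::finite set \<Rightarrow> real ^ 'n \<Rightarrow> real ^ 'n ^ 'n \<Rightarrow> (real ^ 'n) measure" where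
  "flatm I a A = distr (clebesgue I) borel (\<lambda>c. a + A *v c)"

lemma sets_flatm [simp, measurable_cong]: "sets (flatm I a A) = sets borel"
  and space_flatm [simp]: "space (flatm I a A) = UNIV"
  by (simp_all add: flatm_def)

lemma emeasure_flatm:
  assumes [measurable]: "S \<in> sets borel"
  shows "emeasure (flatm I a A) S = (\<integral>\<^sup>+c. indicator S (a + A *v c) \<partial>clebesgue I)"
proof -
  have "emeasure (flatm I a A) S = (\<integral>\<^sup>+c. indicator S c \<partial>flatm I a A)" by simp
  also have "\<dots> = (\<integral>\<^sup>+c. indicator S (a + A *v c) \<partial>clebesgue I)"
    unfolding flatm_def by (rule nn_integral_distr) measurable
  finally show ?thesis .
qed

lemma nn_integral_flatm:
  "F \<in> borel_measurable borel \<Longrightarrow> (\<integral>\<^sup>+x. F x \<partial>flatm I a A) = (\<integral>\<^sup>+c. F (a + A *v c) \<partial>clebesgue I)"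
  unfolding flatm_def by (rule nn_integral_distr) measurable

lemma flatm_cong:
  assumes "A ** cproj I = B ** cproj I"
  shows "flatm I a A = flatm I a B"
proof (rule measure_eqI)
  fix S assume "S \<in> sets (flatm I a A)"
  then have [measurable]: "S \<in> sets borel" by simp
  have e: "A *v (cproj I *v c) = B *v (cproj I *v c)" for c
    by (simp add: matrix_vector_mul_assoc assms)
  have "(\<integral>\<^sup>+c. indicator S (a + A *v c) \<partial>clebesgue I) = (\<integral>\<^sup>+c. indicator S (a + A *v (cproj I *v c)) \<partial>clebesgue I)"
    by (rule nn_integral_clebesgue_cproj[symmetric]) measurable
  also have "\<dots> = (\<integral>\<^sup>+c. indicator S (a + B *v c) \<partial>clebesgue I)"
    unfolding e by (rule nn_integral_clebesgue_cproj[of "\<lambda>c. indicator S (a + B *v c)"]) measurable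
  finally show "emeasure (flatm I a A) S = emeasure (flatm I a B) S" by (simp add: emeasure_flatm)
qed simp

lemma flatm_mult:
  assumes s: "block I s" "bdet I s \<noteq> 0"
  shows "scale_measure (ennreal (bdet I s)) (flatm I a (A ** s)) = flatm I a A"
proof (rule measure_eqI)
  fix S assume "S \<in> sets (scale_measure (ennreal (bdet I s)) (flatm I a (A ** s)))"
  then have [measurable]: "S \<in> sets borel" by simp
  show "emeasure (scale_measure (ennreal (bdet I s)) (flatm I a (A ** s))) S = emeasure (flatm I a A) S"
    using nn_integral_clebesgue_linear[OF s, of "\<lambda>c. indicator S (a + A *v c)"]
    by (simp add: emeasure_flatm matrix_vector_mul_assoc)
qed simp

lemma flatm_shift: "flatm I (a + A *v (cproj I *v v)) A = flatm I a A"
proof (rule measure_eqI)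
  fix S assume "S \<in> sets (flatm I (a + A *v (cproj I *v v)) A)"
  then have [measurable]: "S \<in> sets borel" by simp
  show "emeasure (flatm I (a + A *v (cproj I *v v)) A) S = emeasure (flatm I a A) S"
    using nn_integral_clebesgue_add[of "\<lambda>c. indicator S (a + A *v c)" I v]
    by (simp add: emeasure_flatm matrix_vector_right_distrib add_ac)
qed simp

lemma distr_flatm: "distr (flatm I a A) borel (\<lambda>x. h *v x + c) = flatm I (h *v a + c) (h ** A)"
  unfolding flatm_def
  by (subst distr_distr) (auto simp: comp_def matrix_vector_right_distrib matrix_vector_mul_assoc add_ac)

lemma columns_mult_vec:
  fixes e :: "'n::finite \<Rightarrow> real ^ 'm::finite"
  shows "(\<chi> r i. if i \<in> I then e i $ r else 0) *v c = (\<Sum>i\<in>I. c $ i *\<^sub>R e i)"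
proof -
  have "(\<Sum>i\<in>UNIV. (if i \<in> I then e i $ r else 0) * c $ i) = (\<Sum>i\<in>I. c $ i * e i $ r)" for r
    by (rule sum.mono_neutral_cong_right) auto
  then show ?thesis by (simp add: vec_eq_iff matrix_vector_mult_def)
qed

text \<open>Relabelling the basis by \<open>I\<close> turns the product measure in
  \<open>flat_lebesgue\<close> into \<open>clebesgue I\<close>, with the basis vectors as
  columns.\<close>

lemma flat_basis_coordinates:
  fixes B :: "(real ^ 'n::finite) set"
  assumes e: "bij_betw e I B"
  defines "q \<equiv> (\<chi> r i. if i \<in> I then e i $ r else 0)"
  shows "distr (\<Pi>\<^sub>M b\<in>B. (lborel :: real measure)) borel (\<lambda>c. a + (\<Sum>b\<in>B. c b *\<^sub>R b)) = flatm I a q"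
proof -
  let ?N = "\<lambda>_::real ^ 'n. lborel :: real measure"
  let ?P = "\<Pi>\<^sub>M b\<in>B. (lborel :: real measure)"
  let ?r = "inv_into I e"
  let ?g = "\<lambda>c :: real ^ 'n. \<lambda>b\<in>B. c $ ?r b"
  interpret product_sigma_finite ?N by standard
  have finB: "finite B" using bij_betw_finite[OF e] by simp
  have rI: "?r b \<in> I" "e (?r b) = b" if "b \<in> B" for b
    using that e by (auto simp: bij_betw_def inv_into_into f_inv_into_f)
  have re: "?r (e i) = i" if "i \<in> I" for i using that e by (auto simp: bij_betw_def)
  have g: "?g \<in> clebesgue I \<rightarrow>\<^sub>M ?P" by measurable
  have "distr (clebesgue I) ?P ?g = ?P"
  proof (rule PiM_eqI[OF finB])
    fix A assume "\<And>b. b \<in> B \<Longrightarrow> A b \<in> sets (lborel :: real measure)"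
    then have A: "A b \<in> sets borel" if "b \<in> B" for b using that by simp
    let ?A = "\<lambda>i. if i \<in> I then A (e i) else UNIV"
    have "emeasure (distr (clebesgue I) ?P ?g) (Pi\<^sub>E B A) = emeasure (clebesgue I) (?g -` Pi\<^sub>E B A \<inter> space (clebesgue I))"
      using A finB by (intro emeasure_distr[OF g] sets_PiM_I_finite) auto
    also have "?g -` Pi\<^sub>E B A \<inter> space (clebesgue I) = {c. \<forall>i. c $ i \<in> ?A i}"
    proof (rule Collect_eqI[THEN trans[rotated]])
      fix c
      show "(?g c \<in> Pi\<^sub>E B A) \<longleftrightarrow> (\<forall>i. c $ i \<in> ?A i)"
      proof
        assume *: "?g c \<in> Pi\<^sub>E B A"
        have "c $ i \<in> A (e i)" if "i \<in> I" for i
        proof -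
          have eB: "e i \<in> B" using e that by (auto simp: bij_betw_def)
          then have "?g c (e i) \<in> A (e i)" using * by (rule PiE_mem[rotated])
          then show ?thesis using eB re[OF that] by simp
        qed
        then show "\<forall>i. c $ i \<in> ?A i" by simp
      next
        assume *: "\<forall>i. c $ i \<in> ?A i"
        have "c $ ?r b \<in> A b" if "b \<in> B" for b using *[rule_format, of "?r b"] rI[OF that] by simp
        then show "?g c \<in> Pi\<^sub>E B A" by auto
      qed
    qed auto
    also have "emeasure (clebesgue I) \<dots> = (\<Prod>i\<in>UNIV. emeasure (on_coords I lborel i) (?A i))"
      unfolding clebesgue_def using A e by (intro emeasure_vec_measure_box) (auto simp: bij_betw_def)
    also have "\<dots> = (\<Prod>i\<in>I. emeasure lborel (A (e i)))"
      by (rule prod.mono_neutral_cong_right) (auto simp: on_coords_def)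
    also have "\<dots> = (\<Prod>b\<in>B. emeasure lborel (A b))"
      using prod.reindex_bij_betw[OF e, of "\<lambda>b. emeasure lborel (A b)"] by simp
    finally show "emeasure (distr (clebesgue I) ?P ?g) (Pi\<^sub>E B A) = (\<Prod>b\<in>B. emeasure lborel (A b))" .
  qed simp
  then have "distr ?P borel (\<lambda>c. a + (\<Sum>b\<in>B. c b *\<^sub>R b)) =
    distr (distr (clebesgue I) ?P ?g) borel (\<lambda>c. a + (\<Sum>b\<in>B. c b *\<^sub>R b))" by simp
  also have "\<dots> = distr (clebesgue I) borel ((\<lambda>c. a + (\<Sum>b\<in>B. c b *\<^sub>R b)) \<circ> ?g)"
    by (rule distr_distr[OF _ g]) measurable
  also have "(\<lambda>c. a + (\<Sum>b\<in>B. c b *\<^sub>R b)) \<circ> ?g = (\<lambda>c. a + q *v c)"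
  proof (rule ext)
    fix c
    have "(\<Sum>b\<in>B. c $ ?r b *\<^sub>R b) = (\<Sum>i\<in>I. c $ i *\<^sub>R e i)"
      using sum.reindex_bij_betw[OF e, of "\<lambda>b. c $ ?r b *\<^sub>R b"] re by (simp cong: sum.cong)
    also have "\<dots> = q *v c"
      by (simp add: q_def columns_mult_vec)
    finally show "((\<lambda>c. a + (\<Sum>b\<in>B. c b *\<^sub>R b)) \<circ> ?g) c = a + q *v c" by simp
  qed
  finally show ?thesis by (simp add: flatm_def)
qed

lemma direction_frame:
  "direction ((\<lambda>v. a + U *v v) ` coord_space I) = (*v) U ` coord_space I"
proof safe
  fix x assume "x \<in> direction ((\<lambda>v. a + U *v v) ` coord_space I)"
  then obtain v w where vw: "v \<in> coord_space I" "w \<in> coord_space I" "x = (a + U *v v) - (a + U *v w)"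
    by (auto simp: direction_def)
  then have "x = U *v (v - w)" by (simp add: matrix_vector_mult_diff_distrib)
  moreover have "v - w \<in> coord_space I" using vw by (intro subspace_diff) auto
  ultimately show "x \<in> (*v) U ` coord_space I" by blast
next
  fix v assume v: "v \<in> coord_space I"
  have "U *v v = (a + U *v v) - (a + U *v 0)" by simp
  moreover have "0 \<in> coord_space I" by (intro subspace_0) simp
  ultimately show "U *v v \<in> direction ((\<lambda>v. a + U *v v) ` coord_space I)"
    unfolding direction_def using v by blast
qed

text \<open>Independence of the choices hidden in \<open>SOME\<close>: the chosen orthonormal basis
  differs from the columns of \<open>U\<close> by an isometric block \<open>s\<close>, and the
  chosen origin differs from \<open>a\<close> by a vector along the flat.\<close>

lemma flat_lebesgue_frame:
  fixes U :: "real ^ 'n::finite ^ 'n"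
  assumes U: "orthogonal_matrix U" and F: "F = (\<lambda>v. a + U *v v) ` coord_space I"
  shows "flat_lebesgue F = completion (flatm I a U)"
proof -
  let ?E = "(*v) U ` coord_space I"
  have dF: "direction F = ?E" unfolding F by (rule direction_frame)
  define a0 where "a0 = (SOME a. a \<in> F)"
  define B where "B = (SOME B. orthonormal_basis_of B (direction F))"
  have sE: "subspace ?E" by (intro linear_subspace_image) auto
  have dE: "dim ?E = card I" by (rule dim_orthogonal_image[OF U])
  have "F \<noteq> {}" unfolding F coord_space_def by simp
  then have a0: "a0 \<in> F" unfolding a0_def by (simp add: some_in_eq)
  have "\<exists>B. orthonormal_basis_of B ?E"
    using orthonormal_basis_subspace[OF sE] unfolding orthonormal_basis_of_def by metis
  then have "orthonormal_basis_of B ?E" unfolding B_def dF by (rule someI_ex)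
  then have B: "pairwise orthogonal B" "\<And>b. b \<in> B \<Longrightarrow> norm b = 1" "span B = ?E"
    unfolding orthonormal_basis_of_def by blast+
  have "0 \<notin> B" using B(2) by force
  then have iB: "independent B" using B(1) pairwise_orthogonal_independent by blast
  then have cB: "finite B" by (rule independent_imp_finite)
  have cB2: "card B = card I" using dE B(3) dim_span_eq_card_independent[OF iB] by simp
  obtain e where e: "bij_betw e I B" using finite_same_card_bij[of I B] cB cB2 by auto
  define q :: "real ^ 'n ^ 'n" where "q = (\<chi> r i. if i \<in> I then e i $ r else 0)"
  have qP: "q ** cproj I = q" by (subst vec_eq_iff) (auto simp: mult_cproj_nth q_def vec_eq_iff)
  have qv: "q *v c = (\<Sum>i\<in>I. c $ i *\<^sub>R e i)" for c
    by (simp add: q_def columns_mult_vec)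
  have eij: "e i \<bullet> e j = (if i = j then 1 else 0)" if "i \<in> I" "j \<in> I" for i j
  proof (cases "i = j")
    case True
    then show ?thesis using B(2)[of "e j"] that e by (auto simp: bij_betw_def norm_eq_1)
  next
    case False
    then have "e i \<noteq> e j" using that e by (auto simp: bij_betw_def inj_on_def)
    then show ?thesis using B(1) that e False by (auto simp: pairwise_def orthogonal_def bij_betw_def)
  qed
  have nq: "norm (q *v c) = norm (cproj I *v c)" for c
  proof -
    have "(q *v c) \<bullet> (q *v c) = (\<Sum>i\<in>I. \<Sum>j\<in>I. c $ i * (c $ j * (e i \<bullet> e j)))"
      unfolding qv by (simp add: inner_sum_left inner_sum_right sum_distrib_left mult_ac)
        (subst sum.swap, simp add: mult_ac inner_commute)
    also have "\<dots> = (\<Sum>i\<in>I. c $ i * c $ i)" by (intro sum.cong) (auto simp: eij if_distrib cong: if_cong sum.cong)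
    also have "\<dots> = (cproj I *v c) \<bullet> (cproj I *v c)"
      unfolding inner_vec_def by (intro sum.mono_neutral_cong_left) (auto simp: cproj_mult_vec)
    finally show ?thesis by (simp add: norm_eq)
  qed
  have rq: "range ((*v) q) = ?E"
  proof safe
    fix c show "q *v c \<in> ?E"
      unfolding qv using e sE B(3) by (intro subspace_sum subspace_scale) (auto simp: bij_betw_def intro: span_base)
  next
    fix v assume "v \<in> coord_space I"
    then have "U *v v \<in> span B" using B(3) by blast
    then obtain d where d: "U *v v = (\<Sum>b\<in>B. d b *\<^sub>R b)" using span_finite[OF cB] by auto
    also have "\<dots> = (\<Sum>i\<in>I. d (e i) *\<^sub>R e i)" using sum.reindex_bij_betw[OF e, of "\<lambda>b. d b *\<^sub>R b"] by simp
    also have "\<dots> = q *v (\<chi> i. d (e i))" unfolding qv by simp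
    finally show "U *v v \<in> range ((*v) q)" by auto
  qed
  define s where "s = transpose U ** q"
  have inj: "cproj I *v c = 0" if "q *v c = 0" for c using nq[of c] that by simp
  have s: "block I s" "bdet I s \<noteq> 0" "U ** s = q"
    unfolding s_def using frame_coordinates[OF U qP rq inj] by auto
  have ns: "norm (s *v c) = norm (cproj I *v c)" for c
    using nq[of c] orthogonal_matrix_norm[OF U, of "s *v c"] by (simp add: matrix_vector_mul_assoc s(3))
  \<comment> \<open>An isometry pulls the unit ball back to itself; comparing ball volumes, which
    are positive and finite, forces \<open>bdet I s = 1\<close>.\<close>
  have "ballvol I s = ballvol I (cproj I)" by (simp add: ballvol_def ns)
  then have "ennreal (bdet I s) * ballvol I (cproj I) = 1 * ballvol I (cproj I)"
    using ballvol_mult[OF s(1,2), of "cproj I"] blockD[OF s(1)] by simp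
  then have d1: "ennreal (bdet I s) = 1"
    using ballvol_cproj_pos[of I] ballvol_cproj_finite[of I] by (metis mult_divide_eq_ennreal)
  have "flatm I a0 q = flatm I a0 (U ** s)" by (simp add: s(3))
  also have "\<dots> = flatm I a0 U" using flatm_mult[OF s(1,2), of a0 U] d1 by simp
  also have "\<dots> = flatm I a U"
  proof -
    obtain v where "v \<in> coord_space I" "a0 = a + U *v v" using a0 F by auto
    then have "a0 = a + U *v (cproj I *v v)" by (simp add: coord_space_iff)
    then show ?thesis by (simp add: flatm_shift)
  qed
  finally have "flatm I a0 q = flatm I a U" .
  then show ?thesis
    unfolding flat_lebesgue_def Let_def a0_def[symmetric] B_def[symmetric]
    using flat_basis_coordinates[OF e, of a0] by (simp add: q_def)
qed

lemma affine_grassmannian_frame: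
  fixes F :: "(real ^ 'n::finite) set"
  assumes F: "F \<in> affine_grassmannian (card I)"
  obtains a U where "orthogonal_matrix U" "F = (\<lambda>v. a + U *v v) ` coord_space I"
proof -
  have "affine F" "aff_dim F = int (card I)" using F by (auto simp: affine_grassmannian_def)
  then have "F \<noteq> {}" by auto
  then obtain a where a: "a \<in> F" by auto
  let ?E = "(\<lambda>x. - a + x) ` F"
  have sE: "subspace ?E" using \<open>affine F\<close> a by (rule affine_diffs_subspace)
  have "aff_dim ?E = int (card I)" using \<open>aff_dim F = int (card I)\<close> by (simp only: aff_dim_translation_eq)
  then have dE: "dim ?E = card I" using aff_dim_subspace[OF sE] by simp
  obtain U where U: "orthogonal_matrix U" "(*v) U ` coord_space I = ?E"
    using exists_orthogonal_frame[OF sE dE] by auto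
  have "F = (\<lambda>x. a + x) ` ?E" by (simp add: image_image)
  also have "\<dots> = (\<lambda>v. a + U *v v) ` coord_space I" unfolding U(2)[symmetric] by (simp add: image_image)
  finally show ?thesis using that U(1) by blast
qed

lemma frame_in_affine_grassmannian:
  fixes U :: "real ^ 'n::finite ^ 'n"
  assumes U: "orthogonal_matrix U"
  shows "(\<lambda>v. a + U *v v) ` coord_space I \<in> affine_grassmannian (card I)"
proof -
  have d: "dim ((*v) U ` coord_space I) = card I" by (rule dim_orthogonal_image[OF U])
  have sE: "subspace ((*v) U ` coord_space I)" by (intro linear_subspace_image) auto
  have "(\<lambda>v. a + U *v v) ` coord_space I = (\<lambda>x. a + x) ` ((*v) U ` coord_space I)" by (simp add: image_image)
  moreover have "affine ((\<lambda>x. a + x) ` ((*v) U ` coord_space I))"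
    using subspace_imp_affine[OF sE] by (simp add: affine_translation[symmetric])
  moreover have "aff_dim ((\<lambda>x. a + x) ` ((*v) U ` coord_space I)) = int (card I)"
    using d by (simp add: aff_dim_translation_eq aff_dim_subspace[OF sE])
  ultimately show ?thesis by (simp add: affine_grassmannian_def)
qed

lemma grassmannian_iff_direction:
  assumes "F \<in> affine_grassmannian (card (I :: 'n::finite set))"
  shows "direction (F :: (real ^ 'n) set) \<in> grassmannian (card I)"
proof -
  obtain a U where U: "orthogonal_matrix U" and F: "F = (\<lambda>v. a + U *v v) ` coord_space I"
    using affine_grassmannian_frame[OF assms] by metis
  then show ?thesis
    unfolding F direction_frame grassmannian_def
    using dim_orthogonal_image[OF U] by (auto intro!: linear_subspace_image)
qed

subsection \<open>Flats and their integrals under affine bijections\<close>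

text \<open>Holds for nonmeasurable \<open>f\<close> as well: one bound, applied to \<open>c\<close>
  and to \<open>1 / c\<close>, gives both inequalities.\<close>

lemma nn_integral_multc_const:
  assumes c: "c \<noteq> 0" "c \<noteq> (top :: ennreal)"
  shows "(\<integral>\<^sup>+x. f x * c \<partial>M) = (\<integral>\<^sup>+x. f x \<partial>M) * c"
proof (rule antisym)
  have *: "(\<integral>\<^sup>+x. f x * c \<partial>M) \<le> (\<integral>\<^sup>+x. f x \<partial>M) * c" if c: "c \<noteq> 0" "c \<noteq> (top :: ennreal)" for f c
  proof (rule nn_integral_leI_measurable)
    fix u assume u[measurable]: "u \<in> borel_measurable M" and le: "u \<le> (\<lambda>x. f x * c)"
    have "u x / c \<le> f x" for x
      using divide_right_mono_ennreal[OF le[unfolded le_fun_def, rule_format, of x], of c] c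
      by (simp add: mult_divide_eq_ennreal)
    then have "(\<integral>\<^sup>+x. u x / c \<partial>M) * c \<le> (\<integral>\<^sup>+x. f x \<partial>M) * c"
      by (intro mult_right_mono nn_integral_mono) auto
    also have "(\<integral>\<^sup>+x. u x / c \<partial>M) * c = (\<integral>\<^sup>+x. u x / c * c \<partial>M)"
      by (rule nn_integral_multc[symmetric]) measurable
    also have "\<dots> = (\<integral>\<^sup>+x. u x \<partial>M)"
      using c by (simp add: ennreal_divide_times ennreal_times_divide mult_divide_eq_ennreal[of c 1, simplified])
    finally show "(\<integral>\<^sup>+x. u x \<partial>M) \<le> (\<integral>\<^sup>+x. f x \<partial>M) * c" .
  qed
  show "(\<integral>\<^sup>+x. f x * c \<partial>M) \<le> (\<integral>\<^sup>+x. f x \<partial>M) * c" by (rule *[OF c])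
  have c1: "1 / c \<noteq> 0" "1 / c \<noteq> top" using c by (auto simp: ennreal_divide_eq_top_iff ennreal_divide_eq_0_iff)
  have cc: "x * c * (1 / c) = x" for x using c by (simp add: ennreal_times_divide mult_divide_eq_ennreal)
  have "(\<integral>\<^sup>+x. f x \<partial>M) = (\<integral>\<^sup>+x. f x * c * (1 / c) \<partial>M)" by (simp only: cc)
  also have "\<dots> \<le> (\<integral>\<^sup>+x. f x * c \<partial>M) * (1 / c)" by (rule *[OF c1])
  finally have "(\<integral>\<^sup>+x. f x \<partial>M) * c \<le> (\<integral>\<^sup>+x. f x * c \<partial>M) * (1 / c) * c" by (rule mult_right_mono) simp
  also have "\<dots> = (\<integral>\<^sup>+x. f x * c \<partial>M)" using cc by (simp only: mult.assoc mult.commute[of "1 / c"])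
  finally show "(\<integral>\<^sup>+x. f x \<partial>M) * c \<le> (\<integral>\<^sup>+x. f x * c \<partial>M)" .
qed

text \<open>Normalised by the identity, so for invertible \<open>H\<close> it is exactly the
  reciprocal of the Jacobian of \<open>H\<close> on \<open>E\<close>.\<close>

definition jac_density :: "real ^ 'n::finite ^ 'n \<Rightarrow> (real ^ 'n) set \<Rightarrow> ennreal" where
  "jac_density H E = jacvol H E / jacvol (mat 1) E"

definition flat_ratio :: "nat \<Rightarrow> nat \<Rightarrow> ('a::euclidean_space \<Rightarrow> real) \<Rightarrow> 'a set \<Rightarrow> ennreal" where
  "flat_ratio p m f F = (if flat_Linf_norm F f = 0 then 0 else flat_integral F f ^ p / flat_Linf_norm F f ^ m)"

lemma ballvol_id_mult_nz: "ballvol I (cproj I) * ballvol (- I) (cproj (- I)) \<noteq> 0"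
  "ballvol I (cproj I) * ballvol (- I) (cproj (- I)) \<noteq> top"
  using ballvol_cproj_pos[of I] ballvol_cproj_finite[of I] ballvol_cproj_pos[of "- I"] ballvol_cproj_finite[of "- I"]
  by (auto simp: ennreal_mult_eq_top_iff)

text \<open>Writing \<open>H ** U ** cproj I = V ** s\<close>, the Jacobian is
  \<open>b = bdet I s\<close>. It is determined by \<open>H\<close> and the direction, so one
  \<open>b\<close> serves all parallel flats and all translations \<open>c\<close>.\<close>

lemma affine_image_frame:
  fixes U H :: "real ^ 'n::finite ^ 'n"
  assumes U: "orthogonal_matrix U" and H: "det H \<noteq> 0"
  obtains V b where "orthogonal_matrix V" "0 < b"
    "\<And>a c. (\<lambda>x. H *v x + c) ` (\<lambda>v. a + U *v v) ` coord_space I = (\<lambda>v. (H *v a + c) + V *v v) ` coord_space I"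
    "ennreal b * jacvol H ((*v) U ` coord_space I) = jacvol (mat 1) ((*v) U ` coord_space I)"
    "\<And>a c. flatm I (H *v a + c) V = scale_measure (ennreal b) (distr (flatm I a U) borel (\<lambda>x. H *v x + c))"
proof -
  let ?E = "(*v) U ` coord_space I"
  define y where "y = H ** U ** cproj I"
  have yP: "y ** cproj I = y" by (simp add: y_def matrix_mul_assoc[symmetric])
  have injH: "v = 0" if "H *v v = 0" for v
    using that H by (metis invertible_det_nz invertible_left_inverse matrix_left_invertible_ker)
  have inj: "cproj I *v c = 0" if "y *v c = 0" for c
  proof -
    have "H *v (U *v (cproj I *v c)) = 0" using that by (simp add: y_def matrix_vector_mul_assoc matrix_mul_assoc)
    then have "U *v (cproj I *v c) = 0" by (rule injH)
    then show ?thesis using orthogonal_matrix_norm[OF U, of "cproj I *v c"] by simp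
  qed
  let ?E' = "range ((*v) y)"
  have sE': "subspace ?E'" by (intro linear_subspace_image) auto
  have E': "?E' = (*v) (H ** U) ` coord_space I"
    by (auto simp: y_def coord_space_def image_image matrix_vector_mul_assoc)
  have "inj ((*v) (H ** U))"
  proof (rule injI)
    fix v w assume "(H ** U) *v v = (H ** U) *v w"
    then have "H *v (U *v (v - w)) = 0" by (simp add: matrix_vector_mult_diff_distrib matrix_vector_mul_assoc)
    then have "U *v (v - w) = 0" by (rule injH)
    then show "v = w" using orthogonal_matrix_norm[OF U, of "v - w"] by simp
  qed
  then have dE': "dim ?E' = card I"
    unfolding E' using dim_image_eq[of "(*v) (H ** U)" "coord_space I"] by (simp add: inj_on_subset)
  obtain V where V: "orthogonal_matrix V" "(*v) V ` coord_space I = ?E'"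
    using exists_orthogonal_frame[OF sE' dE'] by auto
  define s where "s = transpose V ** y"
  have s: "block I s" "bdet I s \<noteq> 0" "V ** s = y"
    unfolding s_def using frame_coordinates[OF V(1) yP _ inj] V(2) by auto
  define b where "b = bdet I s"
  have b: "0 < b" using s(2) bdet_nonneg[of I s] unfolding b_def by linarith
  show thesis
  proof (rule that[OF V(1) b])
    fix a c
    have "(\<lambda>x. H *v x + c) ` (\<lambda>v. a + U *v v) ` coord_space I = (\<lambda>x. (H *v a + c) + x) ` ((*v) (H ** U) ` coord_space I)"
      by (simp add: image_image matrix_vector_right_distrib matrix_vector_mul_assoc add_ac)
    also have "\<dots> = (\<lambda>v. (H *v a + c) + V *v v) ` coord_space I"
      unfolding E'[symmetric] V(2)[symmetric] by (simp add: image_image)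
    finally show "(\<lambda>x. H *v x + c) ` (\<lambda>v. a + U *v v) ` coord_space I = (\<lambda>v. (H *v a + c) + V *v v) ` coord_space I" .
    have "flatm I (H *v a + c) V = scale_measure (ennreal b) (flatm I (H *v a + c) y)"
      using flatm_mult[OF s(1,2), of "H *v a + c" V] s(3) by (simp add: b_def)
    also have "flatm I (H *v a + c) y = flatm I (H *v a + c) (H ** U)"
      by (rule flatm_cong) (simp add: y_def matrix_mul_assoc[symmetric])
    also have "\<dots> = distr (flatm I a U) borel (\<lambda>x. H *v x + c)" by (rule distr_flatm[symmetric])
    finally show "flatm I (H *v a + c) V = scale_measure (ennreal b) (distr (flatm I a U) borel (\<lambda>x. H *v x + c))" .
  next
    have UE: "dim ?E = card I" "subspace ?E"
      using dim_orthogonal_image[OF U] by (auto intro!: linear_subspace_image)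
    have "ballvol I (V ** cproj I) = ballvol I (cproj I)"
      by (simp add: ballvol_def matrix_vector_mul_assoc[symmetric] orthogonal_matrix_norm[OF V(1)])
    then have "ennreal b * ballvol I y = ballvol I (cproj I)"
      using ballvol_mult[OF s(1,2), of "V ** cproj I"] blockD[OF s(1)] s(3) by (simp add: b_def matrix_mul_assoc[symmetric])
    then show "ennreal b * jacvol H ?E = jacvol (mat 1) ?E"
      by (simp add: jacvol_id[OF UE(2,1)] jacvol_frame[OF U, of H] y_def[symmetric] mult.assoc[symmetric])
  qed
qed

lemma jac_density_cancel:
  fixes E :: "(real ^ 'n::finite) set" and I :: "'n set"
  assumes E: "subspace E" "dim E = card I" and b: "0 < b" "ennreal b * jacvol H E = jacvol (mat 1) E"
  shows "ennreal b * jac_density H E = 1" "jac_density H E \<noteq> 0" "jac_density H E \<noteq> top"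
proof -
  have j: "jacvol (mat 1) E \<noteq> 0" "jacvol (mat 1) E \<noteq> top"
    unfolding jacvol_id[OF E] by (rule ballvol_id_mult_nz)+
  then show 1: "ennreal b * jac_density H E = 1"
    unfolding jac_density_def by (simp add: ennreal_times_divide b(2)) (metis mult_divide_eq_ennreal mult_1)
  then show "jac_density H E \<noteq> 0" "jac_density H E \<noteq> top"
    using b(1) by (auto simp: ennreal_mult_top)
qed

lemma jac_density_nz:
  fixes H :: "real ^ 'n::finite ^ 'n"
  assumes E: "E \<in> grassmannian k" and H: "det H \<noteq> 0"
  shows "jac_density H E \<noteq> 0" "jac_density H E \<noteq> top"
proof -
  have "subspace E" "dim E = k" using E by (auto simp: grassmannian_def)
  moreover have "dim E \<le> card (UNIV :: 'n set)" using dim_subset_UNIV[of E] by simp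
  ultimately obtain I :: "'n set" where I: "subspace E" "dim E = card I" by (metis obtain_subset_with_card_n)
  obtain U where U: "orthogonal_matrix U" "(*v) U ` coord_space I = E" using exists_orthogonal_frame[OF I] by auto
  obtain b where b: "0 < b" "ennreal b * jacvol H E = jacvol (mat 1) E"
    using affine_image_frame[OF U(1) H, of I] U(2) by metis
  show "jac_density H E \<noteq> 0" "jac_density H E \<noteq> top" using jac_density_cancel[OF I b] by auto
qed

lemma matrix_inverse_pair:
  assumes "det (H :: real ^ 'n::finite ^ 'n) \<noteq> 0"
  obtains B where "H ** B = mat 1" "B ** H = mat 1" "det B \<noteq> 0"
proof -
  obtain B where B: "H ** B = mat 1" "B ** H = mat 1"
    using assms invertible_det_nz[of H] unfolding invertible_def by auto
  have "det H * det B = 1" using B(1) by (metis det_mul det_I)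
  then have "det B \<noteq> 0" by auto
  then show ?thesis using that B by blast
qed

lemma affine_image_inverse:
  fixes H B :: "real ^ 'n::finite ^ 'n"
  assumes "H ** B = mat 1" "B ** H = mat 1"
  shows "B *v ((H *v x + c) - c) = x" "H *v (B *v (x - c)) + c = x"
  using assms by (simp_all add: matrix_vector_mul_assoc)

text \<open>The integral over the flat is multiplied by the Jacobian and the essential supremum is
  unchanged, so the \<open>p\<close> Jacobian factors cancel the \<open>p\<close> powers of the
  reciprocal.\<close>

lemma
  fixes H :: "real ^ 'n::finite ^ 'n" and c :: "real ^ 'n"
  assumes F: "F \<in> affine_grassmannian (card (I :: 'n set))" and H: "det H \<noteq> 0"
  defines "g \<equiv> \<lambda>x. H *v x + c"
  shows affine_image_in_grassmannian: "g ` F \<in> affine_grassmannian (card I)"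
    and flat_ratio_image: "flat_ratio p m (f \<circ> inv g) (g ` F) * jac_density H (direction F) ^ p = flat_ratio p m f F"
proof -
  obtain a U where U: "orthogonal_matrix U" and Fa: "F = (\<lambda>v. a + U *v v) ` coord_space I"
    using affine_grassmannian_frame[OF F] by metis
  obtain V b where V: "orthogonal_matrix V" and b: "0 < b"
    "\<And>a c. (\<lambda>x. H *v x + c) ` (\<lambda>v. a + U *v v) ` coord_space I = (\<lambda>v. (H *v a + c) + V *v v) ` coord_space I"
    "ennreal b * jacvol H ((*v) U ` coord_space I) = jacvol (mat 1) ((*v) U ` coord_space I)"
    "\<And>a c. flatm I (H *v a + c) V = scale_measure (ennreal b) (distr (flatm I a U) borel (\<lambda>x. H *v x + c))"
    using affine_image_frame[OF U H, of I] by metis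
  have gF: "g ` F = (\<lambda>v. (H *v a + c) + V *v v) ` coord_space I" unfolding g_def Fa by (rule b(2))
  show "g ` F \<in> affine_grassmannian (card I)" unfolding gF by (rule frame_in_affine_grassmannian[OF V])
  have dF: "direction F = (*v) U ` coord_space I" unfolding Fa by (rule direction_frame)
  obtain B where B: "H ** B = mat 1" "B ** H = mat 1" "det B \<noteq> 0" using matrix_inverse_pair[OF H] .
  let ?g' = "\<lambda>x. B *v (x - c)"
  have g'g: "?g' (g x) = x" "g (?g' x) = x" for x unfolding g_def using affine_image_inverse[OF B(1,2)] by auto
  have inv: "inv g = ?g'" by (rule inv_equality) (use g'g in auto)
  let ?M = "flatm I a U" and ?N = "flatm I (H *v a + c) V"
  have mg[measurable]: "g \<in> borel \<rightarrow>\<^sub>M borel" unfolding g_def by measurable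
  have mg'[measurable]: "?g' \<in> borel \<rightarrow>\<^sub>M borel" by measurable
  have N: "?N = scale_measure (ennreal b) (distr ?M borel g)" unfolding g_def by (rule b(4))
  have fM: "flat_lebesgue F = completion ?M" by (rule flat_lebesgue_frame[OF U Fa])
  have fN: "flat_lebesgue (g ` F) = completion ?N" by (rule flat_lebesgue_frame[OF V gF])
  have bnz: "ennreal b \<noteq> 0" "ennreal b \<noteq> top" using b(1) by auto
  \<comment> \<open>\<open>f\<close> need not be measurable on an individual flat, so the lower
    integral is transported as a whole.\<close>
  have I: "flat_integral (g ` F) (f \<circ> inv g) = flat_integral F f * ennreal b"
  proof -
    have "(\<integral>\<^sup>+y. ennreal ((f \<circ> inv g) y) \<partial>?N) = (\<integral>\<^sup>+x. ennreal ((f \<circ> inv g) (g x)) * ennreal b \<partial>?M)"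
    proof (rule nn_integral_transport[symmetric, where T'="?g'"])
      fix \<psi> :: "real ^ 'n \<Rightarrow> ennreal" assume "\<psi> \<in> borel_measurable ?N"
      then have [measurable]: "\<psi> \<in> borel_measurable borel" by (simp cong: measurable_cong_sets)
      show "(\<integral>\<^sup>+x. \<psi> (g x) * ennreal b \<partial>?M) = (\<integral>\<^sup>+y. \<psi> y \<partial>?N)"
        unfolding N nn_integral_multc_const[OF bnz]
        by (subst nn_integral_scale_measure) (auto simp: nn_integral_distr mult.commute)
    qed (use g'g b(1) in auto)
    also have "\<dots> = (\<integral>\<^sup>+x. ennreal (f x) * ennreal b \<partial>?M)" by (simp add: inv g'g)
    also have "\<dots> = (\<integral>\<^sup>+x. ennreal (f x) \<partial>?M) * ennreal b" by (rule nn_integral_multc_const[OF bnz])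
    finally show ?thesis by (simp add: flat_integral_def fM fN nn_integral_completion)
  qed
  have L: "flat_Linf_norm (g ` F) (f \<circ> inv g) = flat_Linf_norm F f"
  proof -
    have "esssup (completion ?M) (\<lambda>x. ennreal \<bar>(f \<circ> inv g) (g x)\<bar>) = esssup (completion ?N) (\<lambda>x. ennreal \<bar>(f \<circ> inv g) x\<bar>)"
    proof (rule esssup_transport[where T'="?g'"])
      fix A assume "A \<in> sets ?N"
      then have "A \<in> sets borel" by simp
      then have "emeasure ?N A = ennreal b * emeasure ?M (g -` A \<inter> space ?M)"
        unfolding N by (simp add: emeasure_distr)
      then show "emeasure ?N A = 0 \<longleftrightarrow> emeasure ?M (g -` A \<inter> space ?M) = 0" using bnz by simp
    qed (use g'g in auto)
    then show ?thesis by (simp add: flat_Linf_norm_def fM fN inv g'g)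
  qed
  have sE: "subspace ((*v) U ` coord_space I)" by (intro linear_subspace_image) auto
  have dE: "dim ((*v) U ` coord_space I) = card I"
    using grassmannian_iff_direction[OF F] by (simp add: dF grassmannian_def)
  have bw: "ennreal b * jac_density H (direction F) = 1"
    unfolding dF by (rule jac_density_cancel(1)[OF sE dE b(1,3)])
  show "flat_ratio p m (f \<circ> inv g) (g ` F) * jac_density H (direction F) ^ p = flat_ratio p m f F"
  proof -
    have "(flat_integral F f * ennreal b) ^ p * jac_density H (direction F) ^ p = flat_integral F f ^ p"
      by (simp add: power_mult_distrib[symmetric] mult.assoc bw)
    then show ?thesis unfolding flat_ratio_def I L by (simp add: ennreal_divide_times mult.commute ennreal_times_divide)
  qed
qed

subsection \<open>Measurability on spaces of flats\<close>

lemma space_flats_borel [simp]: "space (flats_borel \<F>) = \<F>"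
  unfolding flats_borel_def by (rule space_measure_of) auto

lemma sets_flats_borel: "sets (flats_borel \<F>) = sigma_sets \<F> {{F \<in> \<F>. F \<inter> U \<noteq> {}} | U. open U}"
  unfolding flats_borel_def by (rule sets_measure_of) auto

lemma hit_set [measurable]: "open U \<Longrightarrow> {F \<in> \<F>. F \<inter> U \<noteq> {}} \<in> sets (flats_borel \<F>)"
  unfolding sets_flats_borel by blast

lemma measurable_flats_borelI:
  assumes "\<And>x. x \<in> space M \<Longrightarrow> f x \<in> \<F>"
    and "\<And>U. open U \<Longrightarrow> {x \<in> space M. f x \<inter> U \<noteq> {}} \<in> sets M"
  shows "f \<in> M \<rightarrow>\<^sub>M flats_borel \<F>"
  unfolding flats_borel_def
proof (rule measurable_measure_of)
  fix A assume "A \<in> {{F \<in> \<F>. F \<inter> U \<noteq> {}} | U. open U}"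
  then obtain U where "open U" "A = {F \<in> \<F>. F \<inter> U \<noteq> {}}" by auto
  moreover have "f -` {F \<in> \<F>. F \<inter> U \<noteq> {}} \<inter> space M = {x \<in> space M. f x \<inter> U \<noteq> {}}"
    using assms(1) by auto
  ultimately show "f -` A \<inter> space M \<in> sets M" using assms(2) by auto
qed (use assms(1) in auto)

lemma measurable_flats_image:
  assumes "\<And>F. F \<in> \<F> \<Longrightarrow> g ` F \<in> \<G>" and g: "continuous_on UNIV g"
  shows "(`) g \<in> flats_borel \<F> \<rightarrow>\<^sub>M flats_borel \<G>"
proof (rule measurable_flats_borelI)
  fix U :: "'b set" assume "open U"
  then have "open (g -` U)" using g by (simp add: open_vimage)
  moreover have "{F \<in> space (flats_borel \<F>). g ` F \<inter> U \<noteq> {}} = {F \<in> \<F>. F \<inter> g -` U \<noteq> {}}" by auto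
  ultimately show "{F \<in> space (flats_borel \<F>). g ` F \<inter> U \<noteq> {}} \<in> sets (flats_borel \<F>)" using hit_set by metis
qed (use assms in auto)

text \<open>A condition such as \<open>x + y \<in> U\<close> for some \<open>y\<close> in a flat
  becomes a countable union of open conditions on \<open>x\<close> combined with hitting conditions
  on the flat, and the latter generate \<open>flats_borel\<close>.\<close>

lemma open_countable_rectangles:
  fixes h :: "'a::second_countable_topology \<Rightarrow> 'b::second_countable_topology \<Rightarrow> 'c::topological_space"
  assumes U: "open U" and h: "continuous_on UNIV (\<lambda>p. h (fst p) (snd p))"
  shows "\<exists>J. countable J \<and> (\<forall>p\<in>J. open (fst p) \<and> open (snd p)) \<and>
    (\<forall>x y. h x y \<in> U \<longleftrightarrow> (\<exists>p\<in>J. x \<in> fst p \<and> y \<in> snd p))"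
proof -
  obtain C :: "'a set set" where C: "countable C" "\<And>u. u \<in> C \<Longrightarrow> open u" "topological_basis C"
    using ex_countable_basis topological_basis_open by metis
  obtain D :: "'b set set" where D: "countable D" "\<And>u. u \<in> D \<Longrightarrow> open u" "topological_basis D"
    using ex_countable_basis topological_basis_open by metis
  let ?J = "{(u, v). u \<in> C \<and> v \<in> D \<and> (\<forall>x\<in>u. \<forall>y\<in>v. h x y \<in> U)}"
  have "\<exists>(u, v)\<in>?J. x \<in> u \<and> y \<in> v" if xy: "h x y \<in> U" for x y
  proof -
    have "open ((\<lambda>p. h (fst p) (snd p)) -` U)" using U h by (rule open_vimage)
    moreover have "(x, y) \<in> (\<lambda>p. h (fst p) (snd p)) -` U" using xy by simp
    ultimately obtain A B where AB: "open A" "open B" "(x, y) \<in> A \<times> B" "A \<times> B \<subseteq> (\<lambda>p. h (fst p) (snd p)) -` U"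
      by (rule open_prod_elim)
    obtain u where u: "u \<in> C" "x \<in> u" "u \<subseteq> A" using topological_basisE[OF C(3) AB(1)] AB(3) by auto
    obtain v where v: "v \<in> D" "y \<in> v" "v \<subseteq> B" using topological_basisE[OF D(3) AB(2)] AB(3) by auto
    have "h a b \<in> U" if "a \<in> u" "b \<in> v" for a b
      using subsetD[OF AB(4), of "(a, b)"] that u(3) v(3) by auto
    then show ?thesis using u v by (intro bexI[of _ "(u, v)"]) auto
  qed
  moreover have "countable ?J"
  proof (rule countable_subset)
    show "?J \<subseteq> C \<times> D" by auto
    show "countable (C \<times> D)" using C(1) D(1) by (rule countable_SIGMA)
  qed
  ultimately show ?thesis using C(2) D(2) by (intro exI[of _ ?J]) fastforce
qed

lemma measurable_direction:
  assumes "\<And>F. F \<in> \<F> \<Longrightarrow> direction F \<in> \<G>"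
  shows "direction \<in> flats_borel \<F> \<rightarrow>\<^sub>M flats_borel (\<G> :: 'a::euclidean_space set set)"
proof (rule measurable_flats_borelI)
  fix U :: "'a set" assume U: "open U"
  have c: "continuous_on UNIV (\<lambda>p :: 'a \<times> 'a. fst p - snd p)" by (intro continuous_intros)
  obtain J where J: "countable J" "\<forall>p\<in>J. open (fst p) \<and> open (snd p)"
    "\<forall>x y :: 'a. x - y \<in> U \<longleftrightarrow> (\<exists>p\<in>J. x \<in> fst p \<and> y \<in> snd p)"
    using open_countable_rectangles[where h="(-)", OF U c] by blast
  have "direction F \<inter> U \<noteq> {} \<longleftrightarrow> (\<exists>p\<in>J. F \<inter> fst p \<noteq> {} \<and> F \<inter> snd p \<noteq> {})" for F
  proof -
    have "direction F \<inter> U \<noteq> {} \<longleftrightarrow> (\<exists>x\<in>F. \<exists>y\<in>F. x - y \<in> U)" by (auto simp: direction_def)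
    then show ?thesis unfolding J(3)[rule_format] by blast
  qed
  then have "{F \<in> \<F>. direction F \<inter> U \<noteq> {}} = (\<Union>p\<in>J. {F \<in> \<F>. F \<inter> fst p \<noteq> {}} \<inter> {F \<in> \<F>. F \<inter> snd p \<noteq> {}})"
    by auto
  also have "\<dots> \<in> sets (flats_borel \<F>)"
    by (rule sets.countable_UN''[OF J(1)]) (use J(2) in \<open>auto intro!: hit_set\<close>)
  finally show "{F \<in> space (flats_borel \<F>). direction F \<inter> U \<noteq> {}} \<in> sets (flats_borel \<F>)" by simp
qed (use assms in auto)

lemma measurable_flats_translate:
  assumes "\<And>E x. E \<in> \<F> \<Longrightarrow> (\<lambda>y. x + y) ` E \<in> \<G>"
  shows "(\<lambda>(E, x). (\<lambda>y. x + y) ` E) \<in> flats_borel \<F> \<Otimes>\<^sub>M borel \<rightarrow>\<^sub>M flats_borel (\<G> :: 'a::euclidean_space set set)"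
proof (rule measurable_flats_borelI)
  fix U :: "'a set" assume U: "open U"
  have c: "continuous_on UNIV (\<lambda>p :: 'a \<times> 'a. fst p + snd p)" by (intro continuous_intros)
  obtain J where J: "countable J" "\<forall>p\<in>J. open (fst p) \<and> open (snd p)"
    "\<forall>x y :: 'a. x + y \<in> U \<longleftrightarrow> (\<exists>p\<in>J. x \<in> fst p \<and> y \<in> snd p)"
    using open_countable_rectangles[where h="(+)", OF U c] by blast
  have hit: "(\<lambda>y. x + y) ` E \<inter> U \<noteq> {} \<longleftrightarrow> (\<exists>p\<in>J. x \<in> fst p \<and> E \<inter> snd p \<noteq> {})" for x E
  proof -
    have "(\<lambda>y. x + y) ` E \<inter> U \<noteq> {} \<longleftrightarrow> (\<exists>y\<in>E. x + y \<in> U)" by auto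
    then show ?thesis unfolding J(3)[rule_format] by blast
  qed
  have "{p \<in> space (flats_borel \<F> \<Otimes>\<^sub>M borel). (case p of (E, x) \<Rightarrow> (\<lambda>y. x + y) ` E) \<inter> U \<noteq> {}} =
    (\<Union>p\<in>J. {E \<in> \<F>. E \<inter> snd p \<noteq> {}} \<times> fst p)"
    unfolding case_prod_beta' hit by (rule set_eqI) (simp add: space_pair_measure mem_Times_iff, blast)
  also have "\<dots> \<in> sets (flats_borel \<F> \<Otimes>\<^sub>M borel)"
    by (rule sets.countable_UN''[OF J(1)]) (use J(2) in \<open>auto intro!: hit_set pair_measureI borel_open\<close>)
  finally show "{p \<in> space (flats_borel \<F> \<Otimes>\<^sub>M borel). (case p of (E, x) \<Rightarrow> (\<lambda>y. x + y) ` E) \<inter> U \<noteq> {}}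
    \<in> sets (flats_borel \<F> \<Otimes>\<^sub>M borel)" .
qed (use assms in \<open>auto simp: space_pair_measure\<close>)

text \<open>The projection realises the distance to \<open>E\<close>, by Pythagoras. This ties
  \<open>prj\<close> to the generating hitting sets.\<close>

lemma norm_prj_diff_less_iff:
  assumes E: "subspace E"
  shows "norm (z - prj E *v z) < r \<longleftrightarrow> E \<inter> ball z r \<noteq> {}"
proof
  assume "norm (z - prj E *v z) < r"
  then show "E \<inter> ball z r \<noteq> {}" using prj_in[OF E, of z] by (auto simp: dist_norm)
next
  assume "E \<inter> ball z r \<noteq> {}"
  then obtain y where y: "y \<in> E" "norm (z - y) < r" by (auto simp: dist_norm)
  have "prj E *v z - y \<in> E" using E y prj_in by (intro subspace_diff) auto
  then have "orthogonal (z - prj E *v z) (prj E *v z - y)"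
    using prj_orthogonal[OF E, of "prj E *v z - y" z] by (simp add: orthogonal_def inner_commute)
  then have "(norm (z - y))\<^sup>2 = (norm (z - prj E *v z))\<^sup>2 + (norm (prj E *v z - y))\<^sup>2"
    using norm_add_Pythagorean by fastforce
  then have "(norm (z - prj E *v z))\<^sup>2 \<le> (norm (z - y))\<^sup>2" by simp
  then have "norm (z - prj E *v z) \<le> norm (z - y)" by (simp add: power2_le_iff_abs_le)
  then show "norm (z - prj E *v z) < r" using y by simp
qed

text \<open>Distances to \<open>E\<close> are measurable by the hitting sets of balls. They
  determine the quadratic form of the projection, and polarisation recovers its entries.\<close>

lemma measurable_prj [measurable]: "prj \<in> flats_borel (grassmannian k) \<rightarrow>\<^sub>M borel"
proof -
  let ?G = "flats_borel (grassmannian k) :: (real ^ 'n::finite) set measure"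
  have sub: "subspace E" if "E \<in> space ?G" for E using that by (simp add: grassmannian_def)
  have n[measurable]: "(\<lambda>E. norm (z - prj E *v z)) \<in> borel_measurable ?G" for z
    unfolding borel_measurable_iff_less
  proof
    fix r
    have "{E \<in> space ?G. norm (z - prj E *v z) < r} = {E \<in> grassmannian k. E \<inter> ball z r \<noteq> {}}"
      by (intro Collect_cong conj_cong) (simp_all add: norm_prj_diff_less_iff[OF sub])
    then show "{E \<in> space ?G. norm (z - prj E *v z) < r} \<in> sets ?G" by (simp add: hit_set)
  qed
  have q: "z \<bullet> (prj E *v z) = z \<bullet> z - (norm (z - prj E *v z))\<^sup>2" if "E \<in> space ?G" for z E
    using prj_orthogonal[OF sub[OF that] prj_in[OF sub[OF that]], of z z]
    by (simp add: power2_norm_eq_inner inner_diff_left inner_diff_right inner_commute)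
  have e: "prj E = (\<chi> i j. let a = axis i 1; b = axis j 1; Q = (\<lambda>z. z \<bullet> z - (norm (z - prj E *v z))\<^sup>2)
     in (Q (a + b) - Q a - Q b) / 2)" if "E \<in> space ?G" for E
  proof -
    have t: "prj E $ j $ i = prj E $ i $ j" for i j
      using arg_cong[OF transpose_prj[OF sub[OF that]], of "\<lambda>p. p $ i $ j"] by (simp add: transpose_def)
    have ent: "axis i 1 \<bullet> (prj E *v axis j 1) = prj E $ i $ j" for i j
      by (simp add: inner_axis' matrix_vector_mult_basis column_def)
    show ?thesis
      unfolding vec_eq_iff
      by (simp add: Let_def q[OF that, symmetric] matrix_vector_right_distrib inner_add_left inner_add_right ent t del: power2_norm_eq_inner)
  qed
  show ?thesis
    by (subst measurable_cong[OF e]) (simp_all add: Let_def)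
qed

text \<open>The body is full-dimensional and described by \<open>prj\<close>, so
  \<open>jacvol\<close> is a parameter integral against the fixed measure
  \<open>lborel\<close>.\<close>

lemma measurable_jacvol [measurable]:
  "jacvol H \<in> borel_measurable (flats_borel (grassmannian k))"
proof -
  let ?G = "flats_borel (grassmannian k) :: (real ^ 'a::finite) set measure"
  have e: "jacvol H E = (\<integral>\<^sup>+z. (if norm (H *v (prj E *v z)) \<le> 1 \<and> norm (z - prj E *v z) \<le> 1 then 1 else 0) \<partial>lborel)" for E
  proof -
    have [measurable]: "{z. norm (H *v (prj E *v z)) \<le> 1 \<and> norm (z - prj E *v z) \<le> 1} \<in> sets borel" by measurable
    have "jacvol H E = (\<integral>\<^sup>+z. indicator {z. norm (H *v (prj E *v z)) \<le> 1 \<and> norm (z - prj E *v z) \<le> 1} z \<partial>lborel)"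
      by (simp add: jacvol_def)
    then show ?thesis by (simp add: indicator_def of_bool_def)
  qed
  show ?thesis unfolding e[abs_def] by measurable
qed

lemma measurable_jac_density [measurable]:
  "jac_density H \<in> borel_measurable (flats_borel (grassmannian k))"
  unfolding jac_density_def[abs_def] by measurable

subsection \<open>The invariant measure on the Grassmannian\<close>

text \<open>Frames with an invertible block in the rows \<open>I\<close> are the ones that lie in
  the chart; the default on the remaining null set keeps the values in the Grassmannian.\<close>

definition frame_span :: "'n::finite set \<Rightarrow> real ^ 'n ^ 'n \<Rightarrow> (real ^ 'n) set" where
  "frame_span I y = (if bdet I (cproj I ** y ** cproj I) = 0 then coord_space I else range ((*v) (y ** cproj I)))"

lemma coord_space_grassmannian: "coord_space I \<in> grassmannian (card I)"
  by (simp add: grassmannian_def)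

lemma top_block_inj:
  assumes nz: "bdet I (cproj I ** y ** cproj I) \<noteq> 0" and "(y ** cproj I) *v c = 0"
  shows "cproj I *v c = 0"
proof -
  have "(cproj I ** y ** cproj I) *v c = cproj I *v ((y ** cproj I) *v c)"
    by (simp add: matrix_vector_mul_assoc matrix_mul_assoc)
  then show ?thesis using assms bdet_nz_iff[OF block_conj_cproj, of I y] by simp
qed

lemma frame_span_grassmannian: "frame_span I y \<in> grassmannian (card (I :: 'n::finite set))"
proof (cases "bdet I (cproj I ** y ** cproj I) = 0")
  case True
  then show ?thesis by (simp add: frame_span_def coord_space_grassmannian)
next
  case False
  let ?y = "y ** cproj I"
  have R: "range ((*v) ?y) = (*v) ?y ` coord_space I"
    by (auto simp: coord_space_def image_image matrix_vector_mul_assoc matrix_mul_assoc[symmetric])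
  have "inj_on ((*v) ?y) (coord_space I)"
  proof (rule inj_onI)
    fix v w assume vw: "v \<in> coord_space I" "w \<in> coord_space I" "?y *v v = ?y *v w"
    then have "?y *v (v - w) = 0" by (simp add: matrix_vector_mult_diff_distrib)
    then have "cproj I *v (v - w) = 0" by (rule top_block_inj[OF False])
    then show "v = w" using vw by (simp add: coord_space_iff matrix_vector_mult_diff_distrib)
  qed
  then have "dim (range ((*v) ?y)) = card I" unfolding R by (subst dim_image_eq) (auto simp: span_eq_iff[THEN iffD2])
  moreover have "subspace (range ((*v) ?y))" by (intro linear_subspace_image) auto
  ultimately show ?thesis using False by (simp add: frame_span_def grassmannian_def)
qed

text \<open>For each coefficient vector \<open>c\<close>, sending it into \<open>U\<close> is an
  open condition on \<open>y\<close>; the default value matters only on the Borel set of singular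
  top blocks.\<close>

lemma measurable_frame_span [measurable]:
  "frame_span I \<in> borel \<rightarrow>\<^sub>M flats_borel (grassmannian (card (I :: 'n::finite set)))"
proof (rule measurable_flats_borelI)
  fix U :: "(real ^ 'n) set" assume U: "open U"
  let ?Z = "{y :: real ^ 'n ^ 'n. bdet I (cproj I ** y ** cproj I) = 0}"
  have Z: "?Z \<in> sets borel" by measurable
  have "open (\<Union>c. {y :: real ^ 'n ^ 'n. (y ** cproj I) *v c \<in> U})"
  proof (rule open_UN, rule ballI)
    fix c
    have "continuous_on UNIV (\<lambda>y :: real ^ 'n ^ 'n. (y ** cproj I) *v c)"
      unfolding matrix_vector_mult_def matrix_matrix_mult_def by (intro continuous_intros)
    then have "open ((\<lambda>y :: real ^ 'n ^ 'n. (y ** cproj I) *v c) -` U)" using U by (simp add: open_vimage)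
    then show "open {y :: real ^ 'n ^ 'n. (y ** cproj I) *v c \<in> U}" by (simp add: vimage_def)
  qed
  then have O: "(\<Union>c. {y :: real ^ 'n ^ 'n. (y ** cproj I) *v c \<in> U}) \<in> sets borel" by (rule borel_open)
  have "{y \<in> space borel. frame_span I y \<inter> U \<noteq> {}} =
    (?Z \<inter> (if coord_space I \<inter> U \<noteq> {} then UNIV else {})) \<union> ((\<Union>c. {y. (y ** cproj I) *v c \<in> U}) - ?Z)"
    by (auto simp: frame_span_def)
  also have "\<dots> \<in> sets borel" using Z O by auto
  finally show "{y \<in> space borel. frame_span I y \<inter> U \<noteq> {}} \<in> sets borel" .
qed (rule frame_span_grassmannian)

lemma range_mult_block:
  assumes a: "block I a" "bdet I a \<noteq> 0"
  shows "range ((*v) ((y ** a) ** cproj I)) = range ((*v) (y ** cproj I))"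
proof -
  have aP: "y ** a ** cproj I = (y ** cproj I) ** a" using blockD[OF a(1)] by (simp add: matrix_mul_assoc[symmetric])
  obtain B where B: "(a + cproj (- I)) ** B = mat 1"
    using a(2) invertible_det_nz[of "a + cproj (- I)"] unfolding invertible_def bdet_def by auto
  show ?thesis
  proof safe
    fix c show "(y ** a ** cproj I) *v c \<in> range ((*v) (y ** cproj I))"
      unfolding aP by (simp add: matrix_vector_mul_assoc[symmetric])
  next
    fix c
    have "cproj I ** ((a + cproj (- I)) ** B) = a ** B"
      using blockD[OF a(1)] by (simp add: matrix_mul_assoc matrix_add_ldistrib)
    then have "cproj I = a ** B" using B by simp
    then have "y ** cproj I = (y ** cproj I) ** a ** B" by (metis cproj_idem matrix_mul_assoc)
    then have "(y ** cproj I) *v c = (y ** a ** cproj I) *v (B *v c)"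
      unfolding aP by (metis matrix_vector_mul_assoc)
    then show "(y ** cproj I) *v c \<in> range ((*v) (y ** a ** cproj I))" by simp
  qed
qed

text \<open>An invertible block on the right changes the basis but not the span, and it keeps the
  top block singular or invertible. This is the invariance that the chart demands of its first
  factor.\<close>

lemma frame_span_mult:
  assumes a: "block I a" "bdet I a \<noteq> 0"
  shows "frame_span I (y ** a) = frame_span I y"
proof -
  have "cproj I ** (y ** a) ** cproj I = (cproj I ** y ** cproj I) ** a"
    using blockD[OF a(1)] by (simp add: matrix_mul_assoc[symmetric])
  then have "bdet I (cproj I ** (y ** a) ** cproj I) = bdet I (cproj I ** y ** cproj I) * bdet I a"
    using a(1) by (simp add: bdet_mult)
  then show ?thesis using a(2) range_mult_block[OF a, of y] by (simp add: frame_span_def)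
qed

section \<open>The law of the span of a random frame\<close>

definition frame_haar :: "'n::finite set \<Rightarrow> (real ^ 'n) set measure" where
  "frame_haar I = distr (uniform_measure (mlebesgue UNIV I) colball) (flats_borel (grassmannian (card I))) (frame_span I)"

lemma sets_frame_haar [simp, measurable_cong]: "sets (frame_haar I) = sets (flats_borel (grassmannian (card I)))"
  and space_frame_haar [simp]: "space (frame_haar I) = grassmannian (card I)"
  by (simp_all add: frame_haar_def)

lemma prob_space_frame_haar: "prob_space (frame_haar I)"
proof -
  interpret prob_space "uniform_measure (mlebesgue UNIV I) colball"
    using emeasure_colball[of I] by (intro prob_space_uniform_measure) auto
  have "frame_span I \<in> uniform_measure (mlebesgue UNIV I) colball \<rightarrow>\<^sub>M flats_borel (grassmannian (card I))"
    using measurable_frame_span[of I] by (simp cong: measurable_cong_sets)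
  then show ?thesis unfolding frame_haar_def by (rule prob_space_distr)
qed

lemma nn_integral_frame_haar:
  assumes [measurable]: "\<phi> \<in> borel_measurable (flats_borel (grassmannian (card I)))"
  shows "(\<integral>\<^sup>+E. \<phi> E \<partial>frame_haar I) =
    (\<integral>\<^sup>+y. \<phi> (frame_span I y) * indicator colball y \<partial>mlebesgue UNIV I) / emeasure (mlebesgue UNIV I) colball"
proof -
  have "(\<integral>\<^sup>+E. \<phi> E \<partial>frame_haar I) = (\<integral>\<^sup>+y. \<phi> (frame_span I y) \<partial>uniform_measure (mlebesgue UNIV I) colball)"
    unfolding frame_haar_def by (rule nn_integral_distr) (auto cong: measurable_cong_sets)
  then show ?thesis by (simp add: nn_integral_uniform_measure)
qed

lemma grassmannian_linear_image:
  fixes H :: "real ^ 'n::finite ^ 'n"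
  assumes H: "det H \<noteq> 0" and E: "E \<in> grassmannian k"
  shows "(*v) H ` E \<in> grassmannian k"
proof -
  obtain B where B: "B ** H = mat 1" using matrix_inverse_pair[OF H] by metis
  have "inj ((*v) H)"
    by (rule injI) (metis B matrix_vector_mul_assoc matrix_vector_mul_lid)
  then have "dim ((*v) H ` E) = dim E" by (intro dim_image_eq) (auto intro: inj_on_subset)
  then show ?thesis using E by (auto simp: grassmannian_def intro!: linear_subspace_image)
qed

lemma measurable_linear_flats [measurable]:
  fixes H :: "real ^ 'n::finite ^ 'n"
  assumes "det H \<noteq> 0"
  shows "(`) ((*v) H) \<in> flats_borel (grassmannian k) \<rightarrow>\<^sub>M flats_borel (grassmannian k)"
  by (intro measurable_flats_image grassmannian_linear_image[OF assms])
     (auto intro: linear_continuous_on)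

text \<open>Over a frame \<open>y\<close>, the mass of the frames \<open>y a\<close> lying in \<open>H\<inverse> colball\<close> is
  proportional to \<open>ballvol I (H y) ^ CARD('n)\<close>; comparing \<open>H\<close> with the identity gives the density.\<close>

lemma frame_haar_linear:
  fixes H :: "real ^ 'n::finite ^ 'n"
  assumes H: "\<bar>det H\<bar> = 1" and \<phi>: "\<phi> \<in> borel_measurable (flats_borel (grassmannian (card (I :: 'n set))))"
  shows "(\<integral>\<^sup>+E. \<phi> ((*v) H ` E) * jac_density H E ^ CARD('n) \<partial>frame_haar I) = (\<integral>\<^sup>+E. \<phi> E \<partial>frame_haar I)"
proof -
  note \<phi>[measurable]
  let ?P = "cproj I :: real ^ 'n ^ 'n" and ?Q = "cproj (- I) :: real ^ 'n ^ 'n" and ?n = "CARD('n)"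
  let ?Y = "mlebesgue UNIV I :: (real ^ 'n ^ 'n) measure" and ?C = "colball :: (real ^ 'n ^ 'n) set"
  let ?R = "frame_span I" and ?w = "jac_density H"
  have H0: "det H \<noteq> 0" using H by auto
  note measurable_linear_flats[OF H0, measurable]
  have HC[measurable]: "{y. H ** y \<in> ?C} \<in> sets borel" by measurable
  \<comment> \<open>\<open>H\<close> may move a generic frame out of the chart, but only on a null
    set, since left multiplication by \<open>H\<close> preserves the measure.\<close>
  have "AE y in ?Y. bdet I (?P ** (H ** y) ** ?P) \<noteq> 0"
  proof -
    let ?Z = "indicator {a. bdet I (?P ** a ** ?P) = 0} :: real ^ 'n ^ 'n \<Rightarrow> ennreal"
    have [measurable]: "{a. bdet I (?P ** a ** ?P) = 0} \<in> sets borel" by measurable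
    have "(\<integral>\<^sup>+y. ?Z y \<partial>?Y) = (\<integral>\<^sup>+y. 0 \<partial>?Y)"
      by (intro nn_integral_cong_AE, rule AE_mp[OF AE_top_block_nz], rule AE_I2) (simp add: indicator_def)
    moreover have "ennreal (bdet UNIV H) ^ card I * (\<integral>\<^sup>+y. ?Z (H ** y) \<partial>?Y) = (\<integral>\<^sup>+y. ?Z y \<partial>?Y)"
      using H0 by (intro nn_integral_mlebesgue_left) auto
    ultimately have "(\<integral>\<^sup>+y. ?Z (H ** y) \<partial>?Y) = 0" using H by simp
    then show ?thesis by (subst (asm) nn_integral_0_iff_AE) (auto simp: indicator_def)
  qed
  then have span_eq: "AE y in ?Y. ?R (H ** y) = (*v) H ` ?R y"
    using AE_top_block_nz[of I]
  proof eventually_elim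
    case (elim y)
    then show ?case by (simp add: frame_span_def image_image matrix_vector_mul_assoc matrix_mul_assoc)
  qed
  define K where "K h x = (\<integral>\<^sup>+a. ennreal (bdet I (?P ** a ** ?P)) ^ card (- I) *
      indicator ?C (h ** ((?P + ?Q ** x ** ?P) ** (?P ** a ** ?P))) \<partial>mlebesgue I I)" for h x
  define \<omega> where "\<omega> = ballvol I ?P"
  have \<omega>: "\<omega> ^ ?n \<noteq> 0" "\<omega> ^ ?n \<noteq> top"
    using ballvol_cproj_pos[of I] ballvol_cproj_finite[of I] by (auto simp: \<omega>_def power_eq_top_ennreal)
  have K: "K H x = K (mat 1) x * ?w (?R (?P + ?Q ** x ** ?P)) ^ ?n" for x
  proof -
    let ?y = "?P + ?Q ** x ** ?P"
    have yP: "?y ** ?P = ?y" by (simp add: matrix_matrix_add_rdistrib matrix_mul_assoc[symmetric])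
    have PyP: "?P ** ?y ** ?P = ?P" by (simp add: matrix_add_ldistrib matrix_matrix_add_rdistrib matrix_mul_assoc)
    then have nz: "bdet I (?P ** ?y ** ?P) \<noteq> 0" by simp
    then have Ry: "range ((*v) ?y) = ?R ?y" by (simp add: frame_span_def yP)
    have inj: "?P *v c = 0" if "?y *v c = 0" for c using top_block_inj[OF nz] that by (simp add: yP)
    have E: "subspace (?R ?y)" "dim (?R ?y) = card I" using frame_span_grassmannian[of I ?y] by (auto simp: grassmannian_def)
    have j: "jacvol (mat 1) (?R ?y) \<noteq> 0" "jacvol (mat 1) (?R ?y) \<noteq> top"
      unfolding jacvol_id[OF E] by (rule ballvol_id_mult_nz)+
    have bw: "ballvol I (H ** ?y) = ballvol I ?y * ?w (?R ?y)"
    proof -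
      have "ballvol I (H ** ?y) = ballvol I (H ** ?y) * jacvol (mat 1) (?R ?y) / jacvol (mat 1) (?R ?y)"
        using j by (simp add: mult_divide_eq_ennreal)
      also have "\<dots> = ballvol I ?y * jacvol H (?R ?y) / jacvol (mat 1) (?R ?y)"
        using ballvol_jacvol[OF yP inj Ry E(2), of H] by simp
      finally show ?thesis by (simp add: jac_density_def ennreal_times_divide)
    qed
    define c0 where "c0 = (\<integral>\<^sup>+a. ennreal (bdet I (?P ** a ** ?P)) ^ card (- I) * indicator ?C (?P ** a ** ?P) \<partial>mlebesgue I I)"
    \<comment> \<open>The constant \<open>c0\<close> is the same for \<open>H\<close> and for the
      identity, so it drops out when \<open>K H\<close> is compared with
      \<open>K (mat 1)\<close>.\<close>
    have Kh: "K h x * \<omega> ^ ?n = c0 * ballvol I (h ** ?y) ^ ?n" if h: "det h \<noteq> 0" for h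
    proof -
      let ?hy = "h ** ?y"
      have hyP: "?hy ** ?P = ?hy" using yP by (simp add: matrix_mul_assoc[symmetric])
      have injh: "?P *v c = 0" if "?hy *v c = 0" for c
      proof -
        obtain B where "B ** h = mat 1" using h matrix_inverse_pair by metis
        then have "?y *v c = B *v (?hy *v c)" by (simp add: matrix_vector_mul_assoc matrix_mul_assoc)
        then show ?thesis using that inj by simp
      qed
      have "range ((*v) ?hy) = (*v) h ` ?R ?y" unfolding Ry[symmetric] by (auto simp: image_image matrix_vector_mul_assoc)
      then have G: "range ((*v) ?hy) \<in> grassmannian (card I)"
        using grassmannian_linear_image[OF h frame_span_grassmannian] by simp
      then obtain V where V: "orthogonal_matrix V" "(*v) V ` coord_space I = range ((*v) ?hy)"
        using exists_orthogonal_frame[of "range ((*v) ?hy)" I] by (auto simp: grassmannian_def)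
      let ?s = "transpose V ** ?hy"
      have s: "block I ?s" "bdet I ?s \<noteq> 0" "V ** ?s = ?hy"
        using frame_coordinates[OF V(1) hyP V(2)[symmetric] injh] by auto
      have n: "norm (?hy *v (?P *v c)) = norm (?s *v c)" for c
      proof -
        have "?hy *v (?P *v c) = V *v (?s *v c)"
          by (simp only: matrix_vector_mul_assoc hyP s(3))
        then show ?thesis by (simp only: orthogonal_matrix_norm[OF V(1)])
      qed
      show ?thesis
        using nn_integral_bdet_colball[OF s(1,2) n hyP] by (simp add: K_def \<omega>_def c0_def matrix_mul_assoc)
    qed
    have "K H x * \<omega> ^ ?n = (c0 * ballvol I ?y ^ ?n) * ?w (?R ?y) ^ ?n"
      using Kh[OF H0] by (simp add: bw power_mult_distrib mult.assoc)
    also have "c0 * ballvol I ?y ^ ?n = K (mat 1) x * \<omega> ^ ?n" using Kh[of "mat 1"] by simp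
    finally have "K H x * \<omega> ^ ?n = (K (mat 1) x * ?w (?R ?y) ^ ?n) * \<omega> ^ ?n" by (simp add: mult_ac)
    then show ?thesis using \<omega> by (metis mult_divide_eq_ennreal)
  qed
  \<comment> \<open>The chain below substitutes \<open>H ** y\<close> with Jacobian 1, passes to the
    chart, exchanges the masses \<open>K\<close>, and leaves the chart again.\<close>
  let ?\<psi> = "\<lambda>y. \<phi> ((*v) H ` ?R y)"
  have "(\<integral>\<^sup>+y. \<phi> (?R y) * indicator ?C y \<partial>?Y) = (\<integral>\<^sup>+y. \<phi> (?R (H ** y)) * indicator ?C (H ** y) \<partial>?Y)"
    using nn_integral_mlebesgue_left[of UNIV H "\<lambda>y. \<phi> (?R y) * indicator ?C y" I] H H0 by simp
  also have "\<dots> = (\<integral>\<^sup>+y. ?\<psi> y * indicator {y. H ** y \<in> ?C} y \<partial>?Y)"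
    by (intro nn_integral_cong_AE, rule AE_mp[OF span_eq], rule AE_I2) (simp add: indicator_def)
  also have "\<dots> = (\<integral>\<^sup>+x. ?\<psi> (?P + ?Q ** x ** ?P) * K H x \<partial>mlebesgue (- I) I)"
    unfolding K_def
    by (subst nn_integral_chart) (auto simp: frame_span_mult indicator_def intro!: nn_integral_cong)
  also have "\<dots> = (\<integral>\<^sup>+x. (?\<psi> (?P + ?Q ** x ** ?P) * ?w (?R (?P + ?Q ** x ** ?P)) ^ ?n) * K (mat 1) x \<partial>mlebesgue (- I) I)"
    by (simp add: K mult_ac)
  also have "\<dots> = (\<integral>\<^sup>+y. (?\<psi> y * ?w (?R y) ^ ?n) * indicator ?C y \<partial>?Y)"
    unfolding K_def
    by (subst nn_integral_chart[where \<phi>="\<lambda>y. ?\<psi> y * ?w (?R y) ^ ?n"]) (auto simp: frame_span_mult)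
  finally show ?thesis by (subst (1 2) nn_integral_frame_haar) auto
qed

lemma linear_matrix_ex:
  fixes g :: "real ^ 'n::finite \<Rightarrow> real ^ 'n"
  assumes "linear g" shows "g = (*v) (matrix g)"
  using matrix_vector_mul(2)[OF assms] by simp

text \<open>An isometry has Jacobian 1 on every subspace, so the density formula reduces to
  invariance.\<close>

lemma frame_haar_orthogonal:
  fixes U :: "real ^ 'n::finite \<Rightarrow> real ^ 'n"
  assumes "orthogonal_transformation U"
  shows "distr (frame_haar I) (frame_haar I) ((`) U) = frame_haar (I :: 'n set)"
proof -
  define H where "H = matrix U"
  have UH: "U = (*v) H" unfolding H_def using assms by (intro linear_matrix_ex orthogonal_transformation_linear)
  have O: "orthogonal_matrix H" using assms by (simp add: H_def orthogonal_transformation_matrix)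
  then have d: "\<bar>det H\<bar> = 1" by (rule orthogonal_matrix_det)
  then have d0: "det H \<noteq> 0" by auto
  have w: "jac_density H E = 1" if E: "E \<in> grassmannian (card I)" for E
  proof -
    have sE: "subspace E" "dim E = card I" using E by (auto simp: grassmannian_def)
    have "jacvol (mat 1) E \<noteq> 0" "jacvol (mat 1) E \<noteq> top"
      unfolding jacvol_id[OF sE] by (rule ballvol_id_mult_nz)+
    moreover have "jacvol H E = jacvol (mat 1) E" by (simp add: jacvol_def orthogonal_matrix_norm[OF O])
    ultimately show ?thesis unfolding jac_density_def by (metis mult_1 mult_divide_eq_ennreal)
  qed
  have m: "(`) U \<in> frame_haar I \<rightarrow>\<^sub>M frame_haar I"
    using measurable_linear_flats[OF d0] by (simp add: UH cong: measurable_cong_sets)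
  show ?thesis
  proof (rule measure_eqI)
    fix A assume "A \<in> sets (distr (frame_haar I) (frame_haar I) ((`) U))"
    then have A: "A \<in> sets (frame_haar I)" by simp
    have "emeasure (distr (frame_haar I) (frame_haar I) ((`) U)) A = (\<integral>\<^sup>+E. indicator A E \<partial>distr (frame_haar I) (frame_haar I) ((`) U))"
      using A by simp
    also have "\<dots> = (\<integral>\<^sup>+E. indicator A (U ` E) \<partial>frame_haar I)"
      using A by (intro nn_integral_distr m) auto
    also have "\<dots> = (\<integral>\<^sup>+E. indicator A ((*v) H ` E) * jac_density H E ^ CARD('n) \<partial>frame_haar I)"
      by (intro nn_integral_cong) (simp add: w UH)
    also have "\<dots> = (\<integral>\<^sup>+E. indicator A E \<partial>frame_haar I)"
      using A by (intro frame_haar_linear[OF d]) auto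
    finally show "emeasure (distr (frame_haar I) (frame_haar I) ((`) U)) A = emeasure (frame_haar I) A" using A by simp
  qed simp
qed

subsection \<open>Uniqueness of the invariant measure\<close>

text \<open>Two probability measures for which balls of equal radius around points of the support
  space have equal measure coincide (Christensen): by Fubini they assign the same measure
  to balls, and Fatou's lemma for small radii compares them on open sets.\<close>

lemma uniformly_distributed_le:
  fixes \<iota> :: "'a \<Rightarrow> 'b::{metric_space, second_countable_topology}"
  assumes M1: "prob_space M1" and M2: "prob_space M2" and S: "sets M1 = sets M2"
    and \<iota>: "\<iota> \<in> M1 \<rightarrow>\<^sub>M borel"
    and c1: "\<And>x r. x \<in> space M1 \<Longrightarrow> emeasure M1 {y \<in> space M1. dist (\<iota> y) (\<iota> x) < r} = c1 r"
    and c2: "\<And>x r. x \<in> space M1 \<Longrightarrow> emeasure M2 {y \<in> space M1. dist (\<iota> y) (\<iota> x) < r} = c2 r"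
    and U: "open U"
  shows "emeasure M1 {x \<in> space M1. \<iota> x \<in> U} \<le> emeasure M2 {x \<in> space M1. \<iota> x \<in> U}"
proof -
  interpret M1: prob_space M1 by fact
  interpret M2: prob_space M2 by fact
  interpret P: pair_sigma_finite M1 M2 ..
  have sp: "space M2 = space M1" using sets_eq_imp_space_eq[OF S] by simp
  note \<iota>[measurable]
  have \<iota>2[measurable]: "\<iota> \<in> M2 \<rightarrow>\<^sub>M borel" using \<iota> S by (simp cong: measurable_cong_sets)
  have U[measurable]: "U \<in> sets borel" using U by simp
  let ?A = "{x \<in> space M1. \<iota> x \<in> U}"
  have A1[measurable]: "?A \<in> sets M1" by measurable
  have A2[measurable]: "?A \<in> sets M2" using A1 S by simp
  let ?k = "\<lambda>r x y. if dist (\<iota> y) (\<iota> x) < r then 1 else 0 :: ennreal"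
  have k1: "(\<integral>\<^sup>+x. ?k r x y \<partial>M1) = c1 r" if "y \<in> space M1" for y r
  proof -
    have [measurable]: "{x \<in> space M1. dist (\<iota> x) (\<iota> y) < r} \<in> sets M1" by measurable
    have "(\<integral>\<^sup>+x. ?k r x y \<partial>M1) = (\<integral>\<^sup>+x. indicator {x \<in> space M1. dist (\<iota> x) (\<iota> y) < r} x \<partial>M1)"
      by (intro nn_integral_cong) (auto simp: indicator_def dist_commute)
    then show ?thesis using c1[OF that] by simp
  qed
  have k2: "(\<integral>\<^sup>+y. ?k r x y \<partial>M2) = c2 r" if "x \<in> space M1" for x r
  proof -
    have [measurable]: "{y \<in> space M1. dist (\<iota> y) (\<iota> x) < r} \<in> sets M2" unfolding sp[symmetric] by measurable
    have "(\<integral>\<^sup>+y. ?k r x y \<partial>M2) = (\<integral>\<^sup>+y. indicator {y \<in> space M1. dist (\<iota> y) (\<iota> x) < r} y \<partial>M2)"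
      by (intro nn_integral_cong) (auto simp: indicator_def sp)
    then show ?thesis using c2[OF that] by simp
  qed
  \<comment> \<open>Both radius functions equal the double integral of the symmetric kernel,
    computed in the two orders.\<close>
  have c: "c1 r = c2 r" for r
  proof -
    have "c2 r = (\<integral>\<^sup>+x. c2 r \<partial>M1)" by (simp add: M1.emeasure_space_1)
    also have "\<dots> = (\<integral>\<^sup>+x. \<integral>\<^sup>+y. ?k r x y \<partial>M2 \<partial>M1)" by (rule nn_integral_cong) (simp only: k2)
    also have "\<dots> = (\<integral>\<^sup>+y. \<integral>\<^sup>+x. ?k r x y \<partial>M1 \<partial>M2)" by (rule P.Fubini'[symmetric]) measurable
    also have "\<dots> = (\<integral>\<^sup>+y. c1 r \<partial>M2)" by (rule nn_integral_cong) (simp only: sp k1)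
    also have "\<dots> = c1 r" by (simp add: M2.emeasure_space_1)
    finally show ?thesis by simp
  qed
  have ne: "space M1 \<noteq> {}" by (rule M1.not_empty)
  \<comment> \<open>If balls of radius \<open>r\<close> were null, countably many of them would
    cover the space by Lindelof, against total mass 1.\<close>
  have cpos: "c1 r \<noteq> 0" if r: "0 < r" for r
  proof
    assume c0: "c1 r = 0"
    obtain \<B> where \<B>: "\<B> \<subseteq> (\<lambda>x. ball (\<iota> x) r) ` space M1" "countable \<B>" "\<Union>\<B> = \<Union>((\<lambda>x. ball (\<iota> x) r) ` space M1)"
      using Lindelof[of "(\<lambda>x. ball (\<iota> x) r) ` space M1"] by auto
    have "(\<Union>b\<in>\<B>. {y \<in> space M1. \<iota> y \<in> b}) \<in> null_sets M1"
    proof (rule null_sets_UN'[OF \<B>(2)])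
      fix b assume "b \<in> \<B>"
      then obtain x where x: "x \<in> space M1" "b = ball (\<iota> x) r" using \<B>(1) by auto
      then have "{y \<in> space M1. \<iota> y \<in> b} = {y \<in> space M1. dist (\<iota> y) (\<iota> x) < r}" by (auto simp: dist_commute)
      moreover have "{y \<in> space M1. dist (\<iota> y) (\<iota> x) < r} \<in> sets M1" by measurable
      ultimately show "{y \<in> space M1. \<iota> y \<in> b} \<in> null_sets M1" using c1[OF x(1), of r] c0 by auto
    qed
    moreover have "(\<Union>b\<in>\<B>. {y \<in> space M1. \<iota> y \<in> b}) = space M1"
    proof -
      have "\<iota> y \<in> \<Union>\<B>" if "y \<in> space M1" for y unfolding \<B>(3) using that r by (intro UN_I[of y]) auto
      then show ?thesis by auto
    qed
    ultimately show False using M1.emeasure_space_1 by (auto simp: null_sets_def)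
  qed
  have cfin: "c1 r \<noteq> top" for r
  proof -
    obtain x where "x \<in> space M1" using ne by auto
    then show ?thesis using c1[of x r] M1.emeasure_finite by metis
  qed
  define r where "r m = 1 / real (Suc m)" for m
  have r: "0 < r m" for m by (simp add: r_def)
  \<comment> \<open>The share, with respect to \<open>M2\<close>, of the ball of radius
    \<open>r m\<close> that lies in \<open>?A\<close>. It is eventually 1 at points of
    \<open>?A\<close>, because \<open>U\<close> is open.\<close>
  let ?u = "\<lambda>m x. indicator ?A x * (\<integral>\<^sup>+y. indicator ?A y * ?k (r m) x y \<partial>M2) / c1 (r m)"
  have um[measurable]: "?u m \<in> borel_measurable M1" for m by measurable
  have "indicator ?A x \<le> liminf (\<lambda>m. ?u m x)" if x: "x \<in> space M1" for x
  proof (cases "x \<in> ?A")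
    case True
    then obtain e where e: "0 < e" "ball (\<iota> x) e \<subseteq> U" using openE[OF \<open>open U\<close>, of "\<iota> x"] by auto
    have "\<forall>\<^sub>F m in sequentially. r m < e"
      unfolding r_def using order_tendstoD(2)[OF LIMSEQ_inverse_real_of_nat e(1)] by (simp add: inverse_eq_divide)
    then have "\<forall>\<^sub>F m in sequentially. 1 \<le> ?u m x"
    proof eventually_elim
      case (elim m)
      have "(\<integral>\<^sup>+y. indicator ?A y * ?k (r m) x y \<partial>M2) = (\<integral>\<^sup>+y. ?k (r m) x y \<partial>M2)"
      proof (rule nn_integral_cong)
        fix y assume "y \<in> space M2"
        then show "indicator ?A y * ?k (r m) x y = ?k (r m) x y"
          using elim e(2) by (auto simp: indicator_def sp dist_commute subset_eq)
      qed
      also have "\<dots> = c1 (r m)" using k2[OF x] c by simp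
      finally have "?u m x = c1 (r m) / c1 (r m)" using True by simp
      also have "c1 (r m) / c1 (r m) = 1"
        using mult_divide_eq_ennreal[OF cpos[OF r] cfin, of 1] by simp
      finally show ?case using True by simp
    qed
    then have "1 \<le> liminf (\<lambda>m. ?u m x)" by (rule Liminf_bounded)
    then show ?thesis using True by simp
  qed simp
  then have "emeasure M1 ?A \<le> (\<integral>\<^sup>+x. liminf (\<lambda>m. ?u m x) \<partial>M1)"
    by (subst nn_integral_indicator[OF A1, symmetric]) (intro nn_integral_mono)
  also have "\<dots> \<le> liminf (\<lambda>m. \<integral>\<^sup>+x. ?u m x \<partial>M1)" by (rule nn_integral_liminf) (rule um)
  also have "\<dots> \<le> emeasure M2 ?A"
  proof (rule Liminf_le)
    have "(\<integral>\<^sup>+x. ?u m x \<partial>M1) \<le> emeasure M2 ?A" for m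
    proof -
    \<comment> \<open>Dropping the first indicator and exchanging the integrals leaves the mass of
      the ball around \<open>y\<close>, which is again \<open>c1 (r m)\<close>.\<close>
    have "(\<integral>\<^sup>+x. indicator ?A x * (\<integral>\<^sup>+y. indicator ?A y * ?k (r m) x y \<partial>M2) \<partial>M1)
      \<le> (\<integral>\<^sup>+x. \<integral>\<^sup>+y. indicator ?A y * ?k (r m) x y \<partial>M2 \<partial>M1)"
      by (intro nn_integral_mono) (auto simp: indicator_def)
    also have "\<dots> = (\<integral>\<^sup>+y. \<integral>\<^sup>+x. indicator ?A y * ?k (r m) x y \<partial>M1 \<partial>M2)"
      by (rule P.Fubini'[symmetric]) measurable
    also have "\<dots> = (\<integral>\<^sup>+y. indicator ?A y * c1 (r m) \<partial>M2)"
    proof (rule nn_integral_cong)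
      fix y assume "y \<in> space M2"
      then have y: "y \<in> space M1" by (simp add: sp)
      show "(\<integral>\<^sup>+x. indicator ?A y * ?k (r m) x y \<partial>M1) = indicator ?A y * c1 (r m)"
        by (subst nn_integral_cmult) (use k1[OF y] in auto)
    qed
    also have "\<dots> = emeasure M2 ?A * c1 (r m)" by (subst nn_integral_multc) auto
    finally have le: "(\<integral>\<^sup>+x. indicator ?A x * (\<integral>\<^sup>+y. indicator ?A y * ?k (r m) x y \<partial>M2) \<partial>M1)
      \<le> emeasure M2 ?A * c1 (r m)" .
    have "(\<integral>\<^sup>+x. ?u m x \<partial>M1) = (\<integral>\<^sup>+x. indicator ?A x * (\<integral>\<^sup>+y. indicator ?A y * ?k (r m) x y \<partial>M2) \<partial>M1) / c1 (r m)"
      by (rule nn_integral_divide) measurable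
    also have "\<dots> \<le> emeasure M2 ?A * c1 (r m) / c1 (r m)" using le by (rule divide_right_mono_ennreal)
    also have "\<dots> = emeasure M2 ?A" using cpos[OF r] cfin by (simp add: mult_divide_eq_ennreal)
    finally show ?thesis .
    qed
    then show "\<forall>\<^sub>F m in sequentially. (\<integral>\<^sup>+x. ?u m x \<partial>M1) \<le> emeasure M2 ?A" by simp
  qed simp
  finally show ?thesis .
qed

lemma matrix_mult_diff_ldistrib: "A ** (B - C) = A ** B - A ** (C :: real ^ 'n::finite ^ 'm::finite)"
  and matrix_mult_diff_rdistrib: "(B - C) ** D = B ** D - C ** (D :: real ^ 'l::finite ^ 'n)"
  by (simp_all add: matrix_matrix_mult_def vec_eq_iff left_diff_distrib right_diff_distrib sum_subtractf)

text \<open>The matrix norm is the Euclidean norm of the entries, so it is invariant under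
  transposition and under isometries acting on each row.\<close>

lemma norm_orthogonal_mult:
  fixes U A :: "real ^ 'n::finite ^ 'n"
  assumes U: "orthogonal_matrix U"
  shows "norm (U ** A ** transpose U) = norm A"
proof -
  have t: "norm (transpose A) = norm A" for A :: "real ^ 'n ^ 'n"
  proof -
    have "(norm (transpose A))\<^sup>2 = (norm A)\<^sup>2"
      unfolding norm_vec_def L2_set_def by (simp add: sum_nonneg transpose_def) (rule sum.swap)
    then show ?thesis by simp
  qed
  have r: "norm (A ** transpose U) = norm A" for A :: "real ^ 'n ^ 'n"
  proof -
    have "norm ((A ** transpose U) $ i) = norm (A $ i)" for i
      by (simp add: matrix_mult_nth orthogonal_matrix_norm[OF U] del: transpose_matrix_vector)
    then show ?thesis by (simp add: norm_vec_def)
  qed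
  have "norm (U ** A) = norm (transpose (U ** A))" by (simp add: t)
  also have "\<dots> = norm A" using r[of "transpose A"] by (simp add: matrix_transpose_mul t)
  finally show ?thesis using r[of "U ** A"] by simp
qed

lemma prj_orthogonal_image:
  fixes U :: "real ^ 'n::finite ^ 'n"
  assumes U: "orthogonal_matrix U" and E: "subspace E"
  shows "prj ((*v) U ` E) = U ** prj E ** transpose U"
proof (rule projection_unique)
  let ?q = "U ** prj E ** transpose U"
  have E': "subspace ((*v) U ` E)" using E by (intro linear_subspace_image) auto
  show "transpose (prj ((*v) U ` E)) = prj ((*v) U ` E)" "prj ((*v) U ` E) ** prj ((*v) U ` E) = prj ((*v) U ` E)"
    using transpose_prj[OF E'] prj_idem[OF E'] by auto
  show "transpose ?q = ?q" by (simp add: matrix_transpose_mul matrix_mul_assoc transpose_prj[OF E])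
  have "?q ** ?q = U ** (prj E ** ((transpose U ** U) ** prj E)) ** transpose U" by (simp only: matrix_mul_assoc)
  then show "?q ** ?q = ?q" using orthogonal_matrix_cancel[OF U] by (simp add: prj_idem[OF E])
  have "range ((*v) ?q) = (*v) U ` (*v) (prj E) ` range ((*v) (transpose U))"
    by (auto simp: image_image matrix_vector_mul_assoc matrix_mul_assoc simp del: transpose_matrix_vector)
  also have "range ((*v) (transpose U)) = UNIV"
    by (metis orthogonal_matrix_cancel(5)[OF U] surj_def)
  finally show "range ((*v) (prj ((*v) U ` E))) = range ((*v) ?q)"
    by (simp add: range_prj[OF E] range_prj[OF E'])
qed

text \<open>Hitting sets are in general not stable under intersection. Preimages of open sets under
  \<open>prj\<close> are, so they can serve as generator in the uniqueness argument.\<close>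

lemma sets_flats_borel_prj:
  fixes k :: nat
  defines "G \<equiv> grassmannian k :: (real ^ 'n::finite) set set"
  shows "sets (flats_borel G) = sigma_sets G {{E \<in> G. prj E \<in> U} | U. open U}"
proof
  have sub: "subspace E" if "E \<in> G" for E using that by (simp add: G_def grassmannian_def)
  have "{{F \<in> G. F \<inter> U \<noteq> {}} | U. open U} \<subseteq> {{E \<in> G. prj E \<in> U} | U. open U}"
  proof safe
    fix U :: "(real ^ 'n) set" assume U: "open U"
    let ?V = "\<Union>x. {p :: real ^ 'n ^ 'n. p *v x \<in> U}"
    have "open ?V"
    proof (rule open_UN, rule ballI)
      fix x
      have "continuous_on UNIV (\<lambda>p :: real ^ 'n ^ 'n. p *v x)"
        unfolding matrix_vector_mult_def by (intro continuous_intros)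
      then have "open ((\<lambda>p :: real ^ 'n ^ 'n. p *v x) -` U)" using U by (simp add: open_vimage)
      then show "open {p :: real ^ 'n ^ 'n. p *v x \<in> U}" by (simp add: vimage_def)
    qed
    moreover have "{F \<in> G. F \<inter> U \<noteq> {}} = {E \<in> G. prj E \<in> ?V}"
    proof (intro Collect_cong conj_cong refl)
      fix E assume "E \<in> G"
      then have sE: "subspace E" by (rule sub)
      show "E \<inter> U \<noteq> {} \<longleftrightarrow> prj E \<in> ?V"
      proof
        assume "E \<inter> U \<noteq> {}"
        then obtain x where "x \<in> E" "x \<in> U" by auto
        then have "prj E *v x \<in> U" by (simp add: prj_fix[OF sE])
        then show "prj E \<in> ?V" by blast
      next
        assume "prj E \<in> ?V"
        then obtain x where "prj E *v x \<in> U" by blast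
        then show "E \<inter> U \<noteq> {}" using prj_in[OF sE, of x] by blast
      qed
    qed
    ultimately show "\<exists>Ua. {F \<in> G. F \<inter> U \<noteq> {}} = {E \<in> G. prj E \<in> Ua} \<and> open Ua" by blast
  qed
  then show "sets (flats_borel G) \<subseteq> sigma_sets G {{E \<in> G. prj E \<in> U} | U. open U}"
    unfolding sets_flats_borel by (rule sigma_sets_mono')
  have "{{E \<in> G. prj E \<in> U} | U. open U} \<subseteq> sets (flats_borel G)"
  proof safe
    fix U :: "(real ^ 'n ^ 'n) set" assume "open U"
    then have "prj -` U \<inter> space (flats_borel G) \<in> sets (flats_borel G)"
      unfolding G_def by (intro measurable_sets[OF measurable_prj]) auto
    also have "prj -` U \<inter> space (flats_borel G) = {E \<in> G. prj E \<in> U}" by auto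
    finally show "{E \<in> G. prj E \<in> U} \<in> sets (flats_borel G)" .
  qed
  then show "sigma_sets G {{E \<in> G. prj E \<in> U} | U. open U} \<subseteq> sets (flats_borel G)"
    using sets.sigma_sets_subset[of _ "flats_borel G"] by simp
qed

text \<open>The orthogonal group acts transitively and, through \<open>prj\<close>, by isometries,
  so an invariant probability measure gives equal mass to balls of equal radius. The comparison on
  open sets then applies in both directions.\<close>

lemma invariant_measure_unique:
  fixes M1 M2 :: "(real ^ 'n::finite) set measure"
  assumes M1: "sets M1 = sets (flats_borel (grassmannian (card (I :: 'n set))))" "prob_space M1"
      "\<And>U. orthogonal_transformation U \<Longrightarrow> distr M1 M1 ((`) U) = M1"
    and M2: "sets M2 = sets (flats_borel (grassmannian (card I)))" "prob_space M2"
      "\<And>U. orthogonal_transformation U \<Longrightarrow> distr M2 M2 ((`) U) = M2"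
  shows "M1 = M2"
proof -
  let ?G = "grassmannian (card I) :: (real ^ 'n) set set"
  let ?S = "{{E \<in> ?G. prj E \<in> U} | U. open U}"
  have sp: "space M1 = ?G" "space M2 = ?G" using sets_eq_imp_space_eq[OF M1(1)] sets_eq_imp_space_eq[OF M2(1)] by auto
  have const: "emeasure M {E \<in> ?G. dist (prj E) (prj F) < r} = emeasure M {E \<in> ?G. dist (prj E) (prj (coord_space I)) < r}"
    if M: "sets M = sets (flats_borel ?G)" "\<And>U. orthogonal_transformation U \<Longrightarrow> distr M M ((`) U) = M"
      and F: "F \<in> ?G" for M F r
  proof -
    have sF: "subspace F" "dim F = card I" using F by (auto simp: grassmannian_def)
    have sM: "space M = ?G" using sets_eq_imp_space_eq[OF M(1)] by simp
    obtain U where U: "orthogonal_matrix U" "(*v) U ` coord_space I = F"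
      using exists_orthogonal_frame[OF sF] by auto
    have d0: "det U \<noteq> 0" using orthogonal_matrix_det[OF U(1)] by auto
    have ot: "orthogonal_transformation ((*v) U)" using U(1) by (simp add: orthogonal_transformation_matrix)
    have m: "(`) ((*v) U) \<in> M \<rightarrow>\<^sub>M M" using measurable_linear_flats[OF d0] M(1) by (simp cong: measurable_cong_sets)
    have B: "{E \<in> ?G. dist (prj E) (prj F) < r} \<in> sets M"
    proof -
      have "{E \<in> space (flats_borel ?G). dist (prj E) (prj F) < r} \<in> sets (flats_borel ?G)" by measurable
      then show ?thesis using M(1) by simp
    qed
    have dd: "dist (prj ((*v) U ` E)) (prj F) = dist (prj E) (prj (coord_space I))" if "E \<in> ?G" for E
    proof -
      have sE: "subspace E" using that by (simp add: grassmannian_def)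
      have "prj ((*v) U ` E) - prj F = U ** (prj E - prj (coord_space I)) ** transpose U"
        unfolding U(2)[symmetric] prj_orthogonal_image[OF U(1) sE] prj_orthogonal_image[OF U(1) subspace_coord_space]
        by (simp add: matrix_mult_diff_ldistrib matrix_mult_diff_rdistrib)
      then show ?thesis by (simp add: dist_norm norm_orthogonal_mult[OF U(1)])
    qed
    have "emeasure M {E \<in> ?G. dist (prj E) (prj F) < r} = emeasure (distr M M ((`) ((*v) U))) {E \<in> ?G. dist (prj E) (prj F) < r}"
      using M(2)[OF ot] by simp
    also have "\<dots> = emeasure M ((`) ((*v) U) -` {E \<in> ?G. dist (prj E) (prj F) < r} \<inter> space M)"
      by (rule emeasure_distr[OF m B])
    also have "(`) ((*v) U) -` {E \<in> ?G. dist (prj E) (prj F) < r} \<inter> space M = {E \<in> ?G. dist (prj E) (prj (coord_space I)) < r}"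
      using grassmannian_linear_image[OF d0] dd by (auto simp: sM)
    finally show ?thesis .
  qed
  have const1: "emeasure M1 {E \<in> ?G. dist (prj E) (prj F) < r} = emeasure M1 {E \<in> ?G. dist (prj E) (prj (coord_space I)) < r}"
    and const2: "emeasure M2 {E \<in> ?G. dist (prj E) (prj F) < r} = emeasure M2 {E \<in> ?G. dist (prj E) (prj (coord_space I)) < r}"
    if "F \<in> ?G" for F r
    using that M1 M2 by (auto intro!: const)
  have S12: "sets M1 = sets M2" using M1(1) M2(1) by simp
  have p1: "prj \<in> M1 \<rightarrow>\<^sub>M borel" "prj \<in> M2 \<rightarrow>\<^sub>M borel"
    using measurable_prj[of "card I"] M1(1) M2(1) by (simp_all cong: measurable_cong_sets)
  have eq: "emeasure M1 {E \<in> ?G. prj E \<in> U} = emeasure M2 {E \<in> ?G. prj E \<in> U}" if U: "open U" for U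
  proof (rule antisym)
    show "emeasure M1 {E \<in> ?G. prj E \<in> U} \<le> emeasure M2 {E \<in> ?G. prj E \<in> U}"
      using uniformly_distributed_le[OF M1(2) M2(2) S12 p1(1) _ _ U, unfolded sp, OF const1 const2] .
    show "emeasure M2 {E \<in> ?G. prj E \<in> U} \<le> emeasure M1 {E \<in> ?G. prj E \<in> U}"
      using uniformly_distributed_le[OF M2(2) M1(2) S12[symmetric] p1(2) _ _ U, unfolded sp, OF const2 const1] .
  qed
  interpret M1: prob_space M1 by fact
  show ?thesis
  proof (rule measure_eqI_generator_eq[where E="?S" and \<Omega>="?G" and A="\<lambda>_. ?G"])
    show "Int_stable ?S"
    proof (rule Int_stableI)
      fix a b assume "a \<in> ?S" "b \<in> ?S"
      then obtain U V where "open U" "open V" "a = {E \<in> ?G. prj E \<in> U}" "b = {E \<in> ?G. prj E \<in> V}" by auto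
      then have "a \<inter> b = {E \<in> ?G. prj E \<in> U \<inter> V}" "open (U \<inter> V)" by auto
      then show "a \<inter> b \<in> ?S" by blast
    qed
    show "range (\<lambda>_::nat. ?G) \<subseteq> ?S" by (auto intro!: exI[of _ UNIV])
    show "sets M1 = sigma_sets ?G ?S" "sets M2 = sigma_sets ?G ?S"
      by (simp_all only: M1(1) M2(1) sets_flats_borel_prj)
    show "emeasure M1 X = emeasure M2 X" if "X \<in> ?S" for X using that eq by blast
  qed (use M1.emeasure_finite in auto)
qed

text \<open>Existence and uniqueness together resolve the definite description.\<close>

lemma grassmannian_haar_eq:
  "grassmannian_haar (card I) = frame_haar (I :: 'n::finite set)"
  unfolding grassmannian_haar_def
proof (rule the_equality)
  show *: "sets (frame_haar I) = sets (flats_borel (grassmannian (card I))) \<and> prob_space (frame_haar I) \<and>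
    (\<forall>U. orthogonal_transformation U \<longrightarrow> distr (frame_haar I) (frame_haar I) ((`) U) = frame_haar I)"
    using prob_space_frame_haar frame_haar_orthogonal by auto
  fix \<mu> :: "(real ^ 'n) set measure"
  assume "sets \<mu> = sets (flats_borel (grassmannian (card I))) \<and> prob_space \<mu> \<and>
    (\<forall>U. orthogonal_transformation U \<longrightarrow> distr \<mu> \<mu> ((`) U) = \<mu>)"
  then show "\<mu> = frame_haar I" using * by (intro invariant_measure_unique[of \<mu> I]) auto
qed

subsection \<open>The invariant measure on the affine Grassmannian\<close>

lemma orthogonal_comp_frame:
  fixes U :: "real ^ 'n::finite ^ 'n"
  assumes U: "orthogonal_matrix U"
  shows "((*v) U ` coord_space I)\<^sup>\<bottom> = (*v) U ` coord_space (- I)"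
proof -
  have ip: "(U *v v) \<bullet> (U *v w) = v \<bullet> w" for v w
    using U orthogonal_transformation_matrix[of "(*v) U"] by (simp add: orthogonal_transformation_def)
  show ?thesis
  proof safe
    fix x assume x: "x \<in> ((*v) U ` coord_space I)\<^sup>\<bottom>"
    define z where "z = transpose U *v x"
    have xz: "x = U *v z" unfolding z_def by (rule orthogonal_matrix_cancel(6)[OF U, symmetric])
    have "cproj I *v z \<in> coord_space I" by (simp add: coord_space_def)
    then have "(U *v (cproj I *v z)) \<bullet> x = 0"
      using x unfolding orthogonal_comp_def orthogonal_def by blast
    then have "(cproj I *v z) \<bullet> z = 0" unfolding xz ip .
    moreover have "(cproj I *v z) \<bullet> z = (cproj I *v z) \<bullet> (cproj I *v z)"
      unfolding inner_vec_def by (intro sum.cong) (auto simp: cproj_mult_vec)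
    ultimately have "cproj I *v z = 0" by simp
    then have "z = cproj (- I) *v z"
      using matrix_vector_mult_add_rdistrib[of "cproj I" "cproj (- I)" z] by (simp add: cproj_add_compl)
    then have "z \<in> coord_space (- I)" by (simp add: coord_space_iff)
    then show "x \<in> (*v) U ` coord_space (- I)" using xz by blast
  next
    fix w assume w: "w \<in> coord_space (- I)"
    have "v \<bullet> w = 0" if "v \<in> coord_space I" for v
    proof -
      have e: "cproj I *v v = v" "cproj (- I) *v w = w" using that w by (simp_all add: coord_space_iff)
      have "v $ i = 0 \<or> w $ i = 0" for i
        using arg_cong[OF e(1), of "\<lambda>u. u $ i"] arg_cong[OF e(2), of "\<lambda>u. u $ i"]
        by (simp add: cproj_mult_vec split: if_splits)
      then show ?thesis unfolding inner_vec_def by (intro sum.neutral) auto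
    qed
    then show "U *v w \<in> ((*v) U ` coord_space I)\<^sup>\<bottom>"
      by (auto simp: orthogonal_comp_def orthogonal_def ip)
  qed
qed

lemma translate_subspace_absorb:
  assumes "subspace E" "u \<in> E"
  shows "(\<lambda>y. u + v + y) ` E = (\<lambda>y. v + y) ` E"
proof safe
  fix y assume "y \<in> E"
  then show "u + v + y \<in> (\<lambda>y. v + y) ` E"
    using assms by (intro image_eqI[of _ _ "u + y"]) (auto simp: subspace_add)
next
  fix y assume "y \<in> E"
  then show "v + y \<in> (\<lambda>y. u + v + y) ` E"
    using assms by (intro image_eqI[of _ _ "y - u"]) (auto simp: subspace_diff)
qed

lemma grassmannian_frame:
  fixes E :: "(real ^ 'n::finite) set"
  assumes "E \<in> grassmannian (card (I :: 'n set))"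
  obtains U where "orthogonal_matrix U" "E = (*v) U ` coord_space I"
  using assms exists_orthogonal_frame[of E I] by (auto simp: grassmannian_def)

lemma translate_grassmannian:
  fixes E :: "(real ^ 'n::finite) set"
  assumes "E \<in> grassmannian (card (I :: 'n set))"
  shows "(\<lambda>y. x + y) ` E \<in> affine_grassmannian (card I)" "direction ((\<lambda>y. x + y) ` E) = E"
proof -
  obtain U where U: "orthogonal_matrix U" "E = (*v) U ` coord_space I" using grassmannian_frame[OF assms] .
  have e: "(\<lambda>y. x + y) ` E = (\<lambda>v. x + U *v v) ` coord_space I" by (simp add: U(2) image_image)
  show "(\<lambda>y. x + y) ` E \<in> affine_grassmannian (card I)" unfolding e by (rule frame_in_affine_grassmannian[OF U(1)])
  show "direction ((\<lambda>y. x + y) ` E) = E" unfolding e direction_frame by (simp add: U(2))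
qed

lemma measurable_translate_flats:
  fixes I :: "'n::finite set"
  shows "(\<lambda>(E, x). (\<lambda>y. x + y) ` E) \<in> flats_borel (grassmannian (card I)) \<Otimes>\<^sub>M (borel :: (real ^ 'n) measure)
    \<rightarrow>\<^sub>M flats_borel (affine_grassmannian (card I))"
  by (intro measurable_flats_translate translate_grassmannian)

lemma measurable_translate_flat:
  fixes I :: "'n::finite set"
  assumes E: "E \<in> grassmannian (card I)"
  shows "(\<lambda>x :: real ^ 'n. (\<lambda>y. x + y) ` E) \<in> borel \<rightarrow>\<^sub>M flats_borel (affine_grassmannian (card I))"
proof -
  have "(\<lambda>x :: real ^ 'n. (E, x)) \<in> borel \<rightarrow>\<^sub>M flats_borel (grassmannian (card I)) \<Otimes>\<^sub>M borel"
    using E by (intro measurable_Pair) auto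
  from measurable_comp[OF this measurable_translate_flats] show ?thesis by (simp add: comp_def)
qed

text \<open>Integration over the quotient by \<open>E\<close> is integration over the whole space against a weight of
  constant mass on the translates of \<open>E\<close>.\<close>

lemma nn_integral_flat_quotient:
  fixes U :: "real ^ 'n::finite ^ 'n"
  assumes U: "orthogonal_matrix U"
    and \<psi>[measurable]: "\<psi> \<in> borel_measurable (flats_borel (affine_grassmannian (card I)))"
    and \<rho>[measurable]: "\<rho> \<in> borel_measurable borel"
    and \<kappa>: "\<And>w. (\<integral>\<^sup>+c. \<rho> (U *v (cproj I *v c) + U *v (cproj (- I) *v w)) \<partial>clebesgue I) = \<kappa>"
  shows "(\<integral>\<^sup>+x. \<psi> ((\<lambda>y. x + y) ` (*v) U ` coord_space I) * \<rho> x \<partial>lborel) =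
    \<kappa> * (\<integral>\<^sup>+w. \<psi> ((\<lambda>y. U *v (cproj (- I) *v w) + y) ` (*v) U ` coord_space I) \<partial>clebesgue (- I))"
proof -
  let ?E = "(*v) U ` coord_space I" and ?P = "cproj I :: real ^ 'n ^ 'n" and ?Q = "cproj (- I) :: real ^ 'n ^ 'n"
  interpret L: sigma_finite_measure "clebesgue I" by (rule sigma_finite_clebesgue)
  interpret L': sigma_finite_measure "clebesgue (- I)" by (rule sigma_finite_clebesgue)
  interpret P: pair_sigma_finite "clebesgue (- I)" "clebesgue I" ..
  have sE: "subspace ?E" by (intro linear_subspace_image) auto
  have EG: "?E \<in> grassmannian (card I)"
    using orthogonal_matrix_det[OF U] by (intro grassmannian_linear_image coord_space_grassmannian) auto
  note measurable_translate_flat[OF EG, measurable]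
  have abs: "(\<lambda>y. U *v (?P *v c) + U *v (?Q *v w) + y) ` ?E = (\<lambda>y. U *v (?Q *v w) + y) ` ?E" for c w
    by (rule translate_subspace_absorb[OF sE]) (auto simp: coord_space_def)
  have "(\<integral>\<^sup>+x. \<psi> ((\<lambda>y. x + y) ` ?E) * \<rho> x \<partial>lborel) = (\<integral>\<^sup>+x. \<psi> ((\<lambda>y. U *v x + y) ` ?E) * \<rho> (U *v x) \<partial>lborel)"
    by (rule nn_integral_lborel_orthogonal[OF U, symmetric]) measurable
  also have "\<dots> = (\<integral>\<^sup>+c. \<integral>\<^sup>+w. \<psi> ((\<lambda>y. U *v (?P *v c + ?Q *v w) + y) ` ?E) * \<rho> (U *v (?P *v c + ?Q *v w)) \<partial>clebesgue (- I) \<partial>clebesgue I)"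
    by (rule nn_integral_lborel_split) measurable
  also have "\<dots> = (\<integral>\<^sup>+c. \<integral>\<^sup>+w. \<psi> ((\<lambda>y. U *v (?Q *v w) + y) ` ?E) * \<rho> (U *v (?P *v c) + U *v (?Q *v w)) \<partial>clebesgue (- I) \<partial>clebesgue I)"
    by (simp only: matrix_vector_right_distrib abs)
  also have "\<dots> = (\<integral>\<^sup>+w. \<integral>\<^sup>+c. \<psi> ((\<lambda>y. U *v (?Q *v w) + y) ` ?E) * \<rho> (U *v (?P *v c) + U *v (?Q *v w)) \<partial>clebesgue I \<partial>clebesgue (- I))"
    by (rule P.Fubini') measurable
  also have "\<dots> = (\<integral>\<^sup>+w. \<psi> ((\<lambda>y. U *v (?Q *v w) + y) ` ?E) * \<kappa> \<partial>clebesgue (- I))"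
    by (intro nn_integral_cong) (subst nn_integral_cmult, measurable, simp only: \<kappa>)
  also have "\<dots> = \<kappa> * (\<integral>\<^sup>+w. \<psi> ((\<lambda>y. U *v (?Q *v w) + y) ` ?E) \<partial>clebesgue (- I))"
    by (subst nn_integral_multc) (auto simp: mult.commute)
  finally show ?thesis .
qed

text \<open>A cylinder around the orthogonal complement of \<open>E\<close>: on each translate of
  \<open>E\<close> it has the volume of the unit ball. With this weight the measure on translates is
  written over the fixed space R^n, jointly measurable in \<open>E\<close> and
  \<open>x\<close>.\<close>

definition slab :: "(real ^ 'n::finite) set \<Rightarrow> real ^ 'n \<Rightarrow> ennreal" where
  "slab E x = (if norm (prj E *v x) \<le> 1 then 1 else 0)"

lemma measurable_slab [measurable]:
  "(\<lambda>(E, x). slab E x) \<in> borel_measurable (flats_borel (grassmannian k) \<Otimes>\<^sub>M borel)"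
  unfolding slab_def by measurable

lemma measurable_slab' [measurable]: "slab E \<in> borel_measurable borel"
  unfolding slab_def[abs_def] by measurable

lemma slab_mass:
  fixes U :: "real ^ 'n::finite ^ 'n"
  assumes U: "orthogonal_matrix U"
  shows "(\<integral>\<^sup>+c. slab ((*v) U ` coord_space I) (U *v (cproj I *v c) + U *v (cproj (- I) *v w)) \<partial>clebesgue I)
    = ballvol I (cproj I)"
proof -
  have [measurable]: "{c :: real ^ 'n. norm (cproj I *v c) \<le> 1} \<in> sets borel" by measurable
  have "prj ((*v) U ` coord_space I) *v (U *v (cproj I *v c) + U *v (cproj (- I) *v w)) = U *v (cproj I *v c)" for c
    unfolding prj_frame[OF U] matrix_vector_right_distrib matrix_vector_mul_assoc[symmetric] orthogonal_matrix_cancel(5)[OF U]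
    by (simp add: matrix_vector_mul_assoc)
  then have "slab ((*v) U ` coord_space I) (U *v (cproj I *v c) + U *v (cproj (- I) *v w)) =
      indicator {c. norm (cproj I *v c) \<le> 1} c" for c
    by (simp add: slab_def orthogonal_matrix_norm[OF U] indicator_def)
  then show ?thesis by (simp add: ballvol_def)
qed

text \<open>Dividing by the fibre mass of the weight leaves exactly the measure on the quotient by
  \<open>E\<close>.\<close>

definition affine_haar :: "'n::finite set \<Rightarrow> (real ^ 'n) set measure" where
  "affine_haar I = distr (density (frame_haar I \<Otimes>\<^sub>M lborel) (\<lambda>(E, x). slab E x / ballvol I (cproj I)))
     (flats_borel (affine_grassmannian (card I))) (\<lambda>(E, x). (\<lambda>y. x + y) ` E)"

lemma sets_affine_haar [simp, measurable_cong]: "sets (affine_haar I) = sets (flats_borel (affine_grassmannian (card I)))"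
  and space_affine_haar [simp]: "space (affine_haar I) = affine_grassmannian (card I)"
  by (simp_all add: affine_haar_def)

lemma measurable_flat_average:
  fixes I :: "'n::finite set"
  assumes \<psi>[measurable]: "\<psi> \<in> borel_measurable (flats_borel (affine_grassmannian (card I)))"
  shows "(\<lambda>E :: (real ^ 'n) set. \<integral>\<^sup>+x. \<psi> ((\<lambda>y. x + y) ` E) * slab E x \<partial>lborel)
    \<in> borel_measurable (flats_borel (grassmannian (card I)))"
proof -
  have "(\<lambda>(E, x :: real ^ 'n). \<psi> ((\<lambda>y. x + y) ` E)) \<in> borel_measurable (flats_borel (grassmannian (card I)) \<Otimes>\<^sub>M borel)"
    using measurable_comp[OF measurable_translate_flats \<psi>] by (simp add: comp_def case_prod_beta')
  then have "(\<lambda>(E, x :: real ^ 'n). \<psi> ((\<lambda>y. x + y) ` E) * slab E x) \<in> borel_measurable (flats_borel (grassmannian (card I)) \<Otimes>\<^sub>M borel)"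
    using measurable_slab[of "card I"] by (simp add: case_prod_beta')
  then show ?thesis
    by (intro lborel.borel_measurable_nn_integral) (simp cong: measurable_cong_sets)
qed

lemma nn_integral_affine_haar:
  fixes I :: "'n::finite set"
  assumes \<psi>[measurable]: "\<psi> \<in> borel_measurable (flats_borel (affine_grassmannian (card I)))"
  shows "(\<integral>\<^sup>+F. \<psi> F \<partial>affine_haar I) =
    (\<integral>\<^sup>+E. (\<integral>\<^sup>+x. \<psi> ((\<lambda>y. x + y) ` E) * slab E x \<partial>lborel) / ballvol I (cproj I) \<partial>frame_haar I)"
proof -
  interpret prob_space "frame_haar I" by (rule prob_space_frame_haar)
  let ?M = "frame_haar I \<Otimes>\<^sub>M (lborel :: (real ^ 'n) measure)" and ?\<omega> = "ballvol I (cproj I)"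
  have sM: "sets ?M = sets (flats_borel (grassmannian (card I)) \<Otimes>\<^sub>M borel)" by (intro sets_pair_measure_cong) auto
  have t: "(\<lambda>(E, x :: real ^ 'n). (\<lambda>y. x + y) ` E) \<in> ?M \<rightarrow>\<^sub>M flats_borel (affine_grassmannian (card I))"
    using measurable_translate_flats[of I] sM by (simp cong: measurable_cong_sets)
  have s: "(\<lambda>(E, x :: real ^ 'n). slab E x) \<in> borel_measurable ?M"
    using measurable_slab[of "card I"] sM by (simp cong: measurable_cong_sets)
  have \<psi>t: "(\<lambda>(E, x :: real ^ 'n). \<psi> ((\<lambda>y. x + y) ` E)) \<in> borel_measurable ?M"
    using measurable_comp[OF t \<psi>] by (simp add: comp_def case_prod_beta')
  note s[unfolded case_prod_beta', measurable] \<psi>t[unfolded case_prod_beta', measurable]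
  have "(\<integral>\<^sup>+F. \<psi> F \<partial>affine_haar I) = (\<integral>\<^sup>+p. \<psi> ((\<lambda>y. snd p + y) ` fst p) \<partial>density ?M (\<lambda>(E, x). slab E x / ?\<omega>))"
    unfolding affine_haar_def using t by (subst nn_integral_distr) (auto simp: case_prod_beta')
  also have "\<dots> = (\<integral>\<^sup>+p. slab (fst p) (snd p) / ?\<omega> * \<psi> ((\<lambda>y. snd p + y) ` fst p) \<partial>?M)"
    unfolding case_prod_beta' by (rule nn_integral_density) measurable
  also have "\<dots> = (\<integral>\<^sup>+E. \<integral>\<^sup>+x. slab E x / ?\<omega> * \<psi> ((\<lambda>y. x + y) ` E) \<partial>lborel \<partial>frame_haar I)"
    by (subst lborel.nn_integral_fst[symmetric]) auto
  also have "\<dots> = (\<integral>\<^sup>+E. (\<integral>\<^sup>+x. \<psi> ((\<lambda>y. x + y) ` E) * slab E x \<partial>lborel) / ?\<omega> \<partial>frame_haar I)"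
  proof (intro nn_integral_cong)
    fix E assume "E \<in> space (frame_haar I)"
    then have "E \<in> grassmannian (card I)" by simp
    note measurable_comp[OF measurable_translate_flat[OF this] \<psi>, unfolded comp_def, measurable]
    have "(\<integral>\<^sup>+x. slab E x / ?\<omega> * \<psi> ((\<lambda>y. x + y) ` E) \<partial>lborel) = (\<integral>\<^sup>+x. \<psi> ((\<lambda>y. x + y) ` E) * slab E x / ?\<omega> \<partial>lborel)"
      by (intro nn_integral_cong) (simp add: ennreal_divide_times mult.commute ennreal_times_divide)
    also have "\<dots> = (\<integral>\<^sup>+x. \<psi> ((\<lambda>y. x + y) ` E) * slab E x \<partial>lborel) / ?\<omega>"
      by (rule nn_integral_divide) measurable
    finally show "(\<integral>\<^sup>+x. slab E x / ?\<omega> * \<psi> ((\<lambda>y. x + y) ` E) \<partial>lborel) = \<dots>" .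
  qed
  finally show ?thesis .
qed

text \<open>\<open>measure_of\<close> yields the zero measure unless the given set function is
  countably additive; agreement with an image measure on all measurable sets supplies this.\<close>

lemma affine_grassmannian_measure_eq:
  "affine_grassmannian_measure (card I) = affine_haar (I :: 'n::finite set)"
proof -
  let ?AG = "affine_grassmannian (card I) :: (real ^ 'n) set set" and ?\<omega> = "ballvol I (cproj I)"
  let ?f = "\<lambda>A. \<integral>\<^sup>+ E. emeasure (flat_lebesgue (E\<^sup>\<bottom>)) {x \<in> E\<^sup>\<bottom>. (\<lambda>y. x + y) ` E \<in> A} \<partial>grassmannian_haar (card I)"
  have f: "?f A = emeasure (affine_haar I) A" if A: "A \<in> sets (flats_borel ?AG)" for A
  proof -
    have [measurable]: "indicator A \<in> borel_measurable (flats_borel ?AG)" using A by simp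
    have "?f A = (\<integral>\<^sup>+E. (\<integral>\<^sup>+x. indicator A ((\<lambda>y. x + y) ` E) * slab E x \<partial>lborel) / ?\<omega> \<partial>frame_haar I)"
      unfolding grassmannian_haar_eq
    proof (intro nn_integral_cong)
      fix E assume "E \<in> space (frame_haar I)"
      then have EG: "E \<in> grassmannian (card I)" by simp
      obtain U where U: "orthogonal_matrix U" and E: "E = (*v) U ` coord_space I" using grassmannian_frame[OF EG] .
      let ?S = "{x \<in> E\<^sup>\<bottom>. (\<lambda>y. x + y) ` E \<in> A}"
      have Ec: "E\<^sup>\<bottom> = (*v) U ` coord_space (- I)" unfolding E by (rule orthogonal_comp_frame[OF U])
      have "E\<^sup>\<bottom> = (\<lambda>v. 0 + U *v v) ` coord_space (- I)" unfolding Ec by simp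
      from flat_lebesgue_frame[OF U this] have L: "flat_lebesgue (E\<^sup>\<bottom>) = completion (flatm (- I) 0 U)" .
      have "subspace (E\<^sup>\<bottom>)" unfolding Ec by (intro linear_subspace_image) auto
      then have "E\<^sup>\<bottom> \<in> sets borel" by (intro borel_closed closed_subspace)
      moreover have "{x. (\<lambda>y. x + y) ` E \<in> A} \<in> sets borel"
        using measurable_sets[OF measurable_translate_flat[OF EG] A] by (simp add: vimage_def)
      moreover have "?S = E\<^sup>\<bottom> \<inter> {x. (\<lambda>y. x + y) ` E \<in> A}" by auto
      ultimately have S: "?S \<in> sets borel" by auto
      then have mS[measurable]: "indicator ?S \<in> borel_measurable borel" by simp
      have "emeasure (flat_lebesgue (E\<^sup>\<bottom>)) ?S = emeasure (flatm (- I) 0 U) ?S" unfolding L using S by simp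
      also have "\<dots> = (\<integral>\<^sup>+w. indicator ?S (0 + U *v w) \<partial>clebesgue (- I))" by (rule emeasure_flatm[OF S])
      also have "\<dots> = (\<integral>\<^sup>+w. indicator ?S (0 + U *v (cproj (- I) *v w)) \<partial>clebesgue (- I))"
        by (rule nn_integral_clebesgue_cproj[symmetric]) measurable
      also have "\<dots> = (\<integral>\<^sup>+w. indicator A ((\<lambda>y. U *v (cproj (- I) *v w) + y) ` E) \<partial>clebesgue (- I))"
      proof (intro nn_integral_cong)
        fix w
        have "U *v (cproj (- I) *v w) \<in> E\<^sup>\<bottom>" unfolding Ec coord_space_def by blast
        then show "indicator ?S (0 + U *v (cproj (- I) *v w)) = (indicator A ((\<lambda>y. U *v (cproj (- I) *v w) + y) ` E) :: ennreal)"
          by (simp add: indicator_def)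
      qed
      also have "\<dots> = (\<integral>\<^sup>+x. indicator A ((\<lambda>y. x + y) ` E) * slab E x \<partial>lborel) / ?\<omega>"
      proof -
        have "(\<integral>\<^sup>+x. indicator A ((\<lambda>y. x + y) ` E) * slab E x \<partial>lborel) =
          ?\<omega> * (\<integral>\<^sup>+w. indicator A ((\<lambda>y. U *v (cproj (- I) *v w) + y) ` E) \<partial>clebesgue (- I))"
          unfolding E by (rule nn_integral_flat_quotient[OF U]) (auto simp: slab_mass[OF U])
        then show ?thesis using ballvol_cproj_pos[of I] ballvol_cproj_finite[of I]
          by (simp add: mult.commute[of ?\<omega>] mult_divide_eq_ennreal)
      qed
      finally show "emeasure (flat_lebesgue (E\<^sup>\<bottom>)) ?S = (\<integral>\<^sup>+x. indicator A ((\<lambda>y. x + y) ` E) * slab E x \<partial>lborel) / ?\<omega>" .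
    qed
    also have "\<dots> = (\<integral>\<^sup>+F. indicator A F \<partial>affine_haar I)" by (rule nn_integral_affine_haar[symmetric]) measurable
    finally show ?thesis using A by simp
  qed
  have "affine_grassmannian_measure (card I) = measure_of ?AG (sets (flats_borel ?AG)) (emeasure (affine_haar I))"
    unfolding affine_grassmannian_measure_def
  proof (rule measure_of_eq)
    show "sets (flats_borel ?AG) \<subseteq> Pow ?AG" using sets.space_closed[of "flats_borel ?AG"] by simp
    fix a assume "a \<in> sigma_sets ?AG (sets (flats_borel ?AG))"
    then show "?f a = emeasure (affine_haar I) a"
      using f sets.sigma_sets_eq[of "flats_borel ?AG"] by simp
  qed
  also have "\<dots> = affine_haar I" using measure_of_of_measure[of "affine_haar I"] by simp
  finally show ?thesis .
qed

text \<open>The quotient formula is used on the image of \<open>E\<close> with two weights: the slab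
  of \<open>E\<close> carried over by \<open>g\<close> and the slab of the image. Their fibre masses
  differ by the Jacobian \<open>b\<close>, which uses up one of the \<open>CARD('n) + 1\<close>
  powers of its reciprocal; the others form the density on the Grassmannian.\<close>

lemma affine_haar_affine:
  fixes H :: "real ^ 'n::finite ^ 'n" and a :: "real ^ 'n"
  assumes H: "\<bar>det H\<bar> = 1" and \<psi>: "\<psi> \<in> borel_measurable (flats_borel (affine_grassmannian (card (I :: 'n set))))"
  defines "g \<equiv> \<lambda>x. H *v x + a"
  shows "(\<integral>\<^sup>+F. \<psi> (g ` F) * jac_density H (direction F) ^ (CARD('n) + 1) \<partial>affine_haar I) = (\<integral>\<^sup>+F. \<psi> F \<partial>affine_haar I)"
proof -
  note \<psi>[measurable]
  let ?AG = "affine_grassmannian (card I) :: (real ^ 'n) set set" and ?G = "grassmannian (card I) :: (real ^ 'n) set set"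
  let ?\<omega> = "ballvol I (cproj I)" and ?w = "jac_density H" and ?P = "cproj I :: real ^ 'n ^ 'n" and ?Q = "cproj (- I) :: real ^ 'n ^ 'n"
  let ?A = "\<lambda>E. \<integral>\<^sup>+x. \<psi> ((\<lambda>y. x + y) ` E) * slab E x \<partial>lborel"
  have H0: "det H \<noteq> 0" using H by auto
  obtain B where B: "H ** B = mat 1" "B ** H = mat 1" "det B \<noteq> 0" using matrix_inverse_pair[OF H0] .
  have g_cont: "continuous_on UNIV g"
    unfolding g_def by (intro continuous_intros linear_continuous_on) (auto simp: linear_linear)
  have mg[measurable]: "(`) g \<in> flats_borel ?AG \<rightarrow>\<^sub>M flats_borel ?AG"
    using affine_image_in_grassmannian[OF _ H0] g_cont by (intro measurable_flats_image) (auto simp: g_def)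
  have mdir[measurable]: "direction \<in> flats_borel ?AG \<rightarrow>\<^sub>M flats_borel ?G"
    by (intro measurable_direction grassmannian_iff_direction)
  have step: "(\<integral>\<^sup>+x. \<psi> (g ` (\<lambda>y. x + y) ` E) * ?w (direction ((\<lambda>y. x + y) ` E)) ^ (CARD('n) + 1) * slab E x \<partial>lborel)
     = ?A ((*v) H ` E) * ?w E ^ CARD('n)" if EG: "E \<in> ?G" for E
  proof -
    obtain U where U: "orthogonal_matrix U" and E: "E = (*v) U ` coord_space I" using grassmannian_frame[OF EG] .
    have sE: "subspace E" "dim E = card I" using EG by (auto simp: grassmannian_def)
    obtain V b where V: "orthogonal_matrix V" and b: "0 < b"
      and img: "\<And>a c. (\<lambda>x. H *v x + c) ` (\<lambda>v. a + U *v v) ` coord_space I = (\<lambda>v. (H *v a + c) + V *v v) ` coord_space I"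
      and bj: "ennreal b * jacvol H ((*v) U ` coord_space I) = jacvol (mat 1) ((*v) U ` coord_space I)"
      and fl: "\<And>a c. flatm I (H *v a + c) V = scale_measure (ennreal b) (distr (flatm I a U) borel (\<lambda>x. H *v x + c))"
      using affine_image_frame[OF U H0, of I] by metis
    have bw: "ennreal b * ?w E = 1" using jac_density_cancel(1)[OF sE b] bj by (simp add: E)
    let ?E' = "(*v) H ` E"
    have E': "?E' = (*v) V ` coord_space I" unfolding E using img[of 0 0] by (simp add: image_image)
    have E'G: "?E' \<in> ?G" by (rule grassmannian_linear_image[OF H0 EG])
    note measurable_comp[OF measurable_translate_flat[OF EG] measurable_comp[OF mg \<psi>], unfolded comp_def, measurable]
    note m'[measurable] = measurable_comp[OF measurable_translate_flat[OF E'G] \<psi>, unfolded comp_def]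
    \<comment> \<open>The slab of \<open>E\<close> composed with the inverse of
      \<open>g\<close>.\<close>
    let ?\<rho> = "\<lambda>x. slab E (B *v (x - a))"
    have gx: "g ` (\<lambda>y. x + y) ` E = (\<lambda>y. g x + y) ` ?E'" for x
      unfolding g_def by (simp add: image_image matrix_vector_right_distrib add_ac)
    have "(\<integral>\<^sup>+x. \<psi> (g ` (\<lambda>y. x + y) ` E) * slab E x \<partial>lborel) = (\<integral>\<^sup>+x. \<psi> ((\<lambda>y. g x + y) ` ?E') * ?\<rho> (g x) \<partial>lborel)"
      unfolding gx unfolding g_def affine_image_inverse(1)[OF B(1,2)] ..
    also have "\<dots> = ennreal \<bar>det H\<bar> * (\<integral>\<^sup>+x. \<psi> ((\<lambda>y. (H *v x + a) + y) ` ?E') * ?\<rho> (H *v x + a) \<partial>lborel)"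
      by (simp add: H g_def)
    also have "\<dots> = (\<integral>\<^sup>+x. \<psi> ((\<lambda>y. (x + a) + y) ` ?E') * ?\<rho> (x + a) \<partial>lborel)"
      by (rule nn_integral_lborel_linear[OF H0, of "\<lambda>x. \<psi> ((\<lambda>y. (x + a) + y) ` ?E') * ?\<rho> (x + a)"])
         (use measurable_comp[OF _ m', of "\<lambda>x. x + a" borel] in \<open>simp add: comp_def\<close>)
    also have "\<dots> = (\<integral>\<^sup>+x. \<psi> ((\<lambda>y. x + y) ` ?E') * ?\<rho> x \<partial>distr lborel borel ((+) a))"
      by (subst nn_integral_distr) (auto simp: add.commute[of a])
    also have "\<dots> = (\<integral>\<^sup>+x. \<psi> ((\<lambda>y. x + y) ` ?E') * ?\<rho> x \<partial>lborel)" by (simp add: lborel_distr_plus)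
    also have "\<dots> = (ennreal b * ?\<omega>) * (\<integral>\<^sup>+w. \<psi> ((\<lambda>y. V *v (?Q *v w) + y) ` ?E') \<partial>clebesgue (- I))"
      unfolding E'
    proof (rule nn_integral_flat_quotient[OF V])
      fix w
      \<comment> \<open>The offset caused by \<open>w\<close> and \<open>a\<close> is a vector of
        \<open>E\<close>, so translation invariance along \<open>E\<close> makes the fibre mass
        independent of \<open>w\<close>.\<close>
      define e0 where "e0 = prj E *v (B *v (V *v (?Q *v w) - a))"
      have "e0 \<in> E" unfolding e0_def by (rule prj_in[OF sE(1)])
      then obtain d where d: "e0 = U *v (?P *v d)" unfolding E coord_space_def by auto
      let ?K = "\<lambda>x. if norm (prj E *v (B *v x) + e0) \<le> 1 then 1 else 0 :: ennreal"
      have [measurable]: "?K \<in> borel_measurable borel" by measurable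
      have pU: "prj E *v (U *v c) = U *v (?P *v c)" for c
        unfolding E prj_frame[OF U] using orthogonal_matrix_cancel(5)[OF U]
        by (simp add: matrix_vector_mul_assoc[symmetric] del: transpose_matrix_vector)
      have S[measurable]: "{c :: real ^ 'n. norm (?P *v c) \<le> 1} \<in> sets borel" by measurable
      have "(\<integral>\<^sup>+c. ?\<rho> (V *v (?P *v c) + V *v (?Q *v w)) \<partial>clebesgue I) = (\<integral>\<^sup>+c. ?K (V *v (?P *v c)) \<partial>clebesgue I)"
        by (simp add: slab_def e0_def matrix_vector_right_distrib[symmetric] add_diff_eq)
      also have "\<dots> = (\<integral>\<^sup>+c. ?K (0 + V *v c) \<partial>clebesgue I)"
        using nn_integral_clebesgue_cproj[of "\<lambda>c. ?K (V *v c)" I] by simp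
      also have "\<dots> = (\<integral>\<^sup>+x. ?K x \<partial>flatm I 0 V)" by (rule nn_integral_flatm[symmetric]) measurable
      also have "\<dots> = (\<integral>\<^sup>+x. ?K x \<partial>scale_measure (ennreal b) (distr (flatm I 0 U) borel (\<lambda>x. H *v x + 0)))"
        using fl[of 0 0] by simp
      also have "\<dots> = ennreal b * (\<integral>\<^sup>+x. ?K (H *v x) \<partial>flatm I 0 U)"
        by (subst nn_integral_scale_measure) (auto simp: nn_integral_distr)
      also have "(\<integral>\<^sup>+x. ?K (H *v x) \<partial>flatm I 0 U) = (\<integral>\<^sup>+c. ?K (H *v (0 + U *v c)) \<partial>clebesgue I)"
        by (rule nn_integral_flatm) measurable
      also have "\<dots> = (\<integral>\<^sup>+c. indicator {c. norm (?P *v c) \<le> 1} (c + ?P *v d) \<partial>clebesgue I)"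
      proof (intro nn_integral_cong)
        fix c
        have "prj E *v (B *v (H *v (0 + U *v c))) + e0 = U *v (?P *v (c + ?P *v d))"
          using pU[of c] B(2) by (simp add: d matrix_vector_mul_assoc[of B H] matrix_vector_right_distrib)
        then show "?K (H *v (0 + U *v c)) = indicator {c. norm (?P *v c) \<le> 1} (c + ?P *v d)"
          by (simp add: orthogonal_matrix_norm[OF U] indicator_def)
      qed
      also have "\<dots> = ?\<omega>" using nn_integral_clebesgue_add[of "indicator {c. norm (?P *v c) \<le> 1}" I d] by (simp add: ballvol_def)
      finally show "(\<integral>\<^sup>+c. ?\<rho> (V *v (?P *v c) + V *v (?Q *v w)) \<partial>clebesgue I) = ennreal b * ?\<omega>" .
    qed measurable
    also have "\<dots> = ennreal b * ?A ?E'"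
      unfolding E' by (subst nn_integral_flat_quotient[OF V \<psi> measurable_slab' slab_mass[OF V]]) (simp add: mult.assoc)
    finally have 1: "(\<integral>\<^sup>+x. \<psi> (g ` (\<lambda>y. x + y) ` E) * slab E x \<partial>lborel) = ennreal b * ?A ?E'" .
    have "(\<integral>\<^sup>+x. \<psi> (g ` (\<lambda>y. x + y) ` E) * ?w (direction ((\<lambda>y. x + y) ` E)) ^ (CARD('n) + 1) * slab E x \<partial>lborel)
      = (\<integral>\<^sup>+x. \<psi> (g ` (\<lambda>y. x + y) ` E) * slab E x * ?w E ^ (CARD('n) + 1) \<partial>lborel)"
      by (simp add: translate_grassmannian(2)[OF EG] mult_ac)
    also have "\<dots> = ennreal b * ?A ?E' * ?w E ^ (CARD('n) + 1)"
      unfolding 1[symmetric] by (rule nn_integral_multc) measurable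
    also have "\<dots> = ?A ?E' * ?w E ^ CARD('n) * (ennreal b * ?w E)" by (simp add: mult_ac)
    finally show ?thesis by (simp add: bw)
  qed
  have "(\<integral>\<^sup>+F. \<psi> (g ` F) * ?w (direction F) ^ (CARD('n) + 1) \<partial>affine_haar I)
    = (\<integral>\<^sup>+E. ?A ((*v) H ` E) * ?w E ^ CARD('n) / ?\<omega> \<partial>frame_haar I)"
  proof -
    have "(\<lambda>F. \<psi> (g ` F) * ?w (direction F) ^ (CARD('n) + 1)) \<in> borel_measurable (flats_borel ?AG)" by measurable
    from nn_integral_affine_haar[OF this] show ?thesis
      by (rule trans) (intro nn_integral_cong, simp only: step space_frame_haar)
  qed
  also have "\<dots> = (\<integral>\<^sup>+E. (?A ((*v) H ` E) / ?\<omega>) * ?w E ^ CARD('n) \<partial>frame_haar I)"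
    by (simp add: ennreal_divide_times ennreal_times_divide mult.commute)
  also have "\<dots> = (\<integral>\<^sup>+E. ?A E / ?\<omega> \<partial>frame_haar I)"
  proof (rule frame_haar_linear[OF H])
    have "(\<lambda>E. u E / ?\<omega>) \<in> borel_measurable (flats_borel ?G)"
      if "u \<in> borel_measurable (flats_borel ?G)" for u using that by measurable
    then show "(\<lambda>E. ?A E / ?\<omega>) \<in> borel_measurable (flats_borel ?G)" using measurable_flat_average[OF \<psi>] .
  qed
  also have "\<dots> = (\<integral>\<^sup>+F. \<psi> F \<partial>affine_haar I)" by (rule nn_integral_affine_haar[OF \<psi>, symmetric])
  finally show ?thesis .
qed

text \<open>The unit cube decides: its image is negligible when \<open>H\<close> is singular and has
  volume \<open>\<bar>det H\<bar>\<close> otherwise.\<close>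

lemma affine_volume_preserving_det:
  fixes H :: "real ^ 'n::finite ^ 'n"
  assumes "volume_preserving (\<lambda>x. H *v x + a)"
  shows "\<bar>det H\<bar> = 1"
proof -
  let ?g = "\<lambda>x. H *v x + a" and ?C = "cbox 0 One :: (real ^ 'n) set"
  have C: "?C \<in> sets lebesgue" "emeasure lebesgue ?C = 1" by (auto simp: emeasure_lborel_cbox_eq)
  have "continuous_on UNIV ?g" by (intro continuous_intros linear_continuous_on) (auto simp: linear_linear)
  then have "compact (?g ` ?C)" by (intro compact_continuous_image) (auto intro: continuous_on_subset)
  then have gC[measurable]: "?g ` ?C \<in> sets borel" by (intro borel_closed compact_imp_closed)
  have "emeasure lebesgue (?g ` ?C) = emeasure lebesgue ?C" using assms C(1) unfolding volume_preserving_def by blast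
  then have e1: "emeasure lborel (?g ` ?C) = 1" using C(2) gC by simp
  have "det H \<noteq> 0"
  proof
    assume "det H = 0"
    then have "\<not> inj ((*v) H)" using det_nz_iff_inj[of "(*v) H"] by simp
    then have "negligible ((*v) H ` ?C)" by (intro negligible_linear_singular_image) auto
    then have "negligible ((+) a ` (*v) H ` ?C)" by (rule negligible_translation)
    also have "(+) a ` (*v) H ` ?C = ?g ` ?C" by (auto simp: image_image add.commute)
    finally show False using e1 gC by (simp add: negligible_iff_null_sets null_sets_def)
  qed
  then have inj: "inj ((*v) H)" using det_nz_iff_inj[of "(*v) H"] by simp
  then have "inj ?g" by (auto simp: inj_def)
  then have in_iff: "?g x \<in> ?g ` ?C \<longleftrightarrow> x \<in> ?C" for x by (rule inj_image_mem_iff)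
  have "1 = (\<integral>\<^sup>+x. indicator (?g ` ?C) x \<partial>distr lborel borel ((+) a))" using e1 by (simp add: lborel_distr_plus)
  also have "\<dots> = (\<integral>\<^sup>+x. indicator (?g ` ?C) (a + x) \<partial>lborel)" by (rule nn_integral_distr) auto
  also have "\<dots> = ennreal \<bar>det H\<bar> * (\<integral>\<^sup>+x. indicator (?g ` ?C) (a + H *v x) \<partial>lborel)"
    by (rule nn_integral_lborel_linear[OF \<open>det H \<noteq> 0\<close>, symmetric]) measurable
  also have "(\<integral>\<^sup>+x. indicator (?g ` ?C) (a + H *v x) \<partial>lborel) = (\<integral>\<^sup>+x. indicator ?C x \<partial>lborel)"
    using in_iff by (intro nn_integral_cong) (simp add: indicator_def add.commute[of a])
  also have "\<dots> = 1" using C(2) by simp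
  finally have "ennreal \<bar>det H\<bar> = 1" by simp
  then show ?thesis by (simp add: ennreal_eq_1)
qed

theorem mainTheorem4:
  fixes f :: "real ^ 'n \<Rightarrow> real" and k :: nat
  assumes "1 \<le> k" and "k \<le> CARD('n) - 1"
    and "\<And>x. 0 \<le> f x" and "bounded (range f)" and "integrable lebesgue f"
  shows "(\<forall>g. linear g \<and> volume_preserving g \<longrightarrow> Phi k (f \<circ> inv g) = Phi k f) \<and>
         (\<forall>g. affine_map g \<and> volume_preserving g \<longrightarrow> Psi k (f \<circ> inv g) = Psi k f)"
proof -
  have "k \<le> card (UNIV :: 'n set)" using assms(2) by simp
  \<comment> \<open>Any \<open>k\<close> of the coordinates may serve as the model subspace.\<close>
  then obtain I :: "'n set" where k: "k = card I" by (metis obtain_subset_with_card_n)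
  let ?m = "CARD('n) - k"
  have Phi: "Phi k h = (\<integral>\<^sup>+E. flat_ratio CARD('n) ?m h E \<partial>frame_haar I)" for h :: "real ^ 'n \<Rightarrow> real"
    unfolding Phi_def flat_ratio_def k grassmannian_haar_eq ..
  have Psi: "Psi k h = (\<integral>\<^sup>+F. flat_ratio (CARD('n) + 1) ?m h F \<partial>affine_haar I)" for h :: "real ^ 'n \<Rightarrow> real"
    unfolding Psi_def flat_ratio_def k affine_grassmannian_measure_eq ..
  show ?thesis
  proof (intro conjI allI impI; elim conjE)
    fix g :: "real ^ 'n \<Rightarrow> real ^ 'n" assume g: "linear g" "volume_preserving g"
    define H where "H = matrix g"
    have gH: "g = (\<lambda>x. H *v x + 0)" unfolding H_def using linear_matrix_ex[OF g(1)] by simp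
    have d: "\<bar>det H\<bar> = 1" using g(2) affine_volume_preserving_det[of H 0] gH by simp
    then have d0: "det H \<noteq> 0" by auto
    obtain B where B: "H ** B = mat 1" "B ** H = mat 1" "det B \<noteq> 0" using matrix_inverse_pair[OF d0] .
    \<comment> \<open>A subspace is a flat and its own direction, so the rule for flats applies with
      translation part 0.\<close>
    have sub: "E \<in> affine_grassmannian (card I)" "direction E = E" if "E \<in> grassmannian (card I)" for E :: "(real ^ 'n) set"
      using translate_grassmannian[OF that, of 0] by auto
    \<comment> \<open>The integrand is not known to be measurable in \<open>E\<close>, so the
      density formula reaches it by transport, with \<open>B\<close> providing the inverse
      bijection.\<close>
    have tr: "(\<integral>\<^sup>+E. flat_ratio CARD('n) ?m (f \<circ> inv g) ((*v) H ` E) * jac_density H E ^ CARD('n) \<partial>frame_haar I)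
      = (\<integral>\<^sup>+E. flat_ratio CARD('n) ?m (f \<circ> inv g) E \<partial>frame_haar I)"
    proof (rule nn_integral_transport[where T'="(`) ((*v) B)"])
      show "(`) ((*v) H) \<in> frame_haar I \<rightarrow>\<^sub>M frame_haar I" "(`) ((*v) B) \<in> frame_haar I \<rightarrow>\<^sub>M frame_haar I"
        using measurable_linear_flats[OF d0] measurable_linear_flats[OF B(3)] by (simp_all cong: measurable_cong_sets)
      show "(*v) B ` (*v) H ` x = x" "(*v) H ` (*v) B ` x = x" for x
        by (simp_all add: image_image matrix_vector_mul_assoc B)
      show "jac_density H x ^ CARD('n) \<noteq> 0 \<and> jac_density H x ^ CARD('n) \<noteq> top" if "x \<in> space (frame_haar I)" for x
        using jac_density_nz[OF _ d0, of x "card I"] that by (auto simp: power_eq_top_ennreal)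
      show "(\<integral>\<^sup>+E. \<psi> ((*v) H ` E) * jac_density H E ^ CARD('n) \<partial>frame_haar I) = (\<integral>\<^sup>+E. \<psi> E \<partial>frame_haar I)"
        if "\<psi> \<in> borel_measurable (frame_haar I)" for \<psi>
        using that by (intro frame_haar_linear[OF d]) (simp cong: measurable_cong_sets)
    qed measurable
    have "flat_ratio CARD('n) ?m (f \<circ> inv g) ((*v) H ` E) * jac_density H E ^ CARD('n) = flat_ratio CARD('n) ?m f E"
      if "E \<in> space (frame_haar I)" for E
      using flat_ratio_image[OF sub(1) d0, where p="CARD('n)" and m="?m" and f=f and c=0] sub(2) that by (simp add: gH)
    then show "Phi k (f \<circ> inv g) = Phi k f" unfolding Phi tr[symmetric] by (rule nn_integral_cong)
  next
    fix g :: "real ^ 'n \<Rightarrow> real ^ 'n" assume g: "affine_map g" "volume_preserving g"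
    then obtain h a where h: "linear h" "g = (\<lambda>x. h x + a)" by (auto simp: affine_map_def)
    define H where "H = matrix h"
    have gH: "g = (\<lambda>x. H *v x + a)" unfolding H_def h(2) using linear_matrix_ex[OF h(1)] by simp
    have d: "\<bar>det H\<bar> = 1" using g(2) affine_volume_preserving_det[of H a] gH by simp
    then have d0: "det H \<noteq> 0" by auto
    obtain B where B: "H ** B = mat 1" "B ** H = mat 1" "det B \<noteq> 0" using matrix_inverse_pair[OF d0] .
    let ?AG = "affine_grassmannian (card I) :: (real ^ 'n) set set"
    let ?g' = "\<lambda>x. B *v x + B *v (- a)"
    have g'g: "?g' (g x) = x" "g (?g' x) = x" for x
      using B by (simp_all add: gH matrix_vector_right_distrib[symmetric] matrix_vector_mul_assoc)
    have meas: "(`) (\<lambda>x. A *v x + c) \<in> affine_haar I \<rightarrow>\<^sub>M affine_haar I" if "det A \<noteq> 0" for A :: "real ^ 'n ^ 'n" and c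
    proof -
      have "(`) (\<lambda>x. A *v x + c) \<in> flats_borel ?AG \<rightarrow>\<^sub>M flats_borel ?AG"
        by (intro measurable_flats_image affine_image_in_grassmannian[OF _ that] continuous_intros linear_continuous_on)
           (auto simp: linear_linear)
      then show ?thesis by (simp cong: measurable_cong_sets)
    qed
    have dir: "direction \<in> affine_haar I \<rightarrow>\<^sub>M flats_borel (grassmannian (card I))"
      using measurable_direction[of ?AG, OF grassmannian_iff_direction] by (simp cong: measurable_cong_sets)
    note dir[measurable]
    have tr: "(\<integral>\<^sup>+F. flat_ratio (CARD('n) + 1) ?m (f \<circ> inv g) (g ` F) * jac_density H (direction F) ^ (CARD('n) + 1) \<partial>affine_haar I)
      = (\<integral>\<^sup>+F. flat_ratio (CARD('n) + 1) ?m (f \<circ> inv g) F \<partial>affine_haar I)"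
    proof (rule nn_integral_transport[where T'="(`) ?g'"])
      show "(`) g \<in> affine_haar I \<rightarrow>\<^sub>M affine_haar I" unfolding gH by (rule meas[OF d0])
      show "(`) ?g' \<in> affine_haar I \<rightarrow>\<^sub>M affine_haar I" by (rule meas[OF B(3)])
      show "?g' ` g ` x = x" "g ` ?g' ` x = x" for x by (simp_all add: image_image g'g)
      show "jac_density H (direction x) ^ (CARD('n) + 1) \<noteq> 0 \<and> jac_density H (direction x) ^ (CARD('n) + 1) \<noteq> top"
        if "x \<in> space (affine_haar I)" for x
        using jac_density_nz[OF grassmannian_iff_direction d0, of x I] that by (auto simp: power_eq_top_ennreal simp del: power_Suc)
      show "(\<integral>\<^sup>+F. \<psi> (g ` F) * jac_density H (direction F) ^ (CARD('n) + 1) \<partial>affine_haar I) = (\<integral>\<^sup>+F. \<psi> F \<partial>affine_haar I)"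
        if "\<psi> \<in> borel_measurable (affine_haar I)" for \<psi>
        unfolding gH using that by (intro affine_haar_affine[OF d]) (simp cong: measurable_cong_sets)
    qed measurable
    have "flat_ratio (CARD('n) + 1) ?m (f \<circ> inv g) (g ` F) * jac_density H (direction F) ^ (CARD('n) + 1) = flat_ratio (CARD('n) + 1) ?m f F"
      if "F \<in> space (affine_haar I)" for F
      unfolding gH using that by (intro flat_ratio_image[OF _ d0]) auto
    then show "Psi k (f \<circ> inv g) = Psi k f" unfolding Psi tr[symmetric] by (rule nn_integral_cong)
  qed
qed

end
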